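(* Let $\mathbb{K}$ be a field of characteristic zero, $\mathbb{F}$ an algebraic closure of $\mathbb{K}$, $\alpha\in\mathbb{F}$ algebraic of degree $n$ over $\mathbb{K}$ with conjugates $\alpha_0=\alpha,\dots,\alpha_{n-1}$, and $\sigma_i$ $\mathbb{K}$-automorphisms of $\mathbb{F}$ with $\sigma_i(\alpha)=\alpha_i$. Let $\mathcal{C}\subseteq\mathbb{F}^m$ be a rational curve of degree $d$ given by a proper parametrization $\psi=(n_1/d_1,\dots,n_m/d_m)\in\mathbb{K}(\alpha)(t)^m$. For a $\mathbb{K}$-automorphism $\sigma$ of $\mathbb{F}$ and $t_0\in\mathbb{F}$ with $d_l(t_0)\ne0$ for all $l$, put $g_{\sigma,t_0}(s)=\gcd\{\psi_l(t_0)d_l^{\sigma}(s)-n_l^{\sigma}(s):1\le l\le m\}\in\mathbb{F}[s]$. Call $t_0$ a good parameter for $\sigma$ if $\psi$ is defined at $t_0$, $\deg g_{\sigma,t_0}=1$ and $\psi(t_0)\ne\psi^{\sigma}(\infty)$; otherwise $t_0$ fails for $\sigma$. Then: (1) If $\mathcal{C}$ is defined over $\mathbb{K}$, then for each $i$ the map $u_i$ can be computed (by interpolation of a fractional linear transformation) from three pairs $(t_k,s_k)$, $t_k$ distinct, where $s_k$ is the unique solution of $\psi^{\sigma_i}(s)=\psi(t_k)$. (2) If $\mathcal{C}$ is defined over $\mathbb{K}$, then at most $d^2-2d+n+1$ parameters $t_0\in\mathbb{F}$ fail for some $\sigma_i$, $1\le i\le n-1$. (3) If $\mathcal{C}$ is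 not defined over $\mathbb{K}$ and $\sigma_i$ is such that $\mathcal{C}\ne\mathcal{C}^{\sigma_i}$, then at most $d^2$ parameters $t_0$ give a fake answer, i.e. satisfy that $\psi$ is defined at $t_0$ and $g_{\sigma_i,t_0}$ has degree $1$ (so that a single value $s_0$ with $\psi^{\sigma_i}(s_0)=\psi(t_0)$ is produced).
   Context: A parametrization is proper if it is birational onto its image; $\psi^\sigma$ denotes applying $\sigma$ to the coefficients, $\mathcal{C}^\sigma=\{\sigma(x):x\in\mathcal{C}\}$ (componentwise), and $\psi^{\sigma}(\infty)$ is the (possibly projective) point of $\mathcal{C}^{\sigma}$ corresponding to the parameter $\infty$. A curve is defined over $\mathbb{K}$ if it is the zero set of polynomials with coefficients in $\mathbb{K}$. Definition of $u_i$ when $\mathcal{C}$ is defined over $\mathbb{K}$: substitute $t=\sum_{k=0}^{n-1}\alpha^kt_k$ and write $\psi_l(\sum_k\alpha^kt_k)=\sum_{k=0}^{n-1}\alpha^kF_{kl}/D$ with $F_{kl},D\in\mathbb{K}[t_0,\dots,t_{n-1}]$; the Zariski closure of $\{F_{kl}=0,\ 1\le k\le n-1,\ 1\le l\le m\}\setminus\{D=0\}$ in $\mathbb{F}^n$ has a unique one-dimensional component $\mathcal{U}$ (the hypercircle), with standard parametrization $\phi=(\phi_0,\dots,\phi_{n-1})$ satisfying $\sum_k\alpha^k\phi_k(t)=t$; then $u_i(t)=\sum_{k}\alpha_i^k\phi_k(t)$, a fractional linear transformation with $\psi=\psi^{\sigma_i}\circ u_i$.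
   Formalization: In (1), uniqueness of s_k is taken on the projective parameter line: it is also assumed that ψ(t_k) ≠ ψ^{σ_i}(∞). Without this the claim fails, since t_k with u_i(t_k)=∞ can have another finite s_k as its only affine solution. *)

theory Defs
  imports "HOL-Computational_Algebra.Computational_Algebra"
begin

definition subfield :: "'f::field set \<Rightarrow> bool" where
  "subfield K \<longleftrightarrow> 0 \<in> K \<and> 1 \<in> K \<and> (\<forall>x\<in>K. \<forall>y\<in>K. x + y \<in> K \<and> x * y \<in> K \<and> - x \<in> K)
     \<and> (\<forall>x\<in>K. x \<noteq> 0 \<longrightarrow> inverse x \<in> K)"

definition poly_over :: "'f::field set \<Rightarrow> 'f poly \<Rightarrow> bool" where
  "poly_over S p \<longleftrightarrow> (\<forall>i. coeff p i \<in> S)"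

definition is_alg_closure_of :: "'f::field set \<Rightarrow> bool" where
  "is_alg_closure_of K \<longleftrightarrow> subfield K
     \<and> (\<forall>p::'f poly. degree p \<ge> 1 \<longrightarrow> (\<exists>x. poly p x = 0))
     \<and> (\<forall>x. \<exists>p. p \<noteq> 0 \<and> poly_over K p \<and> poly p x = 0)"

definition alg_degree :: "'f::field set \<Rightarrow> 'f \<Rightarrow> nat \<Rightarrow> bool" where
  "alg_degree K a n \<longleftrightarrow> (\<exists>p. p \<noteq> 0 \<and> poly_over K p \<and> poly p a = 0 \<and> degree p = n)
     \<and> (\<forall>p. p \<noteq> 0 \<and> poly_over K p \<and> poly p a = 0 \<longrightarrow> n \<le> degree p)"

definition K_automorphism :: "'f::field set \<Rightarrow> ('f \<Rightarrow> 'f) \<Rightarrow> bool" where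
  "K_automorphism K s \<longleftrightarrow> bij s \<and> (\<forall>x y. s (x + y) = s x + s y) \<and> (\<forall>x y. s (x * y) = s x * s y)
     \<and> s 1 = 1 \<and> (\<forall>x\<in>K. s x = x)"

definition simple_ext :: "'f::field set \<Rightarrow> 'f \<Rightarrow> 'f set" where
  "simple_ext K a = {poly q a | q. poly_over K q}"

definition poly_fun :: "'i set \<Rightarrow> 'f::field set \<Rightarrow> (('i \<Rightarrow> 'f) \<Rightarrow> 'f) \<Rightarrow> bool" where
  "poly_fun I S f \<longleftrightarrow> (\<exists>c :: ('i \<Rightarrow> nat) \<Rightarrow> 'f.
      finite {e. c e \<noteq> 0} \<and> (\<forall>e. c e \<in> S) \<and> (\<forall>e. c e \<noteq> 0 \<longrightarrow> (\<forall>j. j \<notin> I \<longrightarrow> e j = 0))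
      \<and> (\<forall>x. f x = (\<Sum>e\<in>{e. c e \<noteq> 0}. c e * (\<Prod>j\<in>I. x j ^ e j))))"

definition zar_closed :: "'i set \<Rightarrow> ('i \<Rightarrow> 'f::field) set \<Rightarrow> ('i \<Rightarrow> 'f) set \<Rightarrow> bool" where
  "zar_closed I A Z \<longleftrightarrow> (\<exists>P. (\<forall>f\<in>P. poly_fun I UNIV f) \<and> Z = {x\<in>A. \<forall>f\<in>P. f x = 0})"

definition zar_closure :: "'i set \<Rightarrow> ('i \<Rightarrow> 'f::field) set \<Rightarrow> ('i \<Rightarrow> 'f) set \<Rightarrow> ('i \<Rightarrow> 'f) set" where
  "zar_closure I A S = {x\<in>A. \<forall>f. poly_fun I UNIV f \<longrightarrow> (\<forall>y\<in>S. f y = 0) \<longrightarrow> f x = 0}"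

definition zar_irreducible :: "'i set \<Rightarrow> ('i \<Rightarrow> 'f::field) set \<Rightarrow> ('i \<Rightarrow> 'f) set \<Rightarrow> bool" where
  "zar_irreducible I A Z \<longleftrightarrow> zar_closed I A Z \<and> Z \<noteq> {} \<and>
     (\<forall>Z1 Z2. zar_closed I A Z1 \<longrightarrow> zar_closed I A Z2 \<longrightarrow> Z = Z1 \<union> Z2 \<longrightarrow> Z = Z1 \<or> Z = Z2)"

definition zar_dim_one :: "'i set \<Rightarrow> ('i \<Rightarrow> 'f::field) set \<Rightarrow> ('i \<Rightarrow> 'f) set \<Rightarrow> bool" where
  "zar_dim_one I A Z \<longleftrightarrow> zar_irreducible I A Z \<and> \<not> (\<exists>p. Z = {p}) \<and>
     (\<forall>V. zar_irreducible I A V \<longrightarrow> V \<subset> Z \<longrightarrow> (\<exists>p. V = {p}))"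

definition zar_component :: "'i set \<Rightarrow> ('i \<Rightarrow> 'f::field) set \<Rightarrow> ('i \<Rightarrow> 'f) set \<Rightarrow> ('i \<Rightarrow> 'f) set \<Rightarrow> bool" where
  "zar_component I A X V \<longleftrightarrow> zar_irreducible I A V \<and> V \<subseteq> X \<and>
     (\<forall>V'. zar_irreducible I A V' \<longrightarrow> V \<subseteq> V' \<longrightarrow> V' \<subseteq> X \<longrightarrow> V' = V)"

definition aff_space :: "nat \<Rightarrow> (nat \<Rightarrow> 'f::field) set" where
  "aff_space n = {x. \<forall>k\<ge>n. x k = 0}"

definition psi_at :: "('m \<Rightarrow> 'f::field poly) \<Rightarrow> ('m \<Rightarrow> 'f poly) \<Rightarrow> 'f \<Rightarrow> ('m \<Rightarrow> 'f)" where
  "psi_at num den t = (\<lambda>l. poly (num l) t / poly (den l) t)"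

definition defined_at :: "('m \<Rightarrow> 'f::field poly) \<Rightarrow> 'f \<Rightarrow> bool" where
  "defined_at den t \<longleftrightarrow> (\<forall>l. poly (den l) t \<noteq> 0)"

definition conj_poly :: "('f::field \<Rightarrow> 'f) \<Rightarrow> ('m \<Rightarrow> 'f poly) \<Rightarrow> ('m \<Rightarrow> 'f poly)" where
  "conj_poly s p = (\<lambda>l. map_poly s (p l))"

definition param_curve :: "('m::finite \<Rightarrow> 'f::field poly) \<Rightarrow> ('m \<Rightarrow> 'f poly) \<Rightarrow> ('m \<Rightarrow> 'f) set" where
  "param_curve num den = zar_closure UNIV UNIV {psi_at num den t | t. defined_at den t}"

text \<open>Proper = birational onto the image, i.e. injective outside finitely many parameters.\<close>
definition proper_param :: "('m \<Rightarrow> 'f::field poly) \<Rightarrow> ('m \<Rightarrow> 'f poly) \<Rightarrow> bool" where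
  "proper_param num den \<longleftrightarrow> finite {t. defined_at den t \<and>
      (\<exists>s. defined_at den s \<and> s \<noteq> t \<and> psi_at num den s = psi_at num den t)}"

definition hyperplane :: "('m::finite \<Rightarrow> 'f::field) \<Rightarrow> 'f \<Rightarrow> ('m \<Rightarrow> 'f) set" where
  "hyperplane a b = {x. (\<Sum>l\<in>UNIV. a l * x l) = b}"

text \<open>Degree of a curve: number of intersection points with a generic hyperplane.\<close>
definition curve_degree :: "('m::finite \<Rightarrow> 'f::field) set \<Rightarrow> nat \<Rightarrow> bool" where
  "curve_degree C d \<longleftrightarrow>
     (\<forall>a b. (\<exists>l. a l \<noteq> 0) \<longrightarrow> finite (C \<inter> hyperplane a b) \<longrightarrow> card (C \<inter> hyperplane a b) \<le> d) \<and>
     (\<exists>a b. (\<exists>l. a l \<noteq> 0) \<and> finite (C \<inter> hyperplane a b) \<and> card (C \<inter> hyperplane a b) = d)"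

definition defined_over :: "'f::field set \<Rightarrow> ('m::finite \<Rightarrow> 'f) set \<Rightarrow> bool" where
  "defined_over K C \<longleftrightarrow> (\<exists>P. (\<forall>f\<in>P. poly_fun UNIV K f) \<and> C = {x. \<forall>f\<in>P. f x = 0})"

definition conj_set :: "('f \<Rightarrow> 'f) \<Rightarrow> ('m \<Rightarrow> 'f) set \<Rightarrow> ('m \<Rightarrow> 'f) set" where
  "conj_set s C = (\<lambda>x. s \<circ> x) ` C"

text \<open>psi^sigma(infinity) is an affine point iff deg n_l \<le> deg d_l for all l; its value.\<close>
definition inf_affine :: "('m \<Rightarrow> 'f::field poly) \<Rightarrow> ('m \<Rightarrow> 'f poly) \<Rightarrow> bool" where
  "inf_affine num den \<longleftrightarrow> (\<forall>l. degree (num l) \<le> degree (den l))"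

definition inf_value :: "('m \<Rightarrow> 'f::field poly) \<Rightarrow> ('m \<Rightarrow> 'f poly) \<Rightarrow> ('m \<Rightarrow> 'f)" where
  "inf_value num den = (\<lambda>l. if degree (num l) = degree (den l)
       then lead_coeff (num l) / lead_coeff (den l) else 0)"

text \<open>psi(t0) differs from the (possibly projective) point psi^sigma(infinity).\<close>
definition differs_from_inf :: "('f::field \<Rightarrow> 'f) \<Rightarrow> ('m \<Rightarrow> 'f poly) \<Rightarrow> ('m \<Rightarrow> 'f poly) \<Rightarrow> 'f \<Rightarrow> bool" where
  "differs_from_inf s num den t0 \<longleftrightarrow>
     \<not> (inf_affine (conj_poly s num) (conj_poly s den) \<and>
        psi_at num den t0 = inf_value (conj_poly s num) (conj_poly s den))"

definition g_poly :: "('f::{field_char_0,field_gcd} \<Rightarrow> 'f) \<Rightarrow> ('m::finite \<Rightarrow> 'f poly) \<Rightarrow> ('m \<Rightarrow> 'f poly) \<Rightarrow> 'f \<Rightarrow> 'f poly" where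
  "g_poly s num den t0 = Gcd ((\<lambda>l. [:psi_at num den t0 l:] * map_poly s (den l) - map_poly s (num l)) ` UNIV)"

definition good_param :: "('f::{field_char_0,field_gcd} \<Rightarrow> 'f) \<Rightarrow> ('m::finite \<Rightarrow> 'f poly) \<Rightarrow> ('m \<Rightarrow> 'f poly) \<Rightarrow> 'f \<Rightarrow> bool" where
  "good_param s num den t0 \<longleftrightarrow> defined_at den t0 \<and> degree (g_poly s num den t0) = 1
      \<and> differs_from_inf s num den t0"

text \<open>F k l and D are polynomials over K in t_0..t_{n-1} with
  psi_l(sum_k alpha^k t_k) = sum_k alpha^k F_kl / D (as an identity of rational functions).\<close>
definition hyper_data :: "'f::field set \<Rightarrow> 'f \<Rightarrow> nat \<Rightarrow> ('m \<Rightarrow> 'f poly) \<Rightarrow> ('m \<Rightarrow> 'f poly)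
    \<Rightarrow> (nat \<Rightarrow> 'm \<Rightarrow> (nat \<Rightarrow> 'f) \<Rightarrow> 'f) \<Rightarrow> ((nat \<Rightarrow> 'f) \<Rightarrow> 'f) \<Rightarrow> bool" where
  "hyper_data K a n num den F D \<longleftrightarrow>
     poly_fun {..<n} K D \<and> (\<exists>T\<in>aff_space n. D T \<noteq> 0) \<and>
     (\<forall>k<n. \<forall>l. poly_fun {..<n} K (F k l)) \<and>
     (\<forall>T\<in>aff_space n. \<forall>l. D T * poly (num l) (\<Sum>k<n. a ^ k * T k)
          = poly (den l) (\<Sum>k<n. a ^ k * T k) * (\<Sum>k<n. a ^ k * F k l T))"

definition hyper_preset :: "nat \<Rightarrow> (nat \<Rightarrow> 'm \<Rightarrow> (nat \<Rightarrow> 'f::field) \<Rightarrow> 'f) \<Rightarrow> ((nat \<Rightarrow> 'f) \<Rightarrow> 'f) \<Rightarrow> (nat \<Rightarrow> 'f) set" where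
  "hyper_preset n F D = {T\<in>aff_space n. D T \<noteq> 0 \<and> (\<forall>k\<in>{1..<n}. \<forall>l. F k l T = 0)}"

definition rat_vec_at :: "nat \<Rightarrow> (nat \<Rightarrow> 'f::field poly) \<Rightarrow> (nat \<Rightarrow> 'f poly) \<Rightarrow> 'f \<Rightarrow> (nat \<Rightarrow> 'f)" where
  "rat_vec_at n pn pd t = (\<lambda>k. if k < n then poly (pn k) t / poly (pd k) t else 0)"

definition rat_vec_defined :: "nat \<Rightarrow> (nat \<Rightarrow> 'f::field poly) \<Rightarrow> 'f \<Rightarrow> bool" where
  "rat_vec_defined n pd t \<longleftrightarrow> (\<forall>k<n. poly (pd k) t \<noteq> 0)"

definition std_param :: "'f::field \<Rightarrow> nat \<Rightarrow> (nat \<Rightarrow> 'f) set \<Rightarrow> (nat \<Rightarrow> 'f poly) \<Rightarrow> (nat \<Rightarrow> 'f poly) \<Rightarrow> bool" where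
  "std_param a n U pn pd \<longleftrightarrow> (\<forall>k<n. pd k \<noteq> 0) \<and>
     (\<forall>t. rat_vec_defined n pd t \<longrightarrow> (\<Sum>k<n. a ^ k * rat_vec_at n pn pd t k) = t) \<and>
     U = zar_closure {..<n} (aff_space n) {rat_vec_at n pn pd t | t. rat_vec_defined n pd t}"

definition u_map :: "'f::field \<Rightarrow> nat \<Rightarrow> (nat \<Rightarrow> 'f poly) \<Rightarrow> (nat \<Rightarrow> 'f poly) \<Rightarrow> 'f \<Rightarrow> 'f" where
  "u_map ai n pn pd t = (\<Sum>k<n. ai ^ k * rat_vec_at n pn pd t k)"

definition mobius_interp :: "'f::field \<Rightarrow> 'f \<Rightarrow> 'f \<Rightarrow> 'f \<Rightarrow> (nat \<Rightarrow> 'f) \<Rightarrow> (nat \<Rightarrow> 'f) \<Rightarrow> bool" where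
  "mobius_interp a b c e t s \<longleftrightarrow> a * e - b * c \<noteq> 0 \<and>
     (\<forall>j\<in>{1,2,3}. c * t j + e \<noteq> 0 \<and> (a * t j + b) / (c * t j + e) = s j)"

end

theory Submission
  imports Defs "Jordan_Normal_Form.Determinant"
begin

text \<open>
  Over the least common denominator, \<open>\<psi>\<close> becomes a family \<open>N\<close> of polynomials of degree at most \<open>e\<close>
  without common zero on the projective line. A generic hyperplane meets the curve in \<open>e\<close> simple
  points, so \<open>e \<le> d\<close>, and it suffices to prove the bounds for \<open>e\<close>. Bezout matrices of two generic
  linear sections, evaluated at the nodes where the first section vanishes, give determinants that
  vanish on the curve. They show that the curve consists of the image of \<open>\<psi>\<close> and at most the point at
  infinity; evaluated along a second curve they are polynomials of degree \<open>e\<^sup>2\<close>, which is (3);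
  and evaluated along the curve itself, after removal of trivial zeros, they have degree
  \<open>(e - 1) (e - 2)\<close> and vanish at all parameters in nonreduced or nontrivial fibres.

  If the curve is invariant under \<open>\<sigma>\<close>, then \<open>\<psi>\<^sup>\<sigma>(s) = \<psi>(t)\<close> has a unique solution for almost every
  \<open>t\<close>, which is a rational function of \<open>t\<close>; being injective almost everywhere it is a Moebius map \<open>u\<close>.
  A parameter can fail for \<open>\<sigma>\<close> only if it is a pole of \<open>\<psi>\<close> (at most \<open>e\<close>), is mapped to infinity by
  \<open>u\<close> (at most one for each \<open>\<sigma>\<close>), or is singular, and the last condition does not depend on \<open>\<sigma>\<close>.
  For (1), applying \<open>\<sigma>\<^sub>i\<close> to the identities defining the hypercircle shows that \<open>u\<^sub>i\<close> satisfies
  \<open>\<psi> = \<psi>\<^sup>\<sigma> \<circ> u\<^sub>i\<close>, so it is such a Moebius map and is determined by three values.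
\<close>

text \<open>All determinants are controlled by one mechanism. Their rows are values, at
  \<open>k\<close> simple zeros \<open>r j\<close> of a polynomial \<open>A\<close>, of polynomials
  of degree at most \<open>k - 2\<close>, up to a nonzero factor for each column. By Euler's
  identity the weights 1 / A'(r j), corrected by these factors, form a kernel vector, so the
  determinant vanishes. That it does not vanish identically is seen at the point from which the
  curve is projected: there the matrix is diagonal.

  Infinity is treated without projective space: polynomials are read as forms of a fixed degree
  \<open>e\<close>, and the coefficient of degree \<open>e\<close> is the value at infinity. This is
  why degree bounds are stated for coefficients and why \<open>e\<close> is carried along as a
  separate number.

  The three counts in (2) add up to e + (e - 1) (e - 2) + (n - 1) = (e - 1)^2 + n. This grows with
  \<open>e\<close> from \<open>e = 1\<close> on and equals d^2 - 2 d + n + 1 at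
  \<open>e = d\<close>.\<close>

hide_const (open) Module.smult

section \<open>Generic members of a linear system of polynomials\<close>

lemma card_roots_eq_degree:
  fixes A :: "'f::field_char_0 poly"
  assumes alg: "\<And>p::'f poly. degree p \<ge> 1 \<Longrightarrow> \<exists>x. poly p x = 0"
    and nz: "A \<noteq> 0" and simple: "\<And>r. poly A r = 0 \<Longrightarrow> poly (pderiv A) r \<noteq> 0"
  shows "card {r. poly A r = 0} = degree A"
  using nz simple
proof (induction "degree A" arbitrary: A)
  case 0
  then obtain c where "A = [:c:]" by (metis degree_eq_zeroE)
  with 0 show ?case by auto
next
  case (Suc n)
  then obtain r where r: "poly A r = 0" using alg[of A] by auto
  then obtain B where B: "A = [:-r, 1:] * B" by (metis dvdE poly_eq_0_iff_dvd)
  have "B \<noteq> 0" using Suc.prems B by auto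
  hence dB: "degree A = Suc (degree B)" unfolding B by (subst degree_mult_eq) auto
  have pd: "poly (pderiv A) x = poly B x + (x - r) * poly (pderiv B) x" for x
    unfolding B pderiv_mult by (simp add: pderiv_pCons algebra_simps)
  have Br: "poly B r \<noteq> 0" using Suc.prems(2)[OF r] pd by auto
  have simp: "poly (pderiv B) x \<noteq> 0" if "poly B x = 0" for x
    using Suc.prems(2)[of x] pd that B by auto
  have "card {r. poly B r = 0} = degree B"
    using Suc.hyps(1)[of B] Suc.hyps(2) dB \<open>B \<noteq> 0\<close> simp by auto
  moreover have "{x. poly A x = 0} = insert r {r. poly B r = 0}" using B by auto
  moreover have "finite {r. poly B r = 0}" using \<open>B \<noteq> 0\<close> poly_roots_finite by blast
  ultimately show ?case using Br dB by simp
qed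

text \<open>Subtracting a multiple of \<open>g\<close> reduces to a solution \<open>h\<close> that
  vanishes at a point \<open>t\<close> where \<open>g\<close> does not. If \<open>h\<close> were
  nonzero of order \<open>m\<close> there, \<open>h * pderiv g\<close> would have order at least
  \<open>m\<close>, but \<open>pderiv h * g\<close> has order exactly \<open>m - 1\<close> in
  characteristic zero.\<close>

lemma wronskian_zero_imp_proportional:
  fixes f g :: "'f::field_char_0 poly"
  assumes "f * pderiv g = pderiv f * g" "g \<noteq> 0"
  shows "\<exists>c. f = smult c g"
proof -
  obtain t where t: "poly g t \<noteq> 0"
    using assms(2) poly_all_0_iff_0 by blast
  define h where "h = f - smult (poly f t / poly g t) g"
  have h: "h * pderiv g = pderiv h * g"
    using assms(1) unfolding h_def by (simp add: pderiv_diff pderiv_smult algebra_simps)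
  have "h = 0"
  proof (rule ccontr)
    assume hn: "h \<noteq> 0"
    have ht: "poly h t = 0" using t by (simp add: h_def)
    define m where "m = order t h"
    have m: "m \<noteq> 0" using ht hn order_root unfolding m_def by blast
    have "degree h \<noteq> 0"
    proof
      assume "degree h = 0"
      then obtain c where "h = [:c:]" by (rule degree_eq_zeroE)
      with ht hn show False by simp
    qed
    hence pn: "pderiv h \<noteq> 0" by (simp add: pderiv_eq_0_iff)
    have o: "order t h = Suc (order t (pderiv h))"
      using order_pderiv[OF hn] ht by auto
    have og: "order t g = 0" using t by (simp add: order_0I)
    have "order t (pderiv h * g) = order t (pderiv h)"
      using order_mult[of "pderiv h" g t] pn assms(2) og by auto
    moreover have "[:-t,1:]^m dvd h * pderiv g" using order_1[of t h] by (simp add: m_def)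
    moreover have "pderiv h * g \<noteq> 0" using pn assms(2) by auto
    ultimately have "m \<le> order t (pderiv h)" using h order_divides[of t m "pderiv h * g"] by auto
    thus False using o m_def by simp
  qed
  thus ?thesis unfolding h_def by (intro exI[of _ "poly f t / poly g t"]) simp
qed

lemma poly_eq_lead_coeff_prod_roots:
  fixes A :: "'f::field poly"
  assumes "degree A = k" "inj_on r {..<k}" "\<And>j. j < k \<Longrightarrow> poly A (r j) = 0"
  shows "A = smult (lead_coeff A) (\<Prod>j<k. [:- r j, 1:])"
proof -
  let ?P = "smult (lead_coeff A) (\<Prod>j<k. [:- r j, 1:])"
  have dP: "degree (\<Prod>j<k. [:- r j, 1:]) = k"
    by (subst degree_prod_eq_sum_degree) auto
  show ?thesis
  proof (cases "A = 0")
    case False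
    have "lead_coeff (\<Prod>j<k. [:- r j, 1:]) = 1"
      by (simp add: lead_coeff_prod)
    hence c: "coeff A k = coeff ?P k" using dP assms(1) by simp
    have "poly A x = poly ?P x" if "x \<in> r ` {..<k}" for x
      using that assms(3) by (auto simp: poly_prod)
    then show ?thesis
    proof (rule poly_eqI_degree_lead_coeff[of A k ?P "r ` {..<k}", rotated -1])
      show "card (r ` {..<k}) \<ge> k" by (simp add: card_image[OF assms(2)])
    qed (use c dP assms(1) in \<open>auto intro: order_trans[OF degree_smult_le]\<close>)
  qed simp
qed

lemma pderiv_prod_linear_at_root:
  fixes r :: "nat \<Rightarrow> 'f::field"
  assumes "j < k"
  shows "poly (pderiv (\<Prod>j<k. [:- r j, 1:])) (r j) = (\<Prod>i\<in>{..<k}-{j}. r j - r i)"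
proof -
  have "(\<Prod>j<k. [:- r j, 1:]) = [:- r j, 1:] * (\<Prod>i\<in>{..<k}-{j}. [:- r i, 1:])"
    using assms by (intro prod.remove) auto
  thus ?thesis by (simp only: pderiv_mult) (simp add: pderiv_pCons poly_prod)
qed

text \<open>Euler's identity, from comparing the coefficients of \<open>x ^ (k - 1)\<close> in Lagrange's interpolation
  formula.\<close>

lemma sum_over_simple_roots_eq_0:
  fixes A q :: "'f::field poly"
  assumes "degree A = k" "A \<noteq> 0" "inj_on r {..<k}" "\<And>j. j < k \<Longrightarrow> poly A (r j) = 0"
    and q: "\<And>j. Suc j \<ge> k \<Longrightarrow> coeff q j = 0"
  shows "(\<Sum>j<k. poly q (r j) / poly (pderiv A) (r j)) = 0"
proof (cases "k = 0")
  case False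
  define c where "c = lead_coeff A"
  have c: "c \<noteq> 0" using assms(2) by (simp add: c_def)
  define L where "L = (\<lambda>j. \<Prod>i\<in>{..<k}-{j}. [:- r i, 1:])"
  have A': "poly (pderiv A) (r j) = c * (\<Prod>i\<in>{..<k}-{j}. r j - r i)" if "j < k" for j
  proof -
    have "pderiv A = smult c (pderiv (\<Prod>j<k. [:- r j, 1:]))"
      using poly_eq_lead_coeff_prod_roots[OF assms(1,3,4)] by (metis c_def pderiv_smult)
    thus ?thesis using pderiv_prod_linear_at_root[OF that, of r] by simp
  qed
  have nz: "(\<Prod>i\<in>{..<k}-{j}. r j - r i) \<noteq> 0" if "j < k" for j
    using that inj_onD[OF assms(3)] by auto
  \<comment> \<open>The Lagrange interpolant of \<open>q / c\<close>: \<open>pderiv A\<close>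
    carries the leading coefficient \<open>c\<close> of \<open>A\<close> into the
    denominators.\<close>
  define T where "T = (\<Sum>j<k. smult (poly q (r j) / poly (pderiv A) (r j)) (L j))"
  have dL: "degree (L j) = k - 1" if "j < k" for j
    using that unfolding L_def by (subst degree_prod_eq_sum_degree) auto
  have cL: "coeff (L j) (k - 1) = 1" if "j < k" for j
    using dL[OF that] lead_coeff_prod[of "\<lambda>i. [:- r i, 1:]" "{..<k}-{j}"] by (simp add: L_def)
  have Lv: "poly (L i) (r j) = (if i = j then (\<Prod>i\<in>{..<k}-{j}. r j - r i) else 0)"
    if "i < k" "j < k" for i j
    using that by (auto simp: L_def poly_prod intro!: prod_zero)
  have "poly T (r j) = poly q (r j) / c" if "j < k" for j
  proof -
    have "poly T (r j) = (\<Sum>i<k. poly q (r i) / poly (pderiv A) (r i) * poly (L i) (r j))"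
      by (simp add: T_def poly_sum)
    also have "\<dots> = poly q (r j) / poly (pderiv A) (r j) * poly (L j) (r j)"
      using that by (subst sum.remove[of _ j]) (auto simp: Lv intro!: sum.neutral)
    also have "\<dots> = poly q (r j) / c"
      using A'[OF that] nz[OF that] that c by (simp add: Lv)
    finally show ?thesis .
  qed
  hence v: "poly (smult c T) x = poly q x" if "x \<in> r ` {..<k}" for x using c that by auto
  have dT: "degree (smult c T) < k"
  proof -
    have "degree T \<le> k - 1" unfolding T_def
      by (intro degree_sum_le) (auto intro!: order_trans[OF degree_smult_le] simp: dL)
    thus ?thesis using False c by simp
  qed
  have dq: "degree q < k"
  proof -
    have "degree q \<le> k - 1" by (rule degree_le) (use q False in auto)
    thus ?thesis using False by simp
  qed
  have "smult c T = q"
    using poly_eqI_degree[OF v] dT dq card_image[OF assms(3)] by auto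
  hence "coeff T (k - 1) = 0" using q[of "k-1"] c False by (auto)
  moreover have "coeff T (k - 1) = (\<Sum>j<k. poly q (r j) / poly (pderiv A) (r j))"
    unfolding T_def coeff_sum by (intro sum.cong) (auto simp del: One_nat_def simp: cL)
  ultimately show ?thesis by simp
qed simp

text \<open>In the induction one coefficient of the form, at an index where the new vector is
  nonzero, is shifted by \<open>c\<close>. Each vector with a nonzero entry there excludes one value
  of \<open>c\<close>, the others keep their value, and the field is infinite.\<close>

lemma linear_form_avoiding:
  fixes V :: "('k::finite \<Rightarrow> 'f::field_char_0) set"
  assumes "finite V" "\<And>v. v \<in> V \<Longrightarrow> \<exists>k. v k \<noteq> 0"
  shows "\<exists>a. \<forall>v\<in>V. (\<Sum>k\<in>UNIV. a k * v k) \<noteq> 0"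
  using assms
proof (induction V rule: finite_induct)
  case (insert v V)
  then obtain a where a: "\<forall>v\<in>V. (\<Sum>k\<in>UNIV. a k * v k) \<noteq> 0" by auto
  obtain k0 where k0: "v k0 \<noteq> 0" using insert by auto
  have expand: "(\<Sum>k\<in>UNIV. (a(k0 := a k0 + c)) k * w k) = (\<Sum>k\<in>UNIV. a k * w k) + c * w k0" for c w
  proof -
    have "(\<Sum>k\<in>UNIV. (a(k0 := a k0 + c)) k * w k) = (\<Sum>k\<in>UNIV. a k * w k + (if k = k0 then c * w k0 else 0))"
      by (intro sum.cong) (auto simp: algebra_simps)
    thus ?thesis by (simp add: sum.distrib)
  qed
  have "finite ((\<lambda>w. - (\<Sum>k\<in>UNIV. a k * w k) / w k0) ` insert v V)"
    using insert by auto
  then obtain c where c: "c \<notin> (\<lambda>w. - (\<Sum>k\<in>UNIV. a k * w k) / w k0) ` insert v V"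
    using ex_new_if_finite[OF infinite_UNIV_char_0] by blast
  have "(\<Sum>k\<in>UNIV. (a(k0 := a k0 + c)) k * w k) \<noteq> 0" if "w \<in> insert v V" for w
  proof (cases "w k0 = 0")
    case True
    then have "w \<in> V" using that k0 by auto
    then show ?thesis using a True by (subst expand) simp
  next
    case False
    have "c \<noteq> - (\<Sum>k\<in>UNIV. a k * w k) / w k0" using c that by auto
    then show ?thesis using False by (subst expand) (auto simp: field_simps add_eq_0_iff)
  qed
  then show ?case by blast
qed auto

definition lin_comb :: "('k::finite \<Rightarrow> 'f::field) \<Rightarrow> ('k \<Rightarrow> 'f poly) \<Rightarrow> 'f poly" where
  "lin_comb a p = (\<Sum>k\<in>UNIV. smult (a k) (p k))"

lemma poly_lin_comb [simp]: "poly (lin_comb a p) x = (\<Sum>k\<in>UNIV. a k * poly (p k) x)"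
  by (simp add: lin_comb_def poly_sum)

lemma coeff_lin_comb [simp]: "coeff (lin_comb a p) j = (\<Sum>k\<in>UNIV. a k * coeff (p k) j)"
  by (simp add: lin_comb_def coeff_sum)

text \<open>A family of polynomials of degree at most \<open>e\<close>, read as binary forms of degree \<open>e\<close>, without
  common zero on the projective line; the second clause is about the zero at infinity.\<close>

definition basepoint_free :: "nat \<Rightarrow> ('k \<Rightarrow> 'f::field poly) \<Rightarrow> bool" where
  "basepoint_free e p \<longleftrightarrow> (\<forall>k. degree (p k) \<le> e) \<and> (\<exists>k. coeff (p k) e \<noteq> 0) \<and>
     (\<forall>r. \<exists>k. poly (p k) r \<noteq> 0)"

text \<open>Bertini for a pencil spanned by two coprime members of the linear system: a double root
  of a member is a zero of the Wronskian, and each point lies on only one member.\<close>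

lemma generic_member_simple_roots:
  fixes p :: "'k::finite \<Rightarrow> 'f::field_char_0 poly"
  assumes alg: "\<And>p::'f poly. degree p \<ge> 1 \<Longrightarrow> \<exists>x. poly p x = 0"
    and bpf: "basepoint_free e p" and fin: "finite Bad"
  shows "\<exists>a. degree (lin_comb a p) = e \<and> lin_comb a p \<noteq> 0 \<and> card {r. poly (lin_comb a p) r = 0} = e \<and>
     (\<forall>r. poly (lin_comb a p) r = 0 \<longrightarrow> poly (pderiv (lin_comb a p)) r \<noteq> 0 \<and> r \<notin> Bad)"
proof -
  have deg_le: "degree (lin_comb a p) \<le> e" for a
    unfolding lin_comb_def using bpf
    by (intro degree_sum_le) (auto simp: basepoint_free_def intro: order_trans[OF degree_smult_le])
  obtain q where q: "(\<Sum>k\<in>UNIV. q k * coeff (p k) e) \<noteq> 0"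
    using linear_form_avoiding[of "{\<lambda>k. coeff (p k) e}"] bpf by (auto simp: basepoint_free_def)
  define Q where "Q = lin_comb q p"
  have cQ: "coeff Q e \<noteq> 0" using q by (simp add: Q_def)
  hence Q0: "Q \<noteq> 0" by auto
  have dQ: "degree Q = e" using deg_le[of q] le_degree[OF cQ] by (auto simp: Q_def)
  have finQ: "finite {r. poly Q r = 0}" using Q0 poly_roots_finite by blast
  \<comment> \<open>A second member \<open>P\<close> without a common zero with \<open>Q\<close>:
    absence of base points makes the evaluation vectors at the zeros of \<open>Q\<close>
    nonzero.\<close>
  obtain b where b: "\<forall>v\<in>(\<lambda>r k. poly (p k) r) ` {r. poly Q r = 0}. (\<Sum>k\<in>UNIV. b k * v k) \<noteq> 0"
    using linear_form_avoiding[of "(\<lambda>r k. poly (p k) r) ` {r. poly Q r = 0}"] bpf finQ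
    by (auto simp: basepoint_free_def)
  define P where "P = lin_comb b p"
  have PQ: "poly P r \<noteq> 0" if "poly Q r = 0" for r using b that by (auto simp: P_def)
  show ?thesis
  proof (cases "e = 0")
    case True
    then obtain c where c: "Q = [:c:]" using dQ by (metis degree_eq_zeroE)
    hence "c \<noteq> 0" using Q0 by auto
    hence "card {r. poly Q r = 0} = e" "\<And>r. poly Q r \<noteq> 0" using True c by auto
    with dQ Q0 show ?thesis unfolding Q_def by (intro exI[of _ q]) auto
  next
    case False
    define W where "W = P * pderiv Q - pderiv P * Q"
    have W: "W \<noteq> 0"
    proof
      assume "W = 0"
      then obtain c where "P = smult c Q"
        using wronskian_zero_imp_proportional[of P Q] Q0 W_def by auto
      moreover obtain r where "poly Q r = 0" using alg[of Q] dQ False by auto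
      ultimately show False using PQ[of r] by auto
    qed
    define Bd where "Bd = Bad \<union> {r. poly W r = 0}"
    have finB: "finite Bd" using fin W poly_roots_finite by (auto simp: Bd_def)
    \<comment> \<open>The first excluded value would lower the degree of
      \<open>P + smult c Q\<close> below \<open>e\<close>; the others would put a point of
      \<open>Bd\<close> on this member.\<close>
    have "finite (insert (- coeff P e / coeff Q e) ((\<lambda>r. - poly P r / poly Q r) ` Bd))"
      using finB by auto
    then obtain c where c: "c \<notin> insert (- coeff P e / coeff Q e) ((\<lambda>r. - poly P r / poly Q r) ` Bd)"
      using ex_new_if_finite[OF infinite_UNIV_char_0] by blast
    define a where "a = (\<lambda>k. b k + c * q k)"
    have A: "lin_comb a p = P + smult c Q"
      by (rule poly_eqI) (simp add: P_def Q_def a_def sum.distrib algebra_simps sum_distrib_left)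
    have ce: "coeff (lin_comb a p) e \<noteq> 0" using c cQ unfolding A by (auto simp: field_simps add_eq_0_iff)
    have dA: "degree (lin_comb a p) = e" "lin_comb a p \<noteq> 0"
      using le_antisym[OF deg_le le_degree[OF ce]] ce by (blast, metis coeff_0)
    have nB: "r \<notin> Bd" if "poly (lin_comb a p) r = 0" for r
    proof
      assume r: "r \<in> Bd"
      have z: "poly P r + c * poly Q r = 0" using that unfolding A by simp
      hence "poly Q r \<noteq> 0" using PQ by force
      hence "c = - poly P r / poly Q r" using z by (simp add: field_simps add_eq_0_iff)
      thus False using c r by blast
    qed
    have sr: "poly (pderiv (lin_comb a p)) r \<noteq> 0" if "poly (lin_comb a p) r = 0" for r
    proof
      assume z': "poly (pderiv (lin_comb a p)) r = 0"
      have 1: "poly P r = - c * poly Q r" using that unfolding A by (simp add: add_eq_0_iff)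
      have 2: "poly (pderiv P) r = - c * poly (pderiv Q) r"
        using z' unfolding A by (simp add: pderiv_add pderiv_smult add_eq_0_iff)
      have "poly W r = 0" by (simp add: W_def 1 2)
      thus False using nB[OF that] by (simp add: Bd_def)
    qed
    show ?thesis
      using dA sr nB card_roots_eq_degree[OF alg dA(2) sr] by (intro exI[of _ a]) (auto simp: Bd_def)
  qed
qed

section \<open>Bezout determinants\<close>

lemma det_mat_eq_0I:
  fixes M :: "nat \<Rightarrow> nat \<Rightarrow> 'f::field"
  assumes "\<And>i. i < k \<Longrightarrow> (\<Sum>j<k. M i j * w j) = 0" "j0 < k" "w j0 \<noteq> 0"
  shows "det (mat k k (\<lambda>(i, j). M i j)) = 0"
proof -
  have "mat k k (\<lambda>(i, j). M i j) *\<^sub>v vec k w = 0\<^sub>v k"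
    by (rule eq_vecI) (auto simp: scalar_prod_def assms(1) atLeast0LessThan)
  moreover have "vec k w \<noteq> 0\<^sub>v k"
    using assms(2,3) by (metis index_vec index_zero_vec(1))
  ultimately show ?thesis
    by (subst det_0_iff_vec_prod_zero_field[of _ k]) (auto intro!: exI[of _ "vec k w"])
qed

lemma det_mat_diagonal_nonzero:
  fixes M :: "nat \<Rightarrow> nat \<Rightarrow> 'f::field"
  assumes "\<And>i j. i < k \<Longrightarrow> j < k \<Longrightarrow> i \<noteq> j \<Longrightarrow> M i j = 0" "\<And>i. i < k \<Longrightarrow> M i i \<noteq> 0"
  shows "det (mat k k (\<lambda>(i, j). M i j)) \<noteq> 0"
proof -
  have "det (mat k k (\<lambda>(i, j). M i j)) = prod_list (diag_mat (mat k k (\<lambda>(i, j). M i j)))"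
    by (rule det_upper_triangular[of _ k]) (auto simp: assms(1))
  moreover have "0 \<notin> set (diag_mat (mat k k (\<lambda>(i, j). M i j)))"
    using assms(2) by (auto simp: diag_mat_def) 
  ultimately show ?thesis by (simp add: prod_list_zero_iff)
qed

text \<open>Euler's identity, applied to each row, gives the kernel vector 1 / (mu j * A'(r j)). The
  factor \<open>mu j\<close> will be \<open>r j - s\<close>, or the value at \<open>r j\<close> of
  the factor \<open>L\<close> of a singular parameter. The condition on the coefficients of
  \<open>q\<close> means degree at most \<open>k - 2\<close> and forces \<open>q = 0\<close> if
  \<open>k = 1\<close>, which a bound with truncated subtraction would not.\<close>

lemma det_mat_node_values_eq_0:
  fixes A :: "'f::field poly"
  assumes "k > 0" "degree A = k" "inj_on r {..<k}" "\<And>j. j < k \<Longrightarrow> poly A (r j) = 0"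
    and A': "\<And>j. j < k \<Longrightarrow> poly (pderiv A) (r j) \<noteq> 0"
    and mu: "\<And>j. j < k \<Longrightarrow> mu j \<noteq> 0"
    and M: "\<And>i. i < k \<Longrightarrow> \<exists>q. (\<forall>j. Suc j \<ge> k \<longrightarrow> coeff q j = 0) \<and> (\<forall>j<k. M i j = mu j * poly q (r j))"
  shows "det (mat k k (\<lambda>(i, j). M i j)) = 0"
proof (rule det_mat_eq_0I)
  fix i assume "i < k"
  then obtain q where q: "\<And>j. Suc j \<ge> k \<Longrightarrow> coeff q j = 0" "\<And>j. j < k \<Longrightarrow> M i j = mu j * poly q (r j)"
    using M by blast
  have "A \<noteq> 0" using assms(1,2) by auto
  have "(\<Sum>j<k. M i j * (1 / (mu j * poly (pderiv A) (r j)))) = (\<Sum>j<k. poly q (r j) / poly (pderiv A) (r j))"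
    by (rule sum.cong) (use q(2) mu in auto)
  also have "\<dots> = 0"
    using sum_over_simple_roots_eq_0[OF assms(2) \<open>A \<noteq> 0\<close> assms(3,4) q(1)] by simp
  finally show "(\<Sum>j<k. M i j * (1 / (mu j * poly (pderiv A) (r j)))) = 0" .
next
  show "0 < k" by fact
  show "1 / (mu 0 * poly (pderiv A) (r 0)) \<noteq> 0" using assms(1) mu A' by simp
qed

text \<open>For a plane curve parametrized by \<open>F = (f, A, B)\<close> and a point \<open>x\<close>, this is the polynomial
  \<open>y \<mapsto> det (x, F(\<rho>), F(y))\<close> at a zero \<open>\<rho>\<close> of \<open>A\<close>.\<close>

definition collinearity_poly ::
    "'f::field poly \<Rightarrow> 'f poly \<Rightarrow> 'f poly \<Rightarrow> 'f \<Rightarrow> 'f \<Rightarrow> 'f \<Rightarrow> 'f \<Rightarrow> 'f poly" where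
  "collinearity_poly f A B \<rho> x0 xa xb =
     smult (xb * poly f \<rho> - x0 * poly B \<rho>) A - smult xa (smult (poly f \<rho>) B - smult (poly B \<rho>) f)"

text \<open>The Bezout matrix of two linear sections of the curve, evaluated at zeros \<open>r i\<close> of \<open>A\<close>; its
  \<open>(i, j)\<close> entry is the value at \<open>r j\<close> of the collinearity polynomial of \<open>r i\<close> divided by
  \<open>y - r i\<close>. On the diagonal the quotient is a derivative.\<close>

definition bezout_entry ::
    "'f::field poly \<Rightarrow> 'f poly \<Rightarrow> 'f poly \<Rightarrow> (nat \<Rightarrow> 'f) \<Rightarrow> nat \<Rightarrow> nat \<Rightarrow> 'f \<Rightarrow> 'f \<Rightarrow> 'f \<Rightarrow> 'f" where
  "bezout_entry f A B r i j x0 xa xb =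
     (if i = j then poly (pderiv A) (r i) * (xb * poly f (r i) - x0 * poly B (r i))
        - xa * (poly f (r i) * poly (pderiv B) (r i) - poly B (r i) * poly (pderiv f) (r i))
      else - xa * ((poly f (r i) * poly B (r j) - poly B (r i) * poly f (r j)) / (r j - r i)))"

lemma bezout_entry_eq:
  assumes "inj_on r {..<k}" "i < k" "j < k" "poly A (r i) = 0" "poly A (r j) = 0"
    and K: "collinearity_poly f A B (r i) x0 xa xb = [:- r i, 1:] * K"
  shows "bezout_entry f A B r i j x0 xa xb = poly K (r j)"
proof (cases "i = j")
  case True
  have "poly (pderiv ([:- r i, 1:] * K)) (r i) = poly K (r i)"
    by (simp only: pderiv_mult) (simp add: pderiv_pCons)
  moreover have "poly (pderiv ([:- r i, 1:] * K)) (r i) = bezout_entry f A B r i j x0 xa xb"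
    unfolding K[symmetric] using True
    by (simp add: collinearity_poly_def bezout_entry_def pderiv_diff pderiv_smult algebra_simps)
  ultimately show ?thesis using True by simp
next
  case False
  hence ne: "r j - r i \<noteq> 0" using inj_onD[OF assms(1)] assms(2,3) by auto
  have "poly ([:- r i, 1:] * K) (r j) = (r j - r i) * poly K (r j)"
    by (simp add: algebra_simps)
  moreover have "poly ([:- r i, 1:] * K) (r j) = (r j - r i) * bezout_entry f A B r i j x0 xa xb"
    unfolding K[symmetric] using False ne assms(4,5)
    by (simp add: collinearity_poly_def bezout_entry_def)
  ultimately show ?thesis using ne by simp
qed

lemma collinearity_poly_at_self:
  "poly A \<rho> = 0 \<Longrightarrow> poly (collinearity_poly f A B \<rho> x0 xa xb) \<rho> = 0"
  by (simp add: collinearity_poly_def)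

lemma degree_collinearity_poly_le:
  assumes "degree f \<le> e" "degree A \<le> e" "degree B \<le> e"
  shows "degree (collinearity_poly f A B \<rho> x0 xa xb) \<le> e"
  unfolding collinearity_poly_def using assms
  by (intro degree_diff_le) (auto intro: order_trans[OF degree_smult_le] degree_diff_le)

lemma degree_le_of_linear_factors:
  fixes q :: "'f::field poly"
  assumes "degree ([:a, 1:] * ([:b, 1:] * q)) \<le> e"
  shows "q = 0 \<or> degree q + 2 \<le> e"
proof (cases "q = 0")
  case False
  have *: "degree ([:c, 1:] * p) = Suc (degree p)" "[:c, 1:] * p \<noteq> 0" if "p \<noteq> 0" for c :: 'f and p
    using that degree_mult_eq[of "[:c, 1:]" p] by auto
  have "degree ([:a, 1:] * ([:b, 1:] * q)) = Suc (Suc (degree q))"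
    using *(1)[OF *(2)[OF False]] *(1)[OF False] by simp
  thus ?thesis using assms by simp
qed simp

lemma degree_lin_comb_le:
  assumes "\<And>k. degree (p k) \<le> e"
  shows "degree (lin_comb a p) \<le> e"
  unfolding lin_comb_def using assms
  by (intro degree_sum_le) (auto intro: order_trans[OF degree_smult_le])

lemma sum_UNIV_option:
  "(\<Sum>k\<in>UNIV. g (k :: 'm::finite option)) = g None + (\<Sum>l\<in>UNIV. g (Some l))"
proof -
  have "(\<Sum>k\<in>UNIV. g k) = g None + (\<Sum>k\<in>range Some. g k)"
    by (simp add: UNIV_option_conv)
  also have "(\<Sum>k\<in>range Some. g k) = (\<Sum>l\<in>UNIV. g (Some l))"
    by (subst sum.reindex) auto
  finally show ?thesis .
qed

text \<open>The members of the linear system \<open>N\<close> cut out by the hyperplanes through the point with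
  homogeneous coordinates \<open>X\<close>.\<close>

definition project_from :: "('m option \<Rightarrow> 'f::field) \<Rightarrow> ('m option \<Rightarrow> 'f poly) \<Rightarrow> 'm \<Rightarrow> 'f poly" where
  "project_from X N l = smult (X (Some l)) (N None) - smult (X None) (N (Some l))"

lemma degree_project_from_le:
  "(\<And>k. degree (N k) \<le> e) \<Longrightarrow> degree (project_from X N l) \<le> e"
  unfolding project_from_def
  by (intro degree_diff_le) (auto intro: order_trans[OF degree_smult_le])

text \<open>Implicitization: the determinant in the conclusion is a form of degree \<open>e\<close> that vanishes
  on the curve but not at the given point \<open>X\<close> off the curve. A generic hyperplane through \<open>X\<close>
  makes the Bezout matrix diagonal at \<open>X\<close>.\<close>

lemma implicit_determinant:
  fixes N :: "'m::finite option \<Rightarrow> 'f::field_char_0 poly" and X :: "'m option \<Rightarrow> 'f"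
  assumes alg: "\<And>p::'f poly. degree p \<ge> 1 \<Longrightarrow> \<exists>x. poly p x = 0"
    and X0: "X None \<noteq> 0" and e: "e \<ge> 1" and deg: "\<And>k. degree (N k) \<le> e"
    and bpf: "basepoint_free e (project_from X N)"
  shows "\<exists>c. (\<forall>s \<kappa>. det (mat e e (\<lambda>(i, j). \<Sum>k\<in>UNIV. c i j k * (\<kappa> * poly (N k) s))) = 0) \<and>
             det (mat e e (\<lambda>(i, j). \<Sum>k\<in>UNIV. c i j k * X k)) \<noteq> 0"
proof -
  define p where "p = project_from X N"
  obtain a where a: "degree (lin_comb a p) = e" "card {r. poly (lin_comb a p) r = 0} = e"
    "\<And>r. poly (lin_comb a p) r = 0 \<Longrightarrow> poly (pderiv (lin_comb a p)) r \<noteq> 0" "lin_comb a p \<noteq> 0"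
    using generic_member_simple_roots[OF alg bpf, of "{}"] unfolding p_def by blast
  define A where "A = lin_comb a p"
  define R where "R = {r. poly A r = 0}"
  have finR: "finite R" using a(4) poly_roots_finite unfolding R_def A_def by blast
  obtain r where "bij_betw r {0..<card R} R" using ex_bij_betw_nat_finite[OF finR] by blast
  hence r: "inj_on r {..<e}" "r ` {..<e} = R"
    using a(2) by (auto simp: bij_betw_def R_def A_def atLeast0LessThan)
  have Ar: "poly A (r j) = 0" if "j < e" for j using r that by (auto simp: R_def)
  have A'r: "poly (pderiv A) (r j) \<noteq> 0" if "j < e" for j using a(3) Ar[OF that] by (simp add: A_def)
  obtain b where b: "\<forall>v\<in>(\<lambda>\<rho> l. poly (p l) \<rho>) ` R. (\<Sum>l\<in>UNIV. b l * v l) \<noteq> 0"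
    using linear_form_avoiding[of "(\<lambda>\<rho> l. poly (p l) \<rho>) ` R"] bpf finR
    by (auto simp: basepoint_free_def p_def)
  define B where "B = lin_comb b p"
  define f where "f = N None"
  have Br: "poly B (r j) \<noteq> 0" if "j < e" for j using r b that by (auto simp: B_def)
  \<comment> \<open>\<open>Y\<close> is projected to the plane with coordinates
    \<open>Y None\<close>, \<open>xi a Y\<close>, \<open>xi b Y\<close>. The last two vanish at
    \<open>X\<close>, and points of the curve go to multiples of \<open>(f, A, B)\<close>.\<close>
  define xi where "xi = (\<lambda>(a::'m \<Rightarrow> 'f) Y. \<Sum>l\<in>UNIV. a l * (X (Some l) * Y None - X None * Y (Some l)))"
  have lin: "\<exists>c. \<forall>Y. bezout_entry f A B r i j (Y None) (xi a Y) (xi b Y) = (\<Sum>k\<in>UNIV. c k * Y k)" for i j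
  proof -
    obtain \<alpha> \<beta> \<gamma> where abc: "\<And>x0 xa xb. bezout_entry f A B r i j x0 xa xb = \<alpha> * x0 + \<beta> * xa + \<gamma> * xb"
    proof -
      show ?thesis
        by (rule that[of "if i = j then - (poly (pderiv A) (r i) * poly B (r i)) else 0"
              "if i = j then - (poly f (r i) * poly (pderiv B) (r i) - poly B (r i) * poly (pderiv f) (r i))
               else - ((poly f (r i) * poly B (r j) - poly B (r i) * poly f (r j)) / (r j - r i))"
              "if i = j then poly (pderiv A) (r i) * poly f (r i) else 0"])
          (cases "i = j"; simp add: bezout_entry_def; simp add: algebra_simps)
    qed
    define c where "c = (\<lambda>k. case k of None \<Rightarrow> \<alpha> + (\<Sum>l\<in>UNIV. (\<beta> * a l + \<gamma> * b l) * X (Some l))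
                       | Some l \<Rightarrow> - (\<beta> * a l + \<gamma> * b l) * X None)"
    have "\<alpha> * Y None + \<beta> * xi a Y + \<gamma> * xi b Y = (\<Sum>k\<in>UNIV. c k * Y k)" for Y
      unfolding sum_UNIV_option c_def xi_def
      by (simp add: sum_distrib_left sum_distrib_right algebra_simps sum.distrib sum_subtractf sum_negf)
    thus ?thesis unfolding abc by blast
  qed
  then obtain c where c: "\<And>i j Y. bezout_entry f A B r i j (Y None) (xi a Y) (xi b Y) = (\<Sum>k\<in>UNIV. c i j k * Y k)"
    by metis
  have xiX: "xi a X = 0" for a by (simp add: xi_def mult.commute)
  have xiN: "xi a (\<lambda>k. \<kappa> * poly (N k) s) = \<kappa> * poly (lin_comb a p) s" for a \<kappa> s
    by (simp add: xi_def p_def project_from_def sum_distrib_left algebra_simps)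
  \<comment> \<open>At \<open>X\<close> this leaves \<open>- A'(r i) * X None * B(r i)\<close> on
    the diagonal.\<close>
  have nonzero: "det (mat e e (\<lambda>(i, j). \<Sum>k\<in>UNIV. c i j k * X k)) \<noteq> 0"
  proof (rule det_mat_diagonal_nonzero)
    fix i assume "i < e"
    then show "(\<Sum>k\<in>UNIV. c i i k * X k) \<noteq> 0"
      unfolding c[symmetric] xiX bezout_entry_def using X0 Br A'r by simp
  next
    fix i j :: nat assume "i \<noteq> j"
    then show "(\<Sum>k\<in>UNIV. c i j k * X k) = 0"
      unfolding c[symmetric] xiX bezout_entry_def by simp
  qed
  have zero: "det (mat e e (\<lambda>(i, j). \<Sum>k\<in>UNIV. c i j k * (\<kappa> * poly (N k) s))) = 0" for s \<kappa>
  proof -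
    define M where "M = (\<lambda>i j. bezout_entry f A B r i j (\<kappa> * poly f s) (\<kappa> * poly A s) (\<kappa> * poly B s))"
    have M: "(\<Sum>k\<in>UNIV. c i j k * (\<kappa> * poly (N k) s)) = M i j" for i j
      using c[of i j "\<lambda>k. \<kappa> * poly (N k) s"] by (simp add: M_def xiN A_def B_def f_def)
    have "det (mat e e (\<lambda>(i, j). M i j)) = 0"
    \<comment> \<open>At a node \<open>s = r j0\<close> the column factor \<open>r j - s\<close>
      vanishes for \<open>j = j0\<close>, but there the whole column \<open>j0\<close> is
      zero.\<close>
    proof (cases "s \<in> R")
      case True
      then obtain j0 where j0: "j0 < e" "s = r j0" using r by auto
      show ?thesis
      proof (rule det_mat_eq_0I[of e _ "\<lambda>j. if j = j0 then 1 else 0"])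
        fix i assume "i < e"
        have "M i j0 = 0"
          using Ar[OF j0(1)] by (simp add: M_def bezout_entry_def j0(2) algebra_simps)
        thus "(\<Sum>j<e. M i j * (if j = j0 then 1 else 0)) = 0"
          by (simp add: if_distrib[of "\<lambda>x. _ * x"] cong: if_cong)
      qed (use j0 in auto)
    next
      case False
      show ?thesis
      \<comment> \<open>The collinearity polynomial of \<open>r i\<close> vanishes at
        \<open>r i\<close> and at \<open>s\<close>, where two of its three points coincide. Dividing
        by the first factor is the Bezout quotient, the second becomes the column factor, and degree
        at most \<open>e - 2\<close> remains.\<close>
      proof (rule det_mat_node_values_eq_0[of e A r "\<lambda>j. r j - s"])
        fix i assume i: "i < e"
        let ?G = "collinearity_poly f A B (r i) (\<kappa> * poly f s) (\<kappa> * poly A s) (\<kappa> * poly B s)"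
        have "poly ?G (r i) = 0" using collinearity_poly_at_self Ar[OF i] by blast
        then obtain K where K: "?G = [:- r i, 1:] * K" by (metis dvdE poly_eq_0_iff_dvd)
        have "poly ?G s = 0" by (simp add: collinearity_poly_def algebra_simps)
        hence "poly K s = 0" using K False i r by auto
        then obtain q where q: "K = [:- s, 1:] * q" by (metis dvdE poly_eq_0_iff_dvd)
        have dl: "degree (lin_comb a p) \<le> e" for a
          by (rule degree_lin_comb_le) (simp add: p_def degree_project_from_le deg)
        have "degree ?G \<le> e"
          using deg dl by (intro degree_collinearity_poly_le) (auto simp: f_def A_def B_def)
        hence "q = 0 \<or> degree q + 2 \<le> e"
          using degree_le_of_linear_factors[of "- r i" "- s" q e] K q by simp
        hence "\<forall>j. Suc j \<ge> e \<longrightarrow> coeff q j = 0" by (auto intro: coeff_eq_0)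
        moreover have "\<forall>j<e. M i j = (r j - s) * poly q (r j)"
        proof (intro allI impI)
          fix j assume j: "j < e"
          have "M i j = poly K (r j)"
            unfolding M_def by (rule bezout_entry_eq[OF r(1) i j Ar[OF i] Ar[OF j] K])
          thus "M i j = (r j - s) * poly q (r j)" unfolding q by (simp add: algebra_simps)
        qed
        ultimately show "\<exists>q. (\<forall>j. Suc j \<ge> e \<longrightarrow> coeff q j = 0) \<and> (\<forall>j<e. M i j = (r j - s) * poly q (r j))"
          by blast
      qed (use e a(1) r Ar A'r False in \<open>auto simp: A_def\<close>)
    qed
    thus ?thesis unfolding M .
  qed
  show ?thesis using nonzero zero by blast
qed

section \<open>Singular parameters\<close>

text \<open>The fibre of the curve through the parameter \<open>t\<close>, as a subscheme of the projective line, is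
  larger than the reduced point \<open>t\<close>: it contains a further zero of \<open>L\<close>, which may be \<open>t\<close> again or,
  if \<open>L\<close> is constant, infinity.\<close>

definition singular_param :: "nat \<Rightarrow> ('m option \<Rightarrow> 'f::field poly) \<Rightarrow> 'f \<Rightarrow> bool" where
  "singular_param e N t \<longleftrightarrow> poly (N None) t \<noteq> 0 \<and> (\<exists>L. L \<noteq> 0 \<and> degree L \<le> 1 \<and>
     (\<forall>l. \<exists>q. (\<forall>j. Suc j \<ge> e \<longrightarrow> coeff q j = 0) \<and>
        project_from (\<lambda>k. poly (N k) t) N l = [:- t, 1:] * (L * q)))"

text \<open>For a homogenized parametrization this is the exceptional set that
  \<open>proper_param\<close> requires to be finite.\<close>

definition double_params :: "('m option \<Rightarrow> 'f::field poly) \<Rightarrow> 'f set" where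
  "double_params N = {t. poly (N None) t \<noteq> 0 \<and> (\<exists>s. s \<noteq> t \<and> poly (N None) s \<noteq> 0 \<and>
     (\<forall>l. poly (N (Some l)) s * poly (N None) t = poly (N (Some l)) t * poly (N None) s))}"

lemma degree_le_1E:
  assumes "degree (L :: 'f::zero poly) \<le> 1"
  obtains b m where "L = [:b, m:]"
proof -
  have "L = [:coeff L 0, coeff L 1:]"
    by (rule poly_eqI) (use assms in \<open>auto simp: coeff_pCons coeff_eq_0 split: nat.split\<close>)
  thus ?thesis using that by blast
qed

text \<open>If every coordinate were proportional to \<open>N None\<close>, a zero of
  \<open>N None\<close> would be a base point. So \<open>N None\<close> would be constant, and as
  \<open>e\<close> is positive, infinity would be a base point.\<close>

lemma ex_wronskian_nonzero:
  fixes N :: "'m option \<Rightarrow> 'f::field_char_0 poly"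
  assumes alg: "\<And>p::'f poly. degree p \<ge> 1 \<Longrightarrow> \<exists>x. poly p x = 0"
    and bpf: "basepoint_free e N" and e: "e \<ge> 1" and N0: "N None \<noteq> 0"
  shows "\<exists>l. N (Some l) * pderiv (N None) \<noteq> pderiv (N (Some l)) * N None"
proof (rule ccontr)
  assume "\<not> ?thesis"
  hence "\<forall>l. \<exists>c. N (Some l) = smult c (N None)"
    using wronskian_zero_imp_proportional[OF _ N0] by blast
  then obtain c where c: "\<And>l. N (Some l) = smult (c l) (N None)" by metis
  have "poly (N None) r \<noteq> 0" for r
  proof
    assume "poly (N None) r = 0"
    hence "poly (N k) r = 0" for k by (cases k) (auto simp: c)
    thus False using bpf by (auto simp: basepoint_free_def)
  qed
  hence "degree (N None) = 0" using alg[of "N None"] by (cases "degree (N None)") auto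
  hence "coeff (N None) e = 0" using e by (intro coeff_eq_0) auto
  hence "coeff (N k) e = 0" for k by (cases k) (auto simp: c)
  thus False using bpf by (auto simp: basepoint_free_def)
qed

text \<open>The points \<open>t\<close> and \<open>r\<close> of the fibre have the same image, so
  the two projections agree up to a scalar and the linear factors of \<open>t\<close> and
  \<open>r\<close> change roles. This keeps the zeros of \<open>L\<close> away from nodes chosen
  outside the singular parameters.\<close>

lemma singular_param_root:
  assumes N: "basepoint_free e N" and X0: "poly (N None) t \<noteq> 0" and L: "L \<noteq> 0" "degree L \<le> 1"
    and q: "\<And>l. \<exists>q. (\<forall>j. Suc j \<ge> e \<longrightarrow> coeff q j = 0) \<and>
        project_from (\<lambda>k. poly (N k) t) N l = [:- t, 1:] * (L * q)"
    and r: "poly L r = 0"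
  shows "singular_param e N r"
proof -
  obtain b m where bm: "L = [:b, m:]" using L(2) by (rule degree_le_1E)
  have m: "m \<noteq> 0" using r L(1) bm by auto
  have "b = - m * r" using r bm by (simp add: add_eq_0_iff mult.commute)
  hence L': "L = smult m [:- r, 1:]" using bm by (simp add: mult.commute)
  have z: "poly (N (Some l)) t * poly (N None) r = poly (N None) t * poly (N (Some l)) r" for l
  proof -
    obtain q where "project_from (\<lambda>k. poly (N k) t) N l = [:- t, 1:] * (L * q)" using q by blast
    hence "poly (project_from (\<lambda>k. poly (N k) t) N l) r = 0" using r by simp
    thus ?thesis by (simp add: project_from_def)
  qed
  have N0r: "poly (N None) r \<noteq> 0"
  proof
    assume "poly (N None) r = 0"
    hence "poly (N k) r = 0" for k using z X0 by (cases k) auto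
    thus False using N by (auto simp: basepoint_free_def)
  qed
  define c where "c = poly (N None) r / poly (N None) t"
  have c: "poly (N k) r = c * poly (N k) t" for k
    using z X0 N0r by (cases k) (auto simp: c_def field_simps)
  have pr: "project_from (\<lambda>k. poly (N k) r) N l = smult c (project_from (\<lambda>k. poly (N k) t) N l)" for l
    unfolding c by (simp add: project_from_def smult_diff_right)
  have "\<exists>q. (\<forall>j. Suc j \<ge> e \<longrightarrow> coeff q j = 0) \<and>
        project_from (\<lambda>k. poly (N k) r) N l = [:- r, 1:] * ([:- t, 1:] * q)" for l
  proof -
    obtain q where q: "\<And>j. Suc j \<ge> e \<Longrightarrow> coeff q j = 0"
      "project_from (\<lambda>k. poly (N k) t) N l = [:- t, 1:] * (L * q)" using q by blast
    have "project_from (\<lambda>k. poly (N k) r) N l = [:- r, 1:] * ([:- t, 1:] * smult (c * m) q)"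
      unfolding pr q(2) L' by (simp only: mult_smult_right mult_smult_left smult_smult mult.left_commute mult.assoc)
    thus ?thesis using q(1) by (intro exI[of _ "smult (c * m) q"]) auto
  qed
  moreover have "[:- t, 1:] \<noteq> 0" "degree [:- t, 1:] \<le> 1" by auto
  ultimately show ?thesis using N0r unfolding singular_param_def by blast
qed

text \<open>The zero of \<open>L\<close> is infinity, \<open>t\<close> itself or another parameter.
  Accordingly the image of \<open>t\<close> agrees with that of infinity, a Wronskian vanishes at
  \<open>t\<close>, or \<open>t\<close> is a double parameter; each happens finitely often.
  Finiteness comes before the count because the count chooses its nodes outside this set.\<close>

lemma finite_singular_params:
  fixes N :: "'m option \<Rightarrow> 'f::field_char_0 poly"
  assumes alg: "\<And>p::'f poly. degree p \<ge> 1 \<Longrightarrow> \<exists>x. poly p x = 0"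
    and bpf: "basepoint_free e N" and e: "e \<ge> 1" and N0: "N None \<noteq> 0"
    and dbl: "finite (double_params N)"
  shows "finite {t. singular_param e N t}"
proof -
  obtain l0 where l0: "N (Some l0) * pderiv (N None) \<noteq> pderiv (N (Some l0)) * N None"
    using ex_wronskian_nonzero[OF alg bpf e N0] by blast
  define W where "W = N (Some l0) * pderiv (N None) - pderiv (N (Some l0)) * N None"
  have finW: "finite {t. poly W t = 0}" using l0 poly_roots_finite[of W] by (simp add: W_def)
  define c where "c = (\<lambda>k. coeff (N k) e)"
  \<comment> \<open>If \<open>c None\<close> is nonzero, the zeros of \<open>V\<close> include the
    parameters whose coordinate \<open>l0\<close> agrees with that of the image of infinity;
    \<open>V = 0\<close> would make this coordinate constant.\<close>
  define V where "V = smult (c None) (N (Some l0)) - smult (c (Some l0)) (N None)"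
  have finV: "finite {t. c None \<noteq> 0 \<and> poly V t = 0}"
  proof (cases "c None = 0")
    case False
    have "V \<noteq> 0"
    proof
      assume "V = 0"
      hence "smult (1 / c None) (smult (c None) (N (Some l0))) = smult (1 / c None) (smult (c (Some l0)) (N None))"
        by (simp add: V_def)
      hence "N (Some l0) = smult (c (Some l0) / c None) (N None)" using False by simp
      thus False using l0 by (simp add: pderiv_smult mult.commute)
    qed
    thus ?thesis using poly_roots_finite[of V] False by simp
  qed simp
  have "{t. singular_param e N t} \<subseteq> double_params N \<union> {t. poly W t = 0} \<union> {t. c None \<noteq> 0 \<and> poly V t = 0}"
  proof
    fix t assume "t \<in> {t. singular_param e N t}"
    then obtain L where t: "poly (N None) t \<noteq> 0" and L: "L \<noteq> 0" "degree L \<le> 1"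
      and q: "\<And>l. \<exists>q. (\<forall>j. Suc j \<ge> e \<longrightarrow> coeff q j = 0) \<and>
        project_from (\<lambda>k. poly (N k) t) N l = [:- t, 1:] * (L * q)"
      unfolding singular_param_def by blast
    obtain b m where bm: "L = [:b, m:]" using L(2) by (rule degree_le_1E)
    consider "m = 0" | "m \<noteq> 0" "- b / m = t" | "m \<noteq> 0" "- b / m \<noteq> t" by blast
    then show "t \<in> double_params N \<union> {t. poly W t = 0} \<union> {t. c None \<noteq> 0 \<and> poly V t = 0}"
    proof cases
      case 1
      have z: "poly (N (Some l)) t * c None = poly (N None) t * c (Some l)" for l
      proof -
        obtain q where q: "\<And>j. Suc j \<ge> e \<Longrightarrow> coeff q j = 0"
          "project_from (\<lambda>k. poly (N k) t) N l = [:- t, 1:] * (L * q)" using q by blast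
        have "coeff ([:- t, 1:] * (L * q)) e = 0"
          using q(1)[of e] q(1)[of "e - 1"] e 1 bm by (cases e) (simp_all add: coeff_pCons)
        hence "coeff (project_from (\<lambda>k. poly (N k) t) N l) e = 0" using q(2) by simp
        thus ?thesis by (simp add: project_from_def c_def)
      qed
      have "c None \<noteq> 0"
      proof
        assume "c None = 0"
        hence "c k = 0" for k using z t by (cases k) auto
        thus False using bpf by (auto simp: basepoint_free_def c_def)
      qed
      moreover have "poly V t = 0" using z[of l0] by (simp add: V_def mult.commute)
      ultimately show ?thesis by simp
    next
      case 2
      have "b + m * (- b / m) = 0" using 2(1) by simp
      hence "b + m * t = 0" unfolding 2(2) .
      hence Lt: "poly L t = 0" using bm by (simp add: mult.commute)
      obtain q where q: "project_from (\<lambda>k. poly (N k) t) N l0 = [:- t, 1:] * (L * q)" using q by blast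
      have "poly (pderiv ([:- t, 1:] * (L * q))) t = 0"
        using Lt by (simp only: pderiv_mult) (simp add: pderiv_pCons)
      hence "poly (pderiv (project_from (\<lambda>k. poly (N k) t) N l0)) t = 0" unfolding q .
      thus ?thesis by (simp add: W_def project_from_def pderiv_diff pderiv_smult mult.commute)
    next
      case 3
      define s where "s = - b / m"
      have Ls: "poly L s = 0" using 3 bm by (simp add: s_def)
      have z: "poly (N (Some l)) t * poly (N None) s = poly (N None) t * poly (N (Some l)) s" for l
      proof -
        obtain q where "project_from (\<lambda>k. poly (N k) t) N l = [:- t, 1:] * (L * q)" using q by blast
        hence "poly (project_from (\<lambda>k. poly (N k) t) N l) s = 0" using Ls by simp
        thus ?thesis by (simp add: project_from_def)
      qed
      have "poly (N None) s \<noteq> 0"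
        using singular_param_root[OF bpf t L q Ls] by (simp add: singular_param_def)
      hence "t \<in> double_params N" unfolding double_params_def using t 3 z
        by (auto intro!: exI[of _ s] simp: s_def mult.commute)
      thus ?thesis by simp
    qed
  qed
  thus ?thesis using dbl finW finV by (meson finite_Un finite_subset)
qed

section \<open>The degree count for singular parameters\<close>

lemma double_root_dvd:
  fixes p :: "'f::field poly"
  assumes "poly p r = 0" "poly (pderiv p) r = 0"
  shows "[:- r, 1:] * [:- r, 1:] dvd p"
proof -
  obtain q where q: "p = [:- r, 1:] * q" using assms(1) by (metis dvdE poly_eq_0_iff_dvd)
  have "poly (pderiv p) r = poly q r"
    unfolding q by (simp only: pderiv_mult) (simp add: pderiv_pCons)
  hence "[:- r, 1:] dvd q" using assms(2) poly_eq_0_iff_dvd by metis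
  thus ?thesis unfolding q by (rule mult_dvd_mono[OF dvd_refl])
qed

lemma two_roots_dvd:
  fixes p :: "'f::field poly"
  assumes "poly p r = 0" "poly p s = 0" "r \<noteq> s"
  shows "[:- r, 1:] * [:- s, 1:] dvd p"
proof -
  obtain q where q: "p = [:- r, 1:] * q" using assms(1) by (metis dvdE poly_eq_0_iff_dvd)
  have "poly q s = 0" using assms(2,3) unfolding q by auto
  hence "[:- s, 1:] dvd q" using poly_eq_0_iff_dvd by metis
  thus ?thesis unfolding q by (rule mult_dvd_mono[OF dvd_refl])
qed

lemma poly_det_mat:
  "poly (det (mat k k (\<lambda>(i, j). M i j))) t = det (mat k k (\<lambda>(i, j). poly (M i j) (t :: 'f::comm_ring_1)))"
proof -
  interpret comm_ring_hom "\<lambda>p. poly p t" by unfold_locales auto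
  have "mat k k (\<lambda>(i, j). poly (M i j) t) = map_mat (\<lambda>p. poly p t) (mat k k (\<lambda>(i, j). M i j))"
    by (rule eq_matI) auto
  thus ?thesis by simp
qed

lemma card_det_roots_le:
  fixes M :: "nat \<Rightarrow> nat \<Rightarrow> 'f::field poly"
  assumes "\<And>i j. i < k \<Longrightarrow> j < k \<Longrightarrow> degree (M i j) \<le> d"
    and "det (mat k k (\<lambda>(i, j). poly (M i j) t1)) \<noteq> 0"
    and "\<And>t. t \<in> S \<Longrightarrow> det (mat k k (\<lambda>(i, j). poly (M i j) t)) = 0"
  shows "finite S \<and> card S \<le> d * k"
proof -
  define D where "D = det (mat k k (\<lambda>(i, j). M i j))"
  have "D \<noteq> 0" using assms(2) poly_det_mat[of k M t1] by (auto simp: D_def)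
  have S: "S \<subseteq> {t. poly D t = 0}" using assms(3) by (auto simp: D_def poly_det_mat)
  have fin: "finite {t. poly D t = 0}" using \<open>D \<noteq> 0\<close> poly_roots_finite by blast
  have "card S \<le> card {t. poly D t = 0}" using S fin by (rule card_mono[rotated])
  also have "\<dots> \<le> degree D" using \<open>D \<noteq> 0\<close> by (intro card_poly_roots_bound) auto
  also have "\<dots> \<le> d * k" unfolding D_def by (rule degree_det_le) (use assms(1) in auto)
  finally show ?thesis using finite_subset[OF S fin] by blast
qed

text \<open>A common zero \<open>r\<close> of the quotients would be a second point in the fibre of
  \<open>t1\<close>, with \<open>L\<close> the linear factor at \<open>r\<close>, or
  \<open>L = 1\<close> if the zero is infinity. Geometrically, projection from a smooth point lowers
  the degree by one.\<close>

lemma basepoint_free_quotient_at_nonsingular: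
  fixes N :: "'m option \<Rightarrow> 'f::field poly"
  assumes bpf: "basepoint_free e N" and e: "e \<ge> 1" and t1: "poly (N None) t1 \<noteq> 0" "\<not> singular_param e N t1"
    and ph: "\<And>l. project_from (\<lambda>k. poly (N k) t1) N l = [:- t1, 1:] * ph l"
  shows "basepoint_free (e - 1) ph"
proof -
  have dph: "degree (ph l) \<le> e - 1" for l
  proof (cases "ph l = 0")
    case False
    have "degree ([:- t1, 1:] * ph l) \<le> e"
      unfolding ph[symmetric] using bpf by (intro degree_project_from_le) (auto simp: basepoint_free_def)
    moreover have "degree ([:- t1, 1:] * ph l) = Suc (degree (ph l))"
      using degree_mult_eq[of "[:- t1, 1:]" "ph l"] False by auto
    ultimately show ?thesis by simp
  qed simp
  have "\<exists>l. coeff (ph l) (e - 1) \<noteq> 0"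
  proof (rule ccontr)
    assume a: "\<not> ?thesis"
    have "\<forall>j. Suc j \<ge> e \<longrightarrow> coeff (ph l) j = 0" for l
    proof (intro allI impI)
      fix j assume "e \<le> Suc j"
      then consider "j = e - 1" | "j > e - 1" by linarith
      thus "coeff (ph l) j = 0" using a dph[of l] by cases (auto intro: coeff_eq_0)
    qed
    hence "\<exists>q. (\<forall>j. Suc j \<ge> e \<longrightarrow> coeff q j = 0) \<and>
        project_from (\<lambda>k. poly (N k) t1) N l = [:- t1, 1:] * (1 * q)" for l
      using ph[of l] by (intro exI[of _ "ph l"]) simp
    moreover have "(1 :: 'f poly) \<noteq> 0" "degree (1 :: 'f poly) \<le> 1" by auto
    ultimately have "singular_param e N t1"
      using t1(1) unfolding singular_param_def by blast
    thus False using t1(2) by blast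
  qed
  moreover have "\<exists>l. poly (ph l) r \<noteq> 0" for r
  proof (rule ccontr)
    assume a: "\<not> ?thesis"
    hence "\<forall>l. \<exists>q. ph l = [:- r, 1:] * q" by (metis dvdE poly_eq_0_iff_dvd)
    then obtain q where q: "\<And>l. ph l = [:- r, 1:] * q l" by metis
    have "\<forall>j. Suc j \<ge> e \<longrightarrow> coeff (q l) j = 0" for l
    proof (cases "q l = 0")
      case False
      have "degree ([:- t1, 1:] * ([:- r, 1:] * q l)) \<le> e"
        unfolding q[symmetric] ph[symmetric] using bpf
        by (intro degree_project_from_le) (auto simp: basepoint_free_def)
      hence "q l = 0 \<or> degree (q l) + 2 \<le> e" by (rule degree_le_of_linear_factors)
      thus ?thesis using False by (auto intro: coeff_eq_0)
    qed simp
    hence "\<exists>q. (\<forall>j. Suc j \<ge> e \<longrightarrow> coeff q j = 0) \<and>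
        project_from (\<lambda>k. poly (N k) t1) N l = [:- t1, 1:] * ([:- r, 1:] * q)" for l
      using ph[of l] q[of l] by metis
    moreover have "[:- r, 1:] \<noteq> 0" "degree [:- r, 1:] \<le> 1" by auto
    ultimately have "singular_param e N t1"
      using t1(1) unfolding singular_param_def by blast
    thus False using t1(2) by blast
  qed
  ultimately show ?thesis using dph by (auto simp: basepoint_free_def)
qed

text \<open>As a function of the third point, the determinant of three points in the plane is a
  linear form that vanishes at the first. With the point of \<open>t0\<close> as the first, it is
  cut out by a hyperplane through that point.\<close>

lemma collinearity_poly_lin_comb:
  fixes N :: "'m::finite option \<Rightarrow> 'f::field_char_0 poly"
  assumes X0: "poly (N None) t0 \<noteq> 0" and \<rho>: "poly A \<rho> = 0"
    and A: "A = lin_comb a (project_from T N)" and B: "B = lin_comb b (project_from T N)"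
  shows "\<exists>g. collinearity_poly (N None) A B \<rho> (poly (N None) t0) (poly A t0) (poly B t0)
     = lin_comb g (project_from (\<lambda>k. poly (N k) t0) N)"
proof -
  define f where "f = N None"
  define X where "X = (\<lambda>k. poly (N k) t0)"
  define \<alpha> where "\<alpha> = - poly A t0 * poly f \<rho>"
  define \<beta> where "\<beta> = poly f t0 * poly B \<rho> - poly B t0 * poly f \<rho>"
  \<comment> \<open>The right side is the combination of a member through \<open>T\<close> with
    \<open>f\<close> that vanishes at \<open>t0\<close>; the identity exchanges the centre
    \<open>T\<close> for the point of \<open>t0\<close>.\<close>
  have key: "T None * (\<Sum>l\<in>UNIV. a l * poly (project_from X N l) y) =
      poly f t0 * poly (lin_comb a (project_from T N)) y - poly (lin_comb a (project_from T N)) t0 * poly f y" for a y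
    by (simp add: project_from_def X_def f_def algebra_simps sum_distrib_left sum_distrib_right
        sum_subtractf sum.distrib)
  define g where "g = (\<lambda>l. T None * (\<alpha> * b l - \<beta> * a l) / poly f t0)"
  have "poly (collinearity_poly f A B \<rho> (poly f t0) (poly A t0) (poly B t0)) y = poly (lin_comb g (project_from X N)) y" for y
  proof -
    have "poly f t0 * poly (lin_comb g (project_from X N)) y =
        \<alpha> * (T None * (\<Sum>l\<in>UNIV. b l * poly (project_from X N l) y))
        - \<beta> * (T None * (\<Sum>l\<in>UNIV. a l * poly (project_from X N l) y))"
      using X0 unfolding poly_lin_comb sum_distrib_left sum_subtractf[symmetric]
      by (intro sum.cong) (auto simp: g_def f_def field_simps)
    also have "\<dots> = \<alpha> * (poly f t0 * poly B y - poly B t0 * poly f y)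
        - \<beta> * (poly f t0 * poly A y - poly A t0 * poly f y)"
      unfolding key A B ..
    also have "\<dots> = poly f t0 * poly (collinearity_poly f A B \<rho> (poly f t0) (poly A t0) (poly B t0)) y"
      unfolding collinearity_poly_def \<alpha>_def \<beta>_def by (simp add: algebra_simps)
    finally show ?thesis using X0 by (simp add: f_def)
  qed
  hence "collinearity_poly f A B \<rho> (poly f t0) (poly A t0) (poly B t0) = lin_comb g (project_from X N)"
    using poly_eq_poly_eq_iff by blast
  thus ?thesis unfolding f_def X_def by blast
qed

text \<open>For a fixed node \<open>r i\<close> the entry \<open>(i, j)\<close> of the Bezout matrix vanishes, as a function of the
  point \<open>N t\<close>, at \<open>t = r i\<close> and \<open>t = r j\<close>; removing these zeros brings the degree of the determinant
  down to the one predicted by the genus formula.\<close>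

lemma card_singular_params_le:
  fixes N :: "'m::finite option \<Rightarrow> 'f::field_char_0 poly"
  assumes alg: "\<And>p::'f poly. degree p \<ge> 1 \<Longrightarrow> \<exists>x. poly p x = 0"
    and bpf: "basepoint_free e N" and e: "e \<ge> 1" and N0: "N None \<noteq> 0"
    and dbl: "finite (double_params N)"
  shows "finite {t. singular_param e N t} \<and> card {t. singular_param e N t} \<le> (e - 2) * (e - 1)"
proof -
  define S where "S = {t. singular_param e N t}"
  have finS: "finite S" unfolding S_def by (rule finite_singular_params[OF assms])
  have deg: "degree (N k) \<le> e" for k using bpf by (auto simp: basepoint_free_def)
  show ?thesis
  proof (cases "e = 1")
    \<comment> \<open>For \<open>e = 1\<close> there are no nodes. The cofactor \<open>q\<close>
      must be zero, so coordinate \<open>l0\<close> would be constant, against its nonzero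
      Wronskian.\<close>
    case True
    obtain l0 where l0: "N (Some l0) * pderiv (N None) \<noteq> pderiv (N (Some l0)) * N None"
      using ex_wronskian_nonzero[OF alg bpf e N0] by blast
    have "\<not> singular_param e N t" for t
    proof
      assume "singular_param e N t"
      then obtain L q where t: "poly (N None) t \<noteq> 0" and q: "\<And>j. Suc j \<ge> e \<Longrightarrow> coeff q j = 0"
         "project_from (\<lambda>k. poly (N k) t) N l0 = [:- t, 1:] * (L * q)"
        unfolding singular_param_def by blast
      have "q = 0" by (rule poly_eqI) (use q(1) True in auto)
      hence z: "smult (poly (N (Some l0)) t) (N None) = smult (poly (N None) t) (N (Some l0))"
        using q(2) by (simp add: project_from_def)
      have "smult (1 / poly (N None) t) (smult (poly (N (Some l0)) t) (N None)) = N (Some l0)"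
        unfolding z using t by simp
      hence "N (Some l0) = smult (poly (N (Some l0)) t / poly (N None) t) (N None)"
        by simp
      then obtain c where "N (Some l0) = smult c (N None)" by blast
      thus False using l0 by (simp add: pderiv_smult mult.commute)
    qed
    thus ?thesis by simp
  next
    case False
    define k where "k = e - 1"
    have k: "k > 0" using e False by (simp add: k_def)
    \<comment> \<open>The centre is a smooth point \<open>t1\<close>: a generic hyperplane through
      it meets the curve in \<open>e - 1\<close> further points, which serve as nodes.\<close>
    have "finite (S \<union> {t. poly (N None) t = 0})" using finS N0 poly_roots_finite by blast
    then obtain t1 where "t1 \<notin> S \<union> {t. poly (N None) t = 0}"
      using ex_new_if_finite[OF infinite_UNIV_char_0] by blast
    hence t1: "poly (N None) t1 \<noteq> 0" "\<not> singular_param e N t1" by (auto simp: S_def)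
    define T where "T = (\<lambda>k. poly (N k) t1)"
    define p where "p = project_from T N"
    have "\<forall>l. \<exists>q. p l = [:- t1, 1:] * q"
    proof
      fix l
      have "poly (p l) t1 = 0" by (simp add: p_def T_def project_from_def)
      thus "\<exists>q. p l = [:- t1, 1:] * q" by (metis dvdE poly_eq_0_iff_dvd)
    qed
    then obtain ph where ph: "\<And>l. p l = [:- t1, 1:] * ph l" by metis
    have bpf': "basepoint_free k ph"
      unfolding k_def using basepoint_free_quotient_at_nonsingular[OF bpf e t1] ph by (simp add: p_def T_def)
    obtain a where a: "degree (lin_comb a ph) = k" "card {r. poly (lin_comb a ph) r = 0} = k"
      "\<And>r. poly (lin_comb a ph) r = 0 \<Longrightarrow> poly (pderiv (lin_comb a ph)) r \<noteq> 0 \<and> r \<notin> insert t1 S"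
      "lin_comb a ph \<noteq> 0"
      using generic_member_simple_roots[OF alg bpf', of "insert t1 S"] finS by blast
    define A' where "A' = lin_comb a ph"
    define R where "R = {r. poly A' r = 0}"
    have finR: "finite R" using a(4) poly_roots_finite unfolding R_def A'_def by blast
    obtain r where "bij_betw r {0..<card R} R" using ex_bij_betw_nat_finite[OF finR] by blast
    hence r: "inj_on r {..<k}" "r ` {..<k} = R"
      using a(2) by (auto simp: bij_betw_def R_def A'_def atLeast0LessThan)
    have A'r: "poly A' (r j) = 0" if "j < k" for j using r that by (auto simp: R_def)
    have A'd: "poly (pderiv A') (r j) \<noteq> 0" and rt1: "r j \<noteq> t1" and rS: "r j \<notin> S" if "j < k" for j
      using a(3) A'r[OF that] unfolding A'_def by blast+
    obtain b where b: "\<forall>v\<in>(\<lambda>\<rho> l. poly (ph l) \<rho>) ` R. (\<Sum>l\<in>UNIV. b l * v l) \<noteq> 0"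
      using linear_form_avoiding[of "(\<lambda>\<rho> l. poly (ph l) \<rho>) ` R"] bpf' finR
      by (auto simp: basepoint_free_def)
    have lc: "lin_comb c p = [:- t1, 1:] * lin_comb c ph" for c
      unfolding lin_comb_def sum_distrib_left by (intro sum.cong refl) (simp only: ph mult_smult_right)
    define A where "A = lin_comb a p"
    define B where "B = lin_comb b p"
    define f where "f = N None"
    have A: "A = [:- t1, 1:] * A'" by (simp only: A_def A'_def lc)
    have Ar: "poly A (r j) = 0" if "j < k" for j using A'r[OF that] by (simp add: A)
    have Ad: "poly (pderiv A) (r j) \<noteq> 0" if "j < k" for j
    proof -
      have "poly (pderiv A) (r j) = (r j - t1) * poly (pderiv A') (r j)"
        using A'r[OF that] unfolding A by (simp only: pderiv_mult) (simp add: pderiv_pCons algebra_simps)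
      thus ?thesis using A'd[OF that] rt1[OF that] by simp
    qed
    have Br: "poly B (r j) \<noteq> 0" if "j < k" for j
    proof -
      have "poly (lin_comb b ph) (r j) \<noteq> 0" using r that b by auto
      moreover have "poly B (r j) = (r j - t1) * poly (lin_comb b ph) (r j)"
        unfolding B_def lc by (simp add: algebra_simps)
      ultimately show ?thesis using rt1[OF that] by simp
    qed
    have At1: "poly A t1 = 0" by (simp add: A)
    have Bt1: "poly B t1 = 0" unfolding B_def lc by simp
    have dlc: "degree (lin_comb c p) \<le> e" for c
      by (rule degree_lin_comb_le) (simp add: p_def degree_project_from_le deg)
    have dfAB: "degree f \<le> e" "degree A \<le> e" "degree B \<le> e"
      using deg dlc by (auto simp: f_def A_def B_def)
    have ex_M: "\<exists>M. degree M \<le> e - 2 \<and> (\<forall>t. bezout_entry f A B r i j (poly f t) (poly A t) (poly B t)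
        = (t - r i) * ((t - r j) * poly M t))" if ij: "i < k" "j < k" for i j
    proof -
      define \<beta> where "\<beta> = (if i = j then poly f (r i) * poly (pderiv B) (r i) - poly B (r i) * poly (pderiv f) (r i)
         else (poly f (r i) * poly B (r j) - poly B (r i) * poly f (r j)) / (r j - r i))"
      define d where "d = (if i = j then poly (pderiv A) (r i) else 0)"
      define G where "G = smult d (smult (poly f (r i)) B - smult (poly B (r i)) f) - smult \<beta> A"
      have G: "bezout_entry f A B r i j (poly f t) (poly A t) (poly B t) = poly G t" for t
        by (simp add: bezout_entry_def G_def d_def \<beta>_def mult.commute)
      have "[:- r i, 1:] * [:- r j, 1:] dvd G"
      proof (cases "i = j")
        case True
        have "poly G (r i) = 0" using Ar[OF ij(1)] by (simp add: G_def)
        \<comment> \<open>The zero is double because \<open>d\<close> and \<open>\<beta>\<close> are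
          the derivatives at \<open>r i\<close> of \<open>A\<close> and of the polynomial that
          \<open>d\<close> multiplies.\<close>
        moreover have "poly (pderiv G) (r i) = 0"
          using True by (simp add: G_def d_def \<beta>_def pderiv_diff pderiv_smult algebra_simps)
        ultimately show ?thesis using double_root_dvd True by blast
      next
        case False
        hence "r i \<noteq> r j" using inj_onD[OF r(1)] ij by auto
        thus ?thesis using False Ar ij by (intro two_roots_dvd) (auto simp: G_def d_def)
      qed
      then obtain M where M: "G = [:- r i, 1:] * ([:- r j, 1:] * M)" by (metis dvdE mult.assoc)
      have "degree G \<le> e" unfolding G_def using dfAB
        by (intro degree_diff_le) (auto intro!: order_trans[OF degree_smult_le] degree_diff_le)
      hence "M = 0 \<or> degree M + 2 \<le> e" using degree_le_of_linear_factors M by metis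
      hence "degree M \<le> e - 2" by auto
      moreover have "poly G t = (t - r i) * ((t - r j) * poly M t)" for t
        unfolding M by (simp add: algebra_simps)
      ultimately show ?thesis unfolding G by blast
    qed
    hence "\<forall>i j. \<exists>M. i < k \<longrightarrow> j < k \<longrightarrow> degree M \<le> e - 2 \<and> (\<forall>t. bezout_entry f A B r i j (poly f t) (poly A t) (poly B t)
        = (t - r i) * ((t - r j) * poly M t))" by blast
    then obtain M where M: "\<And>i j. i < k \<Longrightarrow> j < k \<Longrightarrow> degree (M i j) \<le> e - 2"
      "\<And>i j t. i < k \<Longrightarrow> j < k \<Longrightarrow> bezout_entry f A B r i j (poly f t) (poly A t) (poly B t)
        = (t - r i) * ((t - r j) * poly (M i j) t)" by metis
    have "finite S \<and> card S \<le> (e - 2) * k"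
    proof (rule card_det_roots_le[of k M "e - 2" t1 S, OF M(1)])
      show "det (mat k k (\<lambda>(i, j). poly (M i j) t1)) \<noteq> 0"
      proof (rule det_mat_diagonal_nonzero)
        fix i assume i: "i < k"
        have "bezout_entry f A B r i i (poly f t1) (poly A t1) (poly B t1) \<noteq> 0"
          using Ad[OF i] Br[OF i] t1(1) by (simp add: bezout_entry_def At1 Bt1 f_def)
        thus "poly (M i i) t1 \<noteq> 0" using M(2)[OF i i, of t1] by auto
      next
        fix i j assume ij: "i < k" "j < k" "i \<noteq> j"
        have "bezout_entry f A B r i j (poly f t1) (poly A t1) (poly B t1) = 0"
          using ij(3) by (simp add: bezout_entry_def At1)
        thus "poly (M i j) t1 = 0" using M(2)[OF ij(1,2), of t1] rt1 ij by auto
      qed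
    next
      fix t0 assume t0S: "t0 \<in> S"
      then obtain L where t0: "poly (N None) t0 \<noteq> 0" and L: "L \<noteq> 0" "degree L \<le> 1"
        and q: "\<And>l. \<exists>q. (\<forall>j. Suc j \<ge> e \<longrightarrow> coeff q j = 0) \<and>
          project_from (\<lambda>k. poly (N k) t0) N l = [:- t0, 1:] * (L * q)"
        unfolding S_def singular_param_def by blast
      have rt0: "r j \<noteq> t0" if "j < k" for j using rS[OF that] t0S by auto
      \<comment> \<open>A zero of \<open>L\<close> is itself a singular parameter, whereas the nodes
        are not.\<close>
      have Lr: "poly L (r j) \<noteq> 0" if "j < k" for j
        using singular_param_root[OF bpf t0 L q, of "r j"] rS[OF that] by (auto simp: S_def)
      obtain ql where ql: "\<And>l j. Suc j \<ge> e \<Longrightarrow> coeff (ql l) j = 0"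
        "\<And>l. project_from (\<lambda>k. poly (N k) t0) N l = [:- t0, 1:] * (L * ql l)" using q by metis
      show "det (mat k k (\<lambda>(i, j). poly (M i j) t0)) = 0"
      proof (rule det_mat_node_values_eq_0[OF k a(1)[folded A'_def] r(1) A'r A'd Lr])
        fix i assume i: "i < k"
        let ?G = "collinearity_poly f A B (r i) (poly f t0) (poly A t0) (poly B t0)"
        obtain g where "?G = lin_comb g (project_from (\<lambda>k. poly (N k) t0) N)"
          using collinearity_poly_lin_comb[of N t0 A "r i" a T B b] t0 Ar[OF i]
          unfolding f_def A_def B_def p_def by blast
        hence G: "?G = [:- t0, 1:] * (L * lin_comb g ql)"
          unfolding lin_comb_def sum_distrib_left ql(2) by (simp only: mult_smult_right)
        have "poly ?G (r i) = 0" by (rule collinearity_poly_at_self[OF Ar[OF i]])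
        hence "poly (lin_comb g ql) (r i) = 0"
          unfolding G using Lr[OF i] rt0[OF i] by (simp del: poly_lin_comb)
        then obtain qq where qq: "lin_comb g ql = [:- r i, 1:] * qq" by (metis dvdE poly_eq_0_iff_dvd)
        \<comment> \<open>By \<open>singular_param\<close> each \<open>ql l\<close> has degree at
          most \<open>e - 2\<close>, even if \<open>L\<close> is constant. The linear factor of
          \<open>r i\<close> costs one more, which is the bound \<open>k - 2\<close> for
          \<open>qq\<close>.\<close>
        have cq: "coeff qq j = 0" if "Suc j \<ge> k" for j
        proof (cases "qq = 0")
          case False
          have "degree (lin_comb g ql) \<le> e - 2"
            by (rule degree_le) (use ql(1) in auto)
          moreover have "degree (lin_comb g ql) = Suc (degree qq)"
            unfolding qq using degree_mult_eq[of "[:- r i, 1:]" qq] False by auto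
          ultimately show ?thesis using that by (intro coeff_eq_0) (simp add: k_def)
        qed simp
        have GK: "?G = [:- r i, 1:] * ([:- t0, 1:] * (L * qq))"
          unfolding G qq by (simp only: mult.left_commute)
        \<comment> \<open>Of the trivial zeros, \<open>t0 - r j\<close> cancels up to sign against
          the factor of \<open>t0\<close> evaluated at \<open>r j\<close>, while
          \<open>t0 - r i\<close> depends on the row only and is absorbed into
          \<open>qq\<close>.\<close>
        have "poly (M i j) t0 = poly L (r j) * poly (smult (- 1 / (t0 - r i)) qq) (r j)" if j: "j < k" for j
        proof -
          have "(t0 - r i) * ((t0 - r j) * poly (M i j) t0) = poly ([:- t0, 1:] * (L * qq)) (r j)"
            using bezout_entry_eq[OF r(1) i j Ar[OF i] Ar[OF j] GK] M(2)[OF i j, of t0] by simp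
          also have "\<dots> = (t0 - r j) * (- (poly L (r j) * poly qq (r j)))" by (simp add: algebra_simps)
          finally have "(t0 - r j) * ((t0 - r i) * poly (M i j) t0) = (t0 - r j) * (- (poly L (r j) * poly qq (r j)))"
            by (simp only: mult.left_commute)
          hence "(t0 - r i) * poly (M i j) t0 = - (poly L (r j) * poly qq (r j))"
            using rt0[OF j] unfolding mult_cancel_left by auto
          thus ?thesis using rt0[OF i] by (simp add: field_simps)
        qed
        moreover have "\<forall>j. Suc j \<ge> k \<longrightarrow> coeff (smult (- 1 / (t0 - r i)) qq) j = 0" using cq by simp
        ultimately show "\<exists>q. (\<forall>j. Suc j \<ge> k \<longrightarrow> coeff q j = 0) \<and> (\<forall>j<k. poly (M i j) t0 = poly L (r j) * poly q (r j))"
          by blast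
      qed
    qed
    thus ?thesis by (simp add: S_def k_def)
  qed
qed

section \<open>Polynomial functions and Zariski closures\<close>

text \<open>Exponents may repeat in \<open>ex\<close> here; they are collected into the coefficient
  function that \<open>poly_fun\<close> demands. Sums and products of polynomial functions can then
  be indexed by disjoint sums and products of the index sets.\<close>

lemma poly_funI:
  fixes c :: "'j \<Rightarrow> 'f::field"
  assumes J: "finite J" and supp: "\<And>j i. j \<in> J \<Longrightarrow> i \<notin> I \<Longrightarrow> ex j i = 0"
    and f: "\<And>x. f x = (\<Sum>j\<in>J. c j * (\<Prod>i\<in>I. x i ^ ex j i))"
  shows "poly_fun I UNIV f"
proof -
  define C where "C = (\<lambda>e. \<Sum>j\<in>{j\<in>J. ex j = e}. c j)"
  have sub: "{e. C e \<noteq> 0} \<subseteq> ex ` J"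
  proof
    fix e assume "e \<in> {e. C e \<noteq> 0}"
    hence "{j\<in>J. ex j = e} \<noteq> {}" by (auto simp: C_def simp del: Collect_empty_eq)
    thus "e \<in> ex ` J" by auto
  qed
  have "f x = (\<Sum>e\<in>{e. C e \<noteq> 0}. C e * (\<Prod>i\<in>I. x i ^ e i))" for x
  proof -
    have "f x = (\<Sum>e\<in>ex ` J. \<Sum>j\<in>{j\<in>J. ex j = e}. c j * (\<Prod>i\<in>I. x i ^ ex j i))"
      unfolding f by (rule sum.image_gen[OF J])
    also have "\<dots> = (\<Sum>e\<in>ex ` J. C e * (\<Prod>i\<in>I. x i ^ e i))"
      by (intro sum.cong refl) (simp add: C_def sum_distrib_right)
    also have "\<dots> = (\<Sum>e\<in>{e. C e \<noteq> 0}. C e * (\<Prod>i\<in>I. x i ^ e i))"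
      using sub J by (intro sum.mono_neutral_right) auto
    finally show ?thesis .
  qed
  moreover have "finite {e. C e \<noteq> 0}" using sub J finite_subset by blast
  moreover have "\<forall>e. C e \<noteq> 0 \<longrightarrow> (\<forall>i. i \<notin> I \<longrightarrow> e i = 0)"
  proof (intro allI impI)
    fix e i assume "C e \<noteq> 0" "i \<notin> I"
    moreover obtain j where "j \<in> J" "e = ex j" using sub \<open>C e \<noteq> 0\<close> by auto
    ultimately show "e i = 0" using supp by simp
  qed
  ultimately show ?thesis unfolding poly_fun_def by (intro exI[of _ C] conjI) simp_all
qed

lemma poly_funD:
  assumes "poly_fun I S f"
  shows "\<exists>J c. finite J \<and> (\<forall>e i. e \<in> J \<longrightarrow> i \<notin> I \<longrightarrow> e i = 0) \<and> (\<forall>e. c e \<in> S) \<and>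
    (\<forall>x. f x = (\<Sum>e\<in>J. c e * (\<Prod>i\<in>I. x i ^ e i)))"
proof -
  obtain c where "finite {e. c e \<noteq> 0}" "\<forall>e. c e \<in> S" "\<forall>e. c e \<noteq> 0 \<longrightarrow> (\<forall>i. i \<notin> I \<longrightarrow> e i = 0)"
    "\<forall>x. f x = (\<Sum>e\<in>{e. c e \<noteq> 0}. c e * (\<Prod>i\<in>I. x i ^ e i))"
    using assms unfolding poly_fun_def by blast
  thus ?thesis by (intro exI[of _ "{e. c e \<noteq> 0}"] exI[of _ c]) blast
qed

lemma poly_fun_const [intro]: "poly_fun I UNIV (\<lambda>x. c)"
  by (rule poly_funI[of "{()}" I "\<lambda>_ _. 0" _ "\<lambda>_. c"]) auto

lemma poly_fun_coord [intro]:
  assumes "finite I" "i \<in> I"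
  shows "poly_fun I UNIV (\<lambda>x. x i)"
proof (rule poly_funI[of "{()}" I "\<lambda>_ k. if k = i then 1 else 0" _ "\<lambda>_. 1"])
  fix x :: "'a \<Rightarrow> 'b"
  have "(\<Prod>k\<in>I. x k ^ (if k = i then 1 else 0)) = (\<Prod>k\<in>I. if k = i then x k else 1)"
    by (intro prod.cong) auto
  thus "x i = (\<Sum>j\<in>{()}. 1 * (\<Prod>k\<in>I. x k ^ (if k = i then 1 else 0)))"
    using assms by simp
qed (use assms in auto)

lemma poly_fun_add [intro]:
  assumes "poly_fun I UNIV f" "poly_fun I UNIV g"
  shows "poly_fun I UNIV (\<lambda>x. f x + g x)"
proof -
  obtain J c where f: "finite J" "\<And>e i. e \<in> J \<Longrightarrow> i \<notin> I \<Longrightarrow> e i = 0"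
    "\<And>e. c e \<in> UNIV" "\<And>x. f x = (\<Sum>e\<in>J. c e * (\<Prod>i\<in>I. x i ^ e i))" using poly_funD[OF assms(1)] by blast
  obtain J' c' where g: "finite J'" "\<And>e i. e \<in> J' \<Longrightarrow> i \<notin> I \<Longrightarrow> e i = 0"
    "\<And>e. c' e \<in> UNIV" "\<And>x. g x = (\<Sum>e\<in>J'. c' e * (\<Prod>i\<in>I. x i ^ e i))" using poly_funD[OF assms(2)] by blast
  show ?thesis
    by (rule poly_funI[of "J <+> J'" I "case_sum id id" _ "case_sum c c'"])
      (use f g in \<open>auto simp: sum.Plus\<close>)
qed

lemma poly_fun_mult [intro]:
  assumes "poly_fun I UNIV f" "poly_fun I UNIV g"
  shows "poly_fun I UNIV (\<lambda>x. f x * g x)"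
proof -
  obtain J c where f: "finite J" "\<And>e i. e \<in> J \<Longrightarrow> i \<notin> I \<Longrightarrow> e i = 0"
    "\<And>e. c e \<in> UNIV" "\<And>x. f x = (\<Sum>e\<in>J. c e * (\<Prod>i\<in>I. x i ^ e i))" using poly_funD[OF assms(1)] by blast
  obtain J' c' where g: "finite J'" "\<And>e i. e \<in> J' \<Longrightarrow> i \<notin> I \<Longrightarrow> e i = 0"
    "\<And>e. c' e \<in> UNIV" "\<And>x. g x = (\<Sum>e\<in>J'. c' e * (\<Prod>i\<in>I. x i ^ e i))" using poly_funD[OF assms(2)] by blast
  show ?thesis
  proof (rule poly_funI[of "J \<times> J'" I "\<lambda>(e, e') i. e i + e' i" _ "\<lambda>(e, e'). c e * c' e'"])
    fix x
    have "f x * g x = (\<Sum>(e, e')\<in>J \<times> J'. (c e * (\<Prod>i\<in>I. x i ^ e i)) * (c' e' * (\<Prod>i\<in>I. x i ^ e' i)))"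
      unfolding f(4) g(4) by (simp only: sum_product sum.cartesian_product)
    also have "\<dots> = (\<Sum>j\<in>J \<times> J'. (case j of (e, e') \<Rightarrow> c e * c' e') * (\<Prod>i\<in>I. x i ^ (case j of (e, e') \<Rightarrow> \<lambda>i. e i + e' i) i))"
      by (intro sum.cong) (auto simp: power_add prod.distrib)
    finally show "f x * g x = \<dots>" .
  qed (use f g in auto)
qed

lemma poly_fun_diff [intro]:
  assumes "poly_fun I UNIV f" "poly_fun I UNIV g"
  shows "poly_fun I UNIV (\<lambda>x. f x - g x)"
  using poly_fun_add[OF assms(1) poly_fun_mult[OF poly_fun_const[of I "-1"] assms(2)]] by simp

lemma poly_fun_sum [intro]:
  assumes "\<And>a. a \<in> A \<Longrightarrow> poly_fun I UNIV (f a)"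
  shows "poly_fun I UNIV (\<lambda>x. \<Sum>a\<in>A. f a x)"
  using assms by (induction A rule: infinite_finite_induct) auto

lemma poly_fun_prod [intro]:
  assumes "\<And>a. a \<in> A \<Longrightarrow> poly_fun I UNIV (f a)"
  shows "poly_fun I UNIV (\<lambda>x. \<Prod>a\<in>A. f a x)"
  using assms by (induction A rule: infinite_finite_induct) auto

lemma poly_fun_poly [intro]:
  assumes "poly_fun I UNIV f"
  shows "poly_fun I UNIV (\<lambda>x. poly p (f x))"
  by (induction p) (use assms in auto)

lemma poly_fun_det:
  assumes "\<And>i j. poly_fun I UNIV (M i j)"
  shows "poly_fun I UNIV (\<lambda>x. det (mat k k (\<lambda>(i, j). M i j x)))"
proof -
  have lt: "p i < k" if "p permutes {0..<k}" "i < k" for p i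
    using permutes_in_image[OF that(1), of i] that(2) by auto
  have "det (mat k k (\<lambda>(i, j). M i j x)) =
      (\<Sum>p\<in>{p. p permutes {0..<k}}. signof p * (\<Prod>i=0..<k. M i (p i) x))" for x
    by (subst det_def'[of _ k]) (auto intro!: sum.cong prod.cong simp: lt)
  thus ?thesis
    by (simp only:) (intro poly_fun_sum poly_fun_mult poly_fun_prod poly_fun_const assms)
qed

section \<open>Field automorphisms acting on polynomials and polynomial functions\<close>

locale field_automorphism =
  fixes s :: "'f::field \<Rightarrow> 'f"
  assumes bij: "bij s" and add: "s (x + y) = s x + s y" and mult: "s (x * y) = s x * s y" and one: "s 1 = 1"
begin

lemma zero [simp]: "s 0 = 0" using add[of 0 0] by (metis add_0 add_cancel_right_right)

lemma eq_iff [simp]: "s x = s y \<longleftrightarrow> x = y"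
  using bij by (metis bij_pointE)

lemma eq_0_iff [simp]: "s x = 0 \<longleftrightarrow> x = 0" using eq_iff[of x 0] by simp

lemma divide: "s (x / y) = s x / s y"
proof (cases "y = 0")
  case False
  have "s x = s (x / y) * s y" using mult[of "x / y" y] False by simp
  thus ?thesis using False by (simp add: field_simps)
qed simp

lemma sum: "s (sum f A) = (\<Sum>x\<in>A. s (f x))"
  by (induction A rule: infinite_finite_induct) (auto simp: add)

lemma prod: "s (prod f A) = (\<Prod>x\<in>A. s (f x))"
  by (induction A rule: infinite_finite_induct) (auto simp: mult one)

lemma power: "s (x ^ k) = s x ^ k" by (induction k) (auto simp: mult one)

lemma surjE: obtains x where "y = s x" using bij by (metis bij_pointE)

lemma inv_s: "s (inv_into UNIV s x) = x" using bij by (simp add: bij_is_surj surj_f_inv_f)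

lemma coeff_map [simp]: "coeff (map_poly s p) j = s (coeff p j)" by (simp add: coeff_map_poly)

lemma degree_map [simp]: "degree (map_poly s p) = degree p"
  by (rule degree_map_poly) auto

lemma map_poly_eq_0 [simp]: "map_poly s p = 0 \<longleftrightarrow> p = 0"
  by (rule map_poly_eq_0_iff) auto

lemma map_mult: "map_poly s (p * q) = map_poly s p * map_poly s q"
  by (rule poly_eqI) (simp add: coeff_mult sum mult)

lemma poly_map: "poly (map_poly s p) (s x) = s (poly p x)"
  by (simp add: poly_altdef sum mult power)

lemma poly_map_eq_0: "poly (map_poly s p) x = 0 \<longleftrightarrow> poly p (inv_into UNIV s x) = 0"
  using poly_map[of p "inv_into UNIV s x"] by (simp add: inv_s)

lemma psi_at_conj: "psi_at (conj_poly s num) (conj_poly s den) (s t) = s \<circ> psi_at num den t"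
  by (rule ext) (simp add: psi_at_def conj_poly_def poly_map divide)

lemma defined_at_conj: "defined_at (conj_poly s den) (s t) \<longleftrightarrow> defined_at den t"
  by (simp add: defined_at_def conj_poly_def poly_map)

text \<open>This function is \<open>f\<close> with \<open>s\<close> applied to its
  coefficients.\<close>

lemma poly_fun_conj:
  assumes "poly_fun I S f"
  shows "poly_fun I UNIV (\<lambda>x. s (f (inv_into UNIV s \<circ> x)))"
proof -
  obtain J c where f: "finite J" "\<And>e i. e \<in> J \<Longrightarrow> i \<notin> I \<Longrightarrow> e i = 0"
    "\<And>e. c e \<in> S" "\<And>x. f x = (\<Sum>e\<in>J. c e * (\<Prod>i\<in>I. x i ^ e i))" using poly_funD[OF assms] by blast
  show ?thesis
    by (rule poly_funI[of J I id _ "s \<circ> c"]) (use f in \<open>auto simp: sum mult prod power inv_s\<close>)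
qed

lemma poly_fun_fixed:
  assumes "poly_fun I K f" "\<And>x. x \<in> K \<Longrightarrow> s x = x"
  shows "s (f x) = f (s \<circ> x)"
proof -
  obtain J c where f: "finite J" "\<And>e i. e \<in> J \<Longrightarrow> i \<notin> I \<Longrightarrow> e i = 0" "\<And>e. c e \<in> K"
    "\<And>x. f x = (\<Sum>e\<in>J. c e * (\<Prod>i\<in>I. x i ^ e i))" using poly_funD[OF assms(1)] by blast
  show ?thesis unfolding f(4) by (simp add: sum mult prod power assms(2)[OF f(3)])
qed

lemma conj_set_defined_over:
  assumes "defined_over K C" "\<And>x. x \<in> K \<Longrightarrow> s x = x"
  shows "conj_set s C = C"
proof -
  obtain P where P: "\<And>f. f \<in> P \<Longrightarrow> poly_fun UNIV K f" "C = {x. \<forall>f\<in>P. f x = 0}"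
    using assms(1) unfolding defined_over_def by blast
  have iff: "s \<circ> x \<in> C \<longleftrightarrow> x \<in> C" for x
  proof -
    have "f (s \<circ> x) = 0 \<longleftrightarrow> f x = 0" if "f \<in> P" for f
      using poly_fun_fixed[OF P(1)[OF that] assms(2), of x] eq_0_iff[of "f x"] by simp
    thus ?thesis unfolding P(2) by blast
  qed
  have "x = s \<circ> (inv_into UNIV s \<circ> x)" for x :: "'c \<Rightarrow> 'f" by (auto simp: inv_s)
  thus ?thesis unfolding conj_set_def using iff by (metis (no_types, lifting) image_iff subsetI subset_antisym)
qed

end

lemma K_automorphism_imp_field_automorphism:
  "K_automorphism K s \<Longrightarrow> field_automorphism s"
  unfolding K_automorphism_def by unfold_locales auto

lemma K_automorphism_fixes: "K_automorphism K s \<Longrightarrow> x \<in> K \<Longrightarrow> s x = x"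
  unfolding K_automorphism_def by auto

text \<open>\<open>N None\<close> is the homogenizing coordinate, that is, the least common denominator.\<close>

definition homogenization ::
    "nat \<Rightarrow> ('m \<Rightarrow> 'f::field poly) \<Rightarrow> ('m \<Rightarrow> 'f poly) \<Rightarrow> ('m option \<Rightarrow> 'f poly) \<Rightarrow> bool" where
  "homogenization e num den N \<longleftrightarrow> basepoint_free e N \<and> N None \<noteq> 0 \<and>
     (\<forall>l. N (Some l) * den l = N None * num l) \<and> (\<forall>t. poly (N None) t \<noteq> 0 \<longleftrightarrow> defined_at den t)"

text \<open>\<open>L\<close> is a common multiple of the denominators of least degree. If all
  \<open>N k\<close> vanished at \<open>r\<close>, coprimality would force every cofactor
  \<open>c l\<close> to vanish there too, and dividing \<open>L\<close> by the linear factor of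
  \<open>r\<close> would give a smaller common multiple.\<close>

lemma ex_homogenization:
  fixes num den :: "'m::finite \<Rightarrow> 'f::{field,field_gcd} poly"
  assumes den: "\<And>l. den l \<noteq> 0" and cop: "\<And>l. coprime (num l) (den l)"
  shows "\<exists>e N. homogenization e num den N"
proof -
  define mult where "mult = (\<lambda>L. L \<noteq> 0 \<and> (\<forall>l. den l dvd L))"
  have "mult (\<Prod>l\<in>UNIV. den l)" using den by (auto simp: mult_def)
  then obtain L where "mult L" and least: "\<forall>L'. mult L' \<longrightarrow> degree L \<le> degree L'"
    using ex_has_least_nat[of mult _ degree] by blast
  hence L: "L \<noteq> 0" "\<And>l. den l dvd L" by (auto simp: mult_def)
  have min: "degree L \<le> degree L'" if "L' \<noteq> 0" "\<And>l. den l dvd L'" for L'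
    using least that by (simp add: mult_def)
  from L(2) obtain c where c: "\<And>l. L = den l * c l" unfolding dvd_def by metis
  define N where "N = (\<lambda>k. case k of None \<Rightarrow> L | Some l \<Rightarrow> num l * c l)"
  have N: "N None = L" "N (Some l) = num l * c l" for l by (auto simp: N_def)
  have rel: "N (Some l) * den l = N None * num l" for l
    unfolding N by (subst c[of l]) (simp add: ac_simps)
  have no_zero: "\<exists>k. poly (N k) r \<noteq> 0" for r
  proof (rule ccontr)
    assume "\<not> ?thesis"
    hence z: "poly (N k) r = 0" for k by blast
    have "poly (c l) r = 0" for l
    proof (rule ccontr)
      assume nz: "poly (c l) r \<noteq> 0"
      have "poly (num l) r = 0" using z[of "Some l"] nz unfolding N by simp
      moreover have "poly (den l * c l) r = 0" using z[of None] unfolding N by (subst c[of l, symmetric])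
      hence "poly (den l) r = 0" using nz by simp
      ultimately have "[:- r, 1:] dvd num l" "[:- r, 1:] dvd den l" by (simp_all add: poly_eq_0_iff_dvd)
      hence "[:- r, 1:] dvd 1" using cop[of l] by (rule coprime_common_divisor[rotated])
      thus False using poly_eq_0_iff_dvd[of 1 r] by simp
    qed
    hence "\<forall>l. \<exists>c'. c l = [:- r, 1:] * c'" by (metis dvdE poly_eq_0_iff_dvd)
    then obtain c' where c': "\<And>l. c l = [:- r, 1:] * c' l" by metis
    obtain L' where L': "L = [:- r, 1:] * L'" using z[of None] unfolding N by (metis dvdE poly_eq_0_iff_dvd)
    have "L' \<noteq> 0" using L' L(1) by auto
    have "den l dvd L'" for l
    proof -
      have "[:- r, 1:] * L' = [:- r, 1:] * (den l * c' l)"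
        using c[of l] unfolding c' L' by (simp only: mult.left_commute)
      hence "L' = den l * c' l" by (subst (asm) mult_left_cancel) auto
      thus ?thesis by simp
    qed
    hence "degree L \<le> degree L'" using min \<open>L' \<noteq> 0\<close> by blast
    moreover have "degree L = Suc (degree L')"
      unfolding L' using degree_mult_eq[of "[:- r, 1:]" L'] \<open>L' \<noteq> 0\<close> by auto
    ultimately show False by simp
  qed
  define e where "e = Max (range (\<lambda>k. degree (N k)))"
  have dN: "degree (N k) \<le> e" for k unfolding e_def by (rule Max_ge) auto
  have "e \<in> range (\<lambda>k. degree (N k))" unfolding e_def by (rule Max_in) auto
  then obtain k0 where k0: "degree (N k0) = e" by blast
  have "\<exists>k. coeff (N k) e \<noteq> 0"
  proof (cases "N k0 = 0")
    case True
    hence "e = 0" using k0 by simp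
    hence "coeff (N None) e \<noteq> 0" using dN[of None] L(1) N by (metis leading_coeff_0_iff le_zero_eq)
    thus ?thesis by blast
  next
    case False
    thus ?thesis using k0 by (intro exI[of _ k0]) auto
  qed
  hence "basepoint_free e N" using dN no_zero by (auto simp: basepoint_free_def)
  moreover have "poly (N None) t \<noteq> 0 \<longleftrightarrow> defined_at den t" for t
  proof
    assume "poly (N None) t \<noteq> 0"
    thus "defined_at den t" unfolding defined_at_def N using c by (metis mult_zero_left poly_mult)
  next
    assume d: "defined_at den t"
    show "poly (N None) t \<noteq> 0"
    proof
      assume z: "poly (N None) t = 0"
      then obtain l where "poly (N (Some l)) t \<noteq> 0" using no_zero[of t] by (metis not_Some_eq)
      moreover have "poly (N (Some l)) t * poly (den l) t = 0"
        using arg_cong[OF rel[of l], of "\<lambda>p. poly p t"] z by simp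
      ultimately show False using d by (auto simp: defined_at_def)
    qed
  qed
  ultimately show ?thesis unfolding homogenization_def using L(1) N rel by blast
qed

lemma homogenization_at:
  assumes "homogenization e num den N" "defined_at den t"
  shows "poly (N (Some l)) t = psi_at num den t l * poly (N None) t"
proof -
  have "poly (N (Some l)) t * poly (den l) t = poly (N None) t * poly (num l) t"
    using arg_cong[of _ _ "\<lambda>p. poly p t"] assms(1) unfolding homogenization_def by (metis poly_mult)
  thus ?thesis using assms(2) by (simp add: psi_at_def defined_at_def field_simps)
qed

lemma psi_at_eq_iff:
  assumes "homogenization e num den N" "homogenization e' num' den' N'" "defined_at den t" "defined_at den' s"
  shows "psi_at num' den' s = psi_at num den t \<longleftrightarrow>
     (\<forall>l. poly (N' (Some l)) s * poly (N None) t = poly (N (Some l)) t * poly (N' None) s)"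
proof -
  have nz: "poly (N None) t \<noteq> 0" "poly (N' None) s \<noteq> 0"
    using assms unfolding homogenization_def by auto
  show ?thesis
    unfolding homogenization_at[OF assms(1,3)] homogenization_at[OF assms(2,4)]
    using nz by (auto simp: fun_eq_iff)
qed

lemma double_params_eq:
  assumes "homogenization e num den N"
  shows "double_params N = {t. defined_at den t \<and>
      (\<exists>s. defined_at den s \<and> s \<noteq> t \<and> psi_at num den s = psi_at num den t)}"
proof -
  have "defined_at den t = (poly (N None) t \<noteq> 0)" for t using assms unfolding homogenization_def by blast
  thus ?thesis using psi_at_eq_iff[OF assms assms] unfolding double_params_def by auto
qed

lemma (in field_automorphism) homogenization_conj:
  assumes "homogenization e num den N"
  shows "homogenization e (conj_poly s num) (conj_poly s den) (conj_poly s N)"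
proof -
  have "\<exists>k. poly (map_poly s (N k)) r \<noteq> 0" for r
    using assms unfolding poly_map_eq_0 homogenization_def basepoint_free_def by blast
  moreover have "poly (map_poly s (N None)) t \<noteq> 0 \<longleftrightarrow> defined_at (conj_poly s den) t" for t
  proof -
    obtain t' where t': "t = s t'" by (rule surjE)
    show ?thesis using assms unfolding t' defined_at_conj by (simp add: poly_map homogenization_def)
  qed
  ultimately show ?thesis
    using assms by (auto simp: homogenization_def basepoint_free_def conj_poly_def map_mult[symmetric])
qed

lemma (in field_automorphism) proper_param_conj:
  assumes "proper_param num den"
  shows "proper_param (conj_poly s num) (conj_poly s den)"
proof -
  have "{t. defined_at (conj_poly s den) t \<and> (\<exists>u. defined_at (conj_poly s den) u \<and> u \<noteq> t \<and>
      psi_at (conj_poly s num) (conj_poly s den) u = psi_at (conj_poly s num) (conj_poly s den) t)}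
    \<subseteq> s ` {t. defined_at den t \<and> (\<exists>u. defined_at den u \<and> u \<noteq> t \<and> psi_at num den u = psi_at num den t)}"
  proof
    fix t assume "t \<in> {t. defined_at (conj_poly s den) t \<and> (\<exists>u. defined_at (conj_poly s den) u \<and> u \<noteq> t \<and>
      psi_at (conj_poly s num) (conj_poly s den) u = psi_at (conj_poly s num) (conj_poly s den) t)}"
    then obtain u where tu: "defined_at (conj_poly s den) t" "defined_at (conj_poly s den) u" "u \<noteq> t"
      "psi_at (conj_poly s num) (conj_poly s den) u = psi_at (conj_poly s num) (conj_poly s den) t" by blast
    obtain t' where t': "t = s t'" by (rule surjE)
    obtain u' where u': "u = s u'" by (rule surjE)
    have "psi_at num den u' = psi_at num den t'"
      using tu(4) unfolding t' u' psi_at_conj by (simp add: fun_eq_iff)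
    thus "t \<in> s ` {t. defined_at den t \<and> (\<exists>u. defined_at den u \<and> u \<noteq> t \<and> psi_at num den u = psi_at num den t)}"
      using tu unfolding t' u' defined_at_conj by auto
  qed
  thus ?thesis using assms unfolding proper_param_def by (meson finite_imageI finite_subset)
qed

section \<open>The curve as the image of the projective line\<close>

lemma psi_at_in_param_curve: "defined_at den t \<Longrightarrow> psi_at num den t \<in> param_curve num den"
  unfolding param_curve_def zar_closure_def by blast

text \<open>The coefficients of degree \<open>e\<close> are the homogeneous coordinates of the image
  of infinity.\<close>

definition point_at_infinity :: "nat \<Rightarrow> ('m option \<Rightarrow> 'f::field poly) \<Rightarrow> ('m \<Rightarrow> 'f) \<Rightarrow> bool" where
  "point_at_infinity e N x \<longleftrightarrow> coeff (N None) e \<noteq> 0 \<and> (\<forall>l. coeff (N (Some l)) e = x l * coeff (N None) e)"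

text \<open>At a common zero of the projected system the values of \<open>N\<close> are proportional
  to \<open>(1, x)\<close>, so \<open>x\<close> would be the image of that parameter. The
  coefficients of degree \<open>e\<close> give the same conclusion for infinity.\<close>

lemma basepoint_free_project_from:
  fixes x :: "'m::finite \<Rightarrow> 'f::field"
  assumes hom: "homogenization e num den N"
    and off: "\<And>t. defined_at den t \<Longrightarrow> x \<noteq> psi_at num den t" "\<not> point_at_infinity e N x"
  shows "basepoint_free e (project_from (case_option 1 x) N)"
proof -
  have N: "basepoint_free e N" using hom by (simp add: homogenization_def)
  have "\<exists>l. coeff (project_from (case_option 1 x) N l) e \<noteq> 0"
  proof (rule ccontr)
    assume "\<not> ?thesis"
    hence z: "coeff (N (Some l)) e = x l * coeff (N None) e" for l by (simp add: project_from_def)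
    have "coeff (N None) e \<noteq> 0"
    proof
      assume "coeff (N None) e = 0"
      hence "coeff (N k) e = 0" for k using z by (cases k) auto
      thus False using N by (auto simp: basepoint_free_def)
    qed
    thus False using off(2) z by (auto simp: point_at_infinity_def)
  qed
  moreover have "\<exists>l. poly (project_from (case_option 1 x) N l) r \<noteq> 0" for r
  proof (rule ccontr)
    assume "\<not> ?thesis"
    hence z: "poly (N (Some l)) r = x l * poly (N None) r" for l by (simp add: project_from_def)
    have nz: "poly (N None) r \<noteq> 0"
    proof
      assume "poly (N None) r = 0"
      hence "poly (N k) r = 0" for k using z by (cases k) auto
      thus False using N by (auto simp: basepoint_free_def)
    qed
    hence d: "defined_at den r" using hom by (simp add: homogenization_def)
    have "x = psi_at num den r" using homogenization_at[OF hom d] z nz by (auto simp: fun_eq_iff)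
    thus False using off(1) d by blast
  qed
  ultimately show ?thesis
    using N degree_project_from_le[of N e] unfolding basepoint_free_def by blast
qed

lemma param_curve_subset:
  fixes num den :: "'m::finite \<Rightarrow> 'f::field_char_0 poly"
  assumes alg: "\<And>p::'f poly. degree p \<ge> 1 \<Longrightarrow> \<exists>x. poly p x = 0"
    and hom: "homogenization e num den N" and e: "e \<ge> 1" and x: "x \<in> param_curve num den"
  shows "(\<exists>t. defined_at den t \<and> x = psi_at num den t) \<or> point_at_infinity e N x"
proof (rule ccontr)
  assume "\<not> ?thesis"
  hence bpf: "basepoint_free e (project_from (case_option 1 x) N)"
    using basepoint_free_project_from[OF hom] by blast
  have deg: "degree (N k) \<le> e" for k using hom by (auto simp: homogenization_def basepoint_free_def)
  obtain c where c: "\<And>s \<kappa>. det (mat e e (\<lambda>(i, j). \<Sum>k\<in>UNIV. c i j k * (\<kappa> * poly (N k) s))) = 0"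
    "det (mat e e (\<lambda>(i, j). \<Sum>k\<in>UNIV. c i j k * case_option 1 x k)) \<noteq> 0"
    using implicit_determinant[OF alg _ e deg bpf] by auto
  \<comment> \<open>The implicit form with homogenizing coordinate 1: a polynomial function that
    vanishes on the image but not at \<open>x\<close>.\<close>
  define G where "G = (\<lambda>y. det (mat e e (\<lambda>(i, j). \<Sum>k\<in>UNIV. c i j k * case_option 1 y k)))"
  have "poly_fun UNIV UNIV (\<lambda>y :: 'm \<Rightarrow> 'f. case_option 1 y k)" for k
    by (cases k) auto
  hence "poly_fun UNIV UNIV G" unfolding G_def
    by (intro poly_fun_det poly_fun_sum poly_fun_mult poly_fun_const)
  moreover have "G (psi_at num den t) = 0" if "defined_at den t" for t
  proof -
    have nz: "poly (N None) t \<noteq> 0" using that hom by (simp add: homogenization_def)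
    have "case_option 1 (psi_at num den t) k = 1 / poly (N None) t * poly (N k) t" for k
      using homogenization_at[OF hom that] nz by (cases k) auto
    thus ?thesis unfolding G_def using c(1)[of "1 / poly (N None) t" t] by simp
  qed
  ultimately have "G x = 0" using x unfolding param_curve_def zar_closure_def by blast
  thus False using c(2) by (simp add: G_def)
qed

lemma poly_fun_comp_psi:
  fixes num den :: "'m::finite \<Rightarrow> 'f::field poly"
  assumes "poly_fun UNIV S f"
  shows "\<exists>P Q. \<forall>t. defined_at den t \<longrightarrow> poly Q t \<noteq> 0 \<and> f (psi_at num den t) = poly P t / poly Q t"
proof -
  define rat where "rat = (\<lambda>g :: 'f \<Rightarrow> 'f. \<exists>P Q. \<forall>t. defined_at den t \<longrightarrow> poly Q t \<noteq> 0 \<and> g t = poly P t / poly Q t)"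
  have const: "rat (\<lambda>t. c)" for c
    unfolding rat_def by (intro exI[of _ "[:c:]"] exI[of _ 1]) auto
  have add: "rat (\<lambda>t. g t + h t)" if "rat g" "rat h" for g h
  proof -
    from that obtain P Q P' Q' where "\<And>t. defined_at den t \<Longrightarrow> poly Q t \<noteq> 0 \<and> g t = poly P t / poly Q t"
      "\<And>t. defined_at den t \<Longrightarrow> poly Q' t \<noteq> 0 \<and> h t = poly P' t / poly Q' t" unfolding rat_def by blast
    thus ?thesis unfolding rat_def
      by (intro exI[of _ "P * Q' + P' * Q"] exI[of _ "Q * Q'"]) (auto simp: field_simps)
  qed
  have mul: "rat (\<lambda>t. g t * h t)" if "rat g" "rat h" for g h
  proof -
    from that obtain P Q P' Q' where "\<And>t. defined_at den t \<Longrightarrow> poly Q t \<noteq> 0 \<and> g t = poly P t / poly Q t"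
      "\<And>t. defined_at den t \<Longrightarrow> poly Q' t \<noteq> 0 \<and> h t = poly P' t / poly Q' t" unfolding rat_def by blast
    thus ?thesis unfolding rat_def by (intro exI[of _ "P * P'"] exI[of _ "Q * Q'"]) auto
  qed
  have coord: "rat (\<lambda>t. psi_at num den t l)" for l
    unfolding rat_def psi_at_def defined_at_def by (intro exI[of _ "num l"] exI[of _ "den l"]) auto
  have pow: "rat (\<lambda>t. psi_at num den t l ^ k)" for l k
    by (induction k) (auto intro: const mul coord)
  have prd: "rat (\<lambda>t. \<Prod>l\<in>A. psi_at num den t l ^ e l)" for A e
    by (induction A rule: infinite_finite_induct) (auto intro: const mul pow)
  have sm: "rat (\<lambda>t. \<Sum>e\<in>J. c e * (\<Prod>l\<in>UNIV. psi_at num den t l ^ e l))" for J c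
    by (induction J rule: infinite_finite_induct) (simp_all add: const add mul prd)
  obtain J c where "finite J" "\<And>e i. e \<in> J \<Longrightarrow> i \<notin> UNIV \<Longrightarrow> e i = 0" "\<And>e. c e \<in> S"
    "\<And>x. f x = (\<Sum>e\<in>J. c e * (\<Prod>i\<in>UNIV. x i ^ e i))"
    using poly_funD[OF assms] by blast
  thus ?thesis using sm[of c J] unfolding rat_def by simp
qed

text \<open>Along the curve \<open>f\<close> is a quotient of polynomials in the parameter, so it
  vanishes finitely often or everywhere. This takes the place of the irreducibility of the
  curve.\<close>

lemma poly_fun_vanish_on_curve:
  fixes num den :: "'m::finite \<Rightarrow> 'f::field poly"
  assumes "poly_fun UNIV S f" "infinite {t. defined_at den t \<and> f (psi_at num den t) = 0}" "defined_at den t"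
  shows "f (psi_at num den t) = 0"
proof -
  obtain P Q where PQ: "\<And>t. defined_at den t \<Longrightarrow> poly Q t \<noteq> 0 \<and> f (psi_at num den t) = poly P t / poly Q t"
    using poly_fun_comp_psi[OF assms(1)] by blast
  have "{t. defined_at den t \<and> f (psi_at num den t) = 0} \<subseteq> {t. poly P t = 0}"
    using PQ by auto
  hence "P = 0" using assms(2) poly_roots_finite finite_subset by blast
  thus ?thesis using PQ[OF assms(3)] by simp
qed

text \<open>A family of degree 0 describes a constant map, for which every parameter shares its
  image with another one.\<close>

lemma homogenization_degree_pos:
  fixes num den :: "'m::finite \<Rightarrow> 'f::field_char_0 poly"
  assumes hom: "homogenization e num den N" and proper: "proper_param num den"
  shows "e \<ge> 1"
proof (rule ccontr)
  assume "\<not> e \<ge> 1"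
  hence "e = 0" by simp
  hence "degree (N k) = 0" for k using hom unfolding homogenization_def basepoint_free_def by blast
  hence "\<forall>k. \<exists>c. N k = [:c:]" by (metis degree_eq_zeroE)
  then obtain c where c: "\<And>k. N k = [:c k:]" by metis
  have "c None \<noteq> 0" using hom c by (simp add: homogenization_def)
  moreover have "\<exists>s. s \<noteq> t" for t :: 'f by (rule exI[of _ "t + 1"]) simp
  ultimately have "double_params N = UNIV"
    unfolding double_params_def c by (auto simp: mult.commute)
  thus False using proper infinite_UNIV_char_0[where 'a='f] unfolding proper_param_def double_params_eq[OF hom, symmetric] by simp
qed

lemma point_at_infinity_unique: "point_at_infinity e N x \<Longrightarrow> point_at_infinity e N y \<Longrightarrow> x = y"
  unfolding point_at_infinity_def by (auto simp: fun_eq_iff)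

lemma homogenization_degree_le:
  fixes num den :: "'m::finite \<Rightarrow> 'f::field_char_0 poly"
  assumes alg: "\<And>p::'f poly. degree p \<ge> 1 \<Longrightarrow> \<exists>x. poly p x = 0"
    and hom: "homogenization e num den N" and proper: "proper_param num den"
    and d: "curve_degree (param_curve num den) d"
  shows "e \<le> d"
proof -
  have e: "e \<ge> 1" by (rule homogenization_degree_pos[OF hom proper])
  have bpf: "basepoint_free e N" and N0: "N None \<noteq> 0" using hom by (auto simp: homogenization_def)
  \<comment> \<open>Avoiding double parameters makes the \<open>e\<close> intersection points
    distinct; avoiding zeros of \<open>N None\<close> makes them affine.\<close>
  have finBad: "finite (double_params N \<union> {t. poly (N None) t = 0})"
    using proper N0 poly_roots_finite unfolding proper_param_def double_params_eq[OF hom, symmetric] by blast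
  obtain a where a: "lin_comb a N \<noteq> 0" "card {r. poly (lin_comb a N) r = 0} = e"
    "\<And>r. poly (lin_comb a N) r = 0 \<Longrightarrow> r \<notin> double_params N \<union> {t. poly (N None) t = 0}"
    using generic_member_simple_roots[OF alg bpf finBad] by blast
  define R where "R = {r. poly (lin_comb a N) r = 0}"
  have finR: "finite R" unfolding R_def using a(1) poly_roots_finite by blast
  have def_R: "defined_at den r" if "r \<in> R" for r
    using a(3)[of r] that hom by (auto simp: R_def homogenization_def simp del: poly_lin_comb)
  define H where "H = hyperplane (\<lambda>l. a (Some l)) (- a None)"
  have H_iff: "psi_at num den t \<in> H \<longleftrightarrow> t \<in> R" if "defined_at den t" for t
  proof -
    have nz: "poly (N None) t \<noteq> 0" using that hom by (simp add: homogenization_def)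
    have "poly (lin_comb a N) t = (a None + (\<Sum>l\<in>UNIV. a (Some l) * psi_at num den t l)) * poly (N None) t"
      unfolding poly_lin_comb sum_UNIV_option homogenization_at[OF hom that]
      by (simp add: algebra_simps sum_distrib_left sum_distrib_right)
    thus ?thesis using nz by (auto simp: R_def H_def hyperplane_def add_eq_0_iff simp del: poly_lin_comb)
  qed
  \<comment> \<open>Otherwise the member is a multiple of \<open>N None\<close>, cut out by the
    hyperplane at infinity, and its zeros were excluded.\<close>
  have nontriv: "\<exists>l. a (Some l) \<noteq> 0"
  proof (rule ccontr)
    assume "\<not> ?thesis"
    hence z: "lin_comb a N = smult (a None) (N None)" by (simp add: lin_comb_def sum_UNIV_option)
    have "R \<noteq> {}" using a(2) e unfolding R_def by (metis card.empty not_one_le_zero)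
    then obtain r where "r \<in> R" by blast
    hence "a None * poly (N None) r = 0" "poly (N None) r \<noteq> 0" using a(3)[of r] z unfolding R_def by auto
    thus False using a(1) z by simp
  qed
  let ?C = "param_curve num den"
  \<comment> \<open>The hyperplane may also contain the point at infinity. Finiteness has to be
    shown because \<open>curve_degree\<close> bounds only finite intersections.\<close>
  have "?C \<inter> H \<subseteq> psi_at num den ` R \<union> {x. point_at_infinity e N x}"
    using param_curve_subset[OF alg hom e] H_iff by blast
  moreover have "finite {x. point_at_infinity e N x}"
  proof (cases "\<exists>x. point_at_infinity e N x")
    case True
    then obtain x where x: "point_at_infinity e N x" by blast
    have "{x. point_at_infinity e N x} \<subseteq> {x}" using point_at_infinity_unique[OF x] by blast
    thus ?thesis using finite_subset by blast
  qed simp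
  ultimately have fin: "finite (?C \<inter> H)" using finR by (meson finite_UnI finite_imageI finite_subset)
  have "inj_on (psi_at num den) R"
  proof (rule inj_onI)
    fix r r' assume rr: "r \<in> R" "r' \<in> R" "psi_at num den r = psi_at num den r'"
    have "r \<notin> double_params N" using a(3)[of r] rr(1) by (auto simp: R_def simp del: poly_lin_comb)
    thus "r = r'" unfolding double_params_eq[OF hom] using rr def_R by auto
  qed
  hence "e = card (psi_at num den ` R)" using a(2) by (simp add: card_image R_def del: poly_lin_comb)
  also have "\<dots> \<le> card (?C \<inter> H)"
    by (rule card_mono[OF fin]) (use def_R H_iff in \<open>auto intro: psi_at_in_param_curve\<close>)
  also have "\<dots> \<le> d"
  proof -
    have "\<forall>a b. (\<exists>l. a l \<noteq> 0) \<longrightarrow> finite (?C \<inter> hyperplane a b) \<longrightarrow> card (?C \<inter> hyperplane a b) \<le> d"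
      using d unfolding curve_degree_def by (rule conjunct1)
    thus ?thesis using nontriv fin unfolding H_def by (metis (no_types))
  qed
  finally show ?thesis .
qed

section \<open>Moebius reparametrizations\<close>

text \<open>After cancelling the gcd, a generic fibre has as many points as the larger of the two
  degrees. Injectivity allows at most one, so both degrees are at most 1.\<close>

lemma injective_rational_is_moebius:
  fixes P Q :: "'f::{field_char_0,field_gcd} poly"
  assumes alg: "\<And>p::'f poly. degree p \<ge> 1 \<Longrightarrow> \<exists>x. poly p x = 0"
    and Q: "Q \<noteq> 0" and fin: "finite Bad"
    and inj: "\<And>x y. x \<notin> Bad \<Longrightarrow> y \<notin> Bad \<Longrightarrow> poly P x / poly Q x = poly P y / poly Q y \<Longrightarrow> x = y"
  shows "\<exists>a b c f. a * f - b * c \<noteq> 0 \<and> P * [:f, c:] = Q * [:b, a:]"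
proof -
  define g where "g = gcd P Q"
  have g: "g \<noteq> 0" using Q by (simp add: g_def)
  obtain P' Q' where P': "P = g * P'" and Q': "Q = g * Q'" and cop: "coprime P' Q'"
    using gcd_coprime_exists[of P Q] g unfolding g_def by (metis mult.commute)
  have Q'0: "Q' \<noteq> 0" using Q Q' by auto
  have nocommon: "poly P' x \<noteq> 0 \<or> poly Q' x \<noteq> 0" for x
  proof (rule ccontr)
    assume "\<not> ?thesis"
    hence "[:- x, 1:] dvd P'" "[:- x, 1:] dvd Q'" by (auto simp: poly_eq_0_iff_dvd)
    hence "[:- x, 1:] dvd 1" using cop by (intro coprime_common_divisor[of P' Q'])
    thus False using poly_eq_0_iff_dvd[of 1 x] by simp
  qed
  define e where "e = max (degree P') (degree Q')"
  define p where "p = (\<lambda>k. if k then P' else Q')"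
  have "basepoint_free e p"
  proof -
    have "\<exists>k. coeff (p k) e \<noteq> 0"
    proof (cases "degree P' \<le> degree Q'")
      case True
      thus ?thesis using Q'0 by (intro exI[of _ False]) (auto simp: p_def e_def)
    next
      case False
      hence "P' \<noteq> 0" by auto
      thus ?thesis using False by (intro exI[of _ True]) (auto simp: p_def e_def)
    qed
    moreover have "\<exists>k. poly (p k) r \<noteq> 0" for r
      using nocommon[of r] unfolding p_def by metis
    moreover have "degree (p k) \<le> e" for k by (simp add: p_def e_def)
    ultimately show ?thesis by (simp add: basepoint_free_def)
  qed
  note bpf = this
  define Bad' where "Bad' = Bad \<union> {x. poly g x = 0} \<union> {x. poly Q' x = 0}"
  have fin': "finite Bad'" using fin g Q'0 poly_roots_finite by (auto simp: Bad'_def)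
  have inj': "x = y" if "x \<notin> Bad'" "y \<notin> Bad'" "poly P' x / poly Q' x = poly P' y / poly Q' y" for x y
  proof -
    have "poly P z / poly Q z = poly P' z / poly Q' z" if "z \<notin> Bad'" for z
      using that unfolding P' Q' Bad'_def by simp
    hence eq: "poly P x / poly Q x = poly P y / poly Q y" using that by simp
    have "x \<notin> Bad" "y \<notin> Bad" using that by (auto simp: Bad'_def)
    thus ?thesis by (rule inj[OF _ _ eq])
  qed
  obtain a where a: "lin_comb a p \<noteq> 0" "card {r. poly (lin_comb a p) r = 0} = e"
    "\<And>r. poly (lin_comb a p) r = 0 \<Longrightarrow> r \<notin> Bad'"
    using generic_member_simple_roots[OF alg bpf fin'] by blast
  have A: "lin_comb a p = smult (a True) P' + smult (a False) Q'"
    by (simp add: lin_comb_def UNIV_bool p_def add.commute)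
  define R where "R = {r. poly (lin_comb a p) r = 0}"
  have finR: "finite R" using a(1) poly_roots_finite unfolding R_def by blast
  \<comment> \<open>The zeros of a generic member lie in a single fibre of
    \<open>P' / Q'\<close>.\<close>
  have val: "poly P' r / poly Q' r = - a False / a True" if "r \<in> R" for r
  proof -
    have r: "a True * poly P' r + a False * poly Q' r = 0" using that unfolding R_def A by simp
    have nz: "poly Q' r \<noteq> 0" using a(3) that unfolding R_def Bad'_def by blast
    have "a True \<noteq> 0"
    proof
      assume "a True = 0"
      moreover from this have "a False = 0" using r nz by simp
      ultimately show False using a(1) A by simp
    qed
    thus ?thesis using r nz by (simp add: field_simps add_eq_0_iff)
  qed
  have "x = y" if "x \<in> R" "y \<in> R" for x y
    using inj'[of x y] a(3)[of x] a(3)[of y] that val by (simp add: R_def del: poly_lin_comb)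
  hence "card R \<le> Suc 0" using card_le_Suc0_iff_eq[OF finR] by blast
  hence e1: "e \<le> 1" using a(2) by (simp add: R_def del: poly_lin_comb)
  obtain b a' where PP: "P' = [:b, a':]" using e1 by (metis degree_le_1E e_def max.bounded_iff)
  obtain f c where QQ: "Q' = [:f, c:]" using e1 by (metis degree_le_1E e_def max.bounded_iff)
  have "a' * f - b * c \<noteq> 0"
  proof
    assume z: "a' * f - b * c = 0"
    show False
    proof (cases "c = 0")
      case False
      have "poly Q' (- f / c) = 0" "poly P' (- f / c) = 0"
        using z False by (simp_all add: PP QQ field_simps)
      thus False using nocommon by blast
    next
      case True
      hence "f \<noteq> 0" using Q'0 QQ by auto
      hence "a' = 0" using z True by simp
      hence const: "poly P' x / poly Q' x = b / f" for x by (simp add: PP QQ True)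
      obtain x where x: "x \<notin> Bad'" using ex_new_if_finite[OF infinite_UNIV_char_0 fin'] by blast
      obtain y where y: "y \<notin> insert x Bad'"
        using ex_new_if_finite[OF infinite_UNIV_char_0, of "insert x Bad'"] fin' by blast
      show False using inj'[of x y] x y const by auto
    qed
  qed
  moreover have "P * [:f, c:] = Q * [:b, a':]"
    unfolding P' Q' PP QQ by (simp only: mult.assoc mult.commute mult.left_commute)
  ultimately show ?thesis by blast
qed

lemma poly_eq_if_eq_on_infinite:
  fixes p q :: "'f::field poly"
  assumes "infinite {t. poly p t = poly q t}"
  shows "p = q"
proof (rule ccontr)
  assume "p \<noteq> q"
  hence "finite {t. poly (p - q) t = 0}" by (intro poly_roots_finite) simp
  thus False using assms by simp
qed

lemma poly_eq_if_eq_outside_finite: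
  fixes p q :: "'f::field_char_0 poly"
  assumes "finite Bad" "\<And>t. t \<notin> Bad \<Longrightarrow> poly p t = poly q t"
  shows "p = q"
proof (rule poly_eq_if_eq_on_infinite)
  have "- Bad \<subseteq> {t. poly p t = poly q t}" using assms(2) by blast
  moreover have "infinite (- Bad)" using assms(1) infinite_UNIV_char_0 by (metis finite_compl)
  ultimately show "infinite {t. poly p t = poly q t}" using finite_subset by blast
qed

section \<open>Substitution into binary forms\<close>

text \<open>The binary form of degree \<open>e\<close> attached to \<open>p\<close>, evaluated at \<open>(P, Q)\<close>.\<close>

definition form_subst :: "nat \<Rightarrow> 'f::field poly \<Rightarrow> 'f poly \<Rightarrow> 'f poly \<Rightarrow> 'f poly" where
  "form_subst e p P Q = (\<Sum>j\<le>e. smult (coeff p j) (P ^ j * Q ^ (e - j)))"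

lemma poly_form_subst:
  assumes "degree p \<le> e" "poly Q t \<noteq> 0"
  shows "poly (form_subst e p P Q) t = poly Q t ^ e * poly p (poly P t / poly Q t)"
proof -
  have p: "poly p x = (\<Sum>j\<le>e. coeff p j * x ^ j)" for x
    unfolding poly_altdef using assms(1) by (intro sum.mono_neutral_left) (auto simp: coeff_eq_0)
  have summand: "coeff p j * (poly P t ^ j * poly Q t ^ (e - j)) = poly Q t ^ e * (coeff p j * (poly P t / poly Q t) ^ j)"
    if "j \<le> e" for j
  proof -
    have "poly Q t ^ e = poly Q t ^ j * poly Q t ^ (e - j)" using that by (simp add: power_add[symmetric])
    thus ?thesis using assms(2) by (simp add: field_simps)
  qed
  show ?thesis unfolding form_subst_def poly_sum p sum_distrib_left
    by (intro sum.cong refl) (simp add: summand del: power_divide)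
qed

lemma poly_form_subst_inf:
  assumes "poly Q t = 0"
  shows "poly (form_subst e p P Q) t = coeff p e * poly P t ^ e"
proof -
  have "poly (form_subst e p P Q) t = (\<Sum>j\<le>e. if j = e then coeff p e * poly P t ^ e else 0)"
    unfolding form_subst_def poly_sum by (intro sum.cong) (auto simp: assms power_0_left)
  thus ?thesis by simp
qed

lemma form_subst_lincomb:
  "form_subst e (smult x p - smult y q) P Q = smult x (form_subst e p P Q) - smult y (form_subst e q P Q)"
proof (rule poly_eqI)
  fix i
  show "coeff (form_subst e (smult x p - smult y q) P Q) i =
      coeff (smult x (form_subst e p P Q) - smult y (form_subst e q P Q)) i"
    by (simp add: form_subst_def coeff_sum sum_distrib_left sum_subtractf algebra_simps)
qed

lemma form_subst_linear_factor:
  fixes p :: "'f::field_char_0 poly"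
  assumes "degree p \<le> e" "Q \<noteq> 0"
  shows "form_subst (Suc e) ([:- s, 1:] * p) P Q = (P - smult s Q) * form_subst e p P Q"
proof (rule poly_eq_if_eq_outside_finite)
  show "finite {t. poly Q t = 0}" using assms(2) poly_roots_finite by blast
  fix t assume "t \<notin> {t. poly Q t = 0}"
  hence t: "poly Q t \<noteq> 0" by simp
  have "degree ([:- s, 1:] * p) \<le> Suc e"
    using degree_mult_le[of "[:- s, 1:]" p] assms(1) by simp
  thus "poly (form_subst (Suc e) ([:- s, 1:] * p) P Q) t = poly ((P - smult s Q) * form_subst e p P Q) t"
    unfolding poly_mult using t assms(1) poly_form_subst[of _ "Suc e" Q t P] poly_form_subst[of p e Q t P]
    by (simp add: field_simps)
qed

text \<open>Read as a form of degree one more, \<open>p\<close> acquires a zero at infinity, and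
  substitution turns the linear form of infinity into \<open>Q\<close>.\<close>

lemma form_subst_raise:
  fixes p :: "'f::field_char_0 poly"
  assumes "degree p \<le> e" "Q \<noteq> 0"
  shows "form_subst (Suc e) p P Q = Q * form_subst e p P Q"
proof (rule poly_eq_if_eq_outside_finite)
  show "finite {t. poly Q t = 0}" using assms(2) poly_roots_finite by blast
  fix t assume "t \<notin> {t. poly Q t = 0}"
  hence t: "poly Q t \<noteq> 0" by simp
  thus "poly (form_subst (Suc e) p P Q) t = poly (Q * form_subst e p P Q) t"
    using assms(1) by (simp add: poly_form_subst)
qed

lemma degree_form_subst_le:
  fixes P Q :: "'f::field poly"
  assumes "degree P \<le> 1" "degree Q \<le> 1"
  shows "degree (form_subst e p P Q) \<le> e"
  unfolding form_subst_def
proof (intro degree_sum_le order_trans[OF degree_smult_le])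
  fix j assume "j \<in> {..e}"
  have "degree (P ^ j * Q ^ (e - j)) \<le> degree (P ^ j) + degree (Q ^ (e - j))" by (rule degree_mult_le)
  also have "\<dots> \<le> degree P * j + degree Q * (e - j)" by (intro add_mono degree_power_le)
  also have "\<dots> \<le> 1 * j + 1 * (e - j)" using assms by (intro add_mono mult_right_mono) auto
  finally show "degree (P ^ j * Q ^ (e - j)) \<le> e" using \<open>j \<in> {..e}\<close> by simp
qed simp

lemma coprime_if_no_common_root:
  fixes p q :: "'f::{field_char_0,field_gcd} poly"
  assumes alg: "\<And>p::'f poly. degree p \<ge> 1 \<Longrightarrow> \<exists>x. poly p x = 0"
    and "p \<noteq> 0" "\<And>x. poly p x = 0 \<Longrightarrow> poly q x \<noteq> 0"
  shows "coprime p q"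
proof (rule coprimeI)
  fix c assume c: "c dvd p" "c dvd q"
  have "degree c = 0"
  proof (rule ccontr)
    assume "degree c \<noteq> 0"
    then obtain x where "poly c x = 0" using alg[of c] by auto
    thus False using c assms(3)[of x] by (auto simp: dvd_def)
  qed
  moreover have "c \<noteq> 0" using c(1) assms(2) by auto
  ultimately show "is_unit c" using is_unit_iff_degree by blast
qed

text \<open>Both families describe the same projective points, so they differ by a rational factor.
  A member of \<open>N\<close> coprime to \<open>N k0\<close> shows that the factor is a polynomial
  \<open>h\<close>. A zero of \<open>h\<close> would be a common zero of the substituted family,
  which is impossible because the determinant is nonzero and \<open>N'\<close> has no base
  point.\<close>

lemma form_subst_proportional:
  fixes N N' :: "'k::finite \<Rightarrow> 'f::{field_char_0,field_gcd} poly"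
  assumes alg: "\<And>p::'f poly. degree p \<ge> 1 \<Longrightarrow> \<exists>x. poly p x = 0"
    and N: "basepoint_free e N" and N': "basepoint_free e N'" and k0: "N k0 \<noteq> 0"
    and det: "a * f - b * c \<noteq> 0"
    and eq: "\<And>k. form_subst e (N' k) [:b, a:] [:f, c:] * N k0 = N k * form_subst e (N' k0) [:b, a:] [:f, c:]"
  shows "\<exists>\<kappa>. \<kappa> \<noteq> 0 \<and> (\<forall>k. form_subst e (N' k) [:b, a:] [:f, c:] = smult \<kappa> (N k))"
proof -
  define T where "T = (\<lambda>k. form_subst e (N' k) [:b, a:] [:f, c:])"
  have T: "T k * N k0 = N k * T k0" for k using eq by (simp add: T_def)
  have Tnz: "\<exists>k. poly (T k) t \<noteq> 0" for t
  proof (cases "poly [:f, c:] t = 0")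
    case True
    hence f: "f = - (t * c)" by (simp add: eq_neg_iff_add_eq_0)
    have "poly [:b, a:] t \<noteq> 0"
    proof
      assume "poly [:b, a:] t = 0"
      hence b: "b = - (t * a)" by (simp add: eq_neg_iff_add_eq_0)
      show False using det unfolding f b by simp
    qed
    moreover obtain k where "coeff (N' k) e \<noteq> 0" using N' by (auto simp: basepoint_free_def)
    ultimately show ?thesis unfolding T_def poly_form_subst_inf[OF True]
      by (intro exI[of _ k]) (simp del: poly_pCons)
  next
    case False
    obtain k where "poly (N' k) (poly [:b, a:] t / poly [:f, c:] t) \<noteq> 0"
      using N' by (auto simp: basepoint_free_def simp del: poly_pCons)
    moreover have "degree (N' k) \<le> e" using N' by (simp add: basepoint_free_def)
    ultimately show ?thesis unfolding T_def using False
      by (intro exI[of _ k]) (simp add: poly_form_subst del: poly_pCons)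
  qed
  have "finite {r. poly (N k0) r = 0}" using k0 poly_roots_finite by blast
  then obtain g where g: "\<forall>v\<in>(\<lambda>r k. poly (N k) r) ` {r. poly (N k0) r = 0}. (\<Sum>k\<in>UNIV. g k * v k) \<noteq> 0"
    using linear_form_avoiding[of "(\<lambda>r k. poly (N k) r) ` {r. poly (N k0) r = 0}"] N
    by (auto simp: basepoint_free_def)
  have cop: "coprime (N k0) (lin_comb g N)"
    using g by (intro coprime_if_no_common_root[OF alg k0]) auto
  have "lin_comb g N * T k0 = lin_comb g T * N k0"
    unfolding lin_comb_def sum_distrib_right by (intro sum.cong) (simp_all add: T)
  hence "N k0 dvd lin_comb g N * T k0" by simp
  hence "N k0 dvd T k0" using cop coprime_dvd_mult_right_iff by blast
  then obtain h where h: "T k0 = N k0 * h" by blast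
  have Th: "T k = N k * h" for k
  proof -
    have "N k0 * T k = N k0 * (N k * h)" using T[of k] unfolding h by (simp only: ac_simps)
    thus ?thesis using k0 by simp
  qed
  have "poly h t \<noteq> 0" for t using Tnz[of t] unfolding Th by auto
  hence "degree h = 0" using alg[of h] by (cases "degree h") auto
  then obtain \<kappa> where \<kappa>: "h = [:\<kappa>:]" by (rule degree_eq_zeroE)
  have "\<kappa> \<noteq> 0" using \<open>\<And>t. poly h t \<noteq> 0\<close> \<kappa> by auto
  thus ?thesis using Th unfolding \<kappa> T_def by (intro exI[of _ \<kappa>]) simp
qed

lemma finite_fibre:
  assumes "proper_param num den"
  shows "finite {t. defined_at den t \<and> psi_at num den t = x}"
proof (cases "\<exists>t. defined_at den t \<and> psi_at num den t = x")
  case True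
  then obtain t0 where t0: "defined_at den t0" "psi_at num den t0 = x" by blast
  have "{t. defined_at den t \<and> psi_at num den t = x} \<subseteq> insert t0 {t. defined_at den t \<and>
      (\<exists>s. defined_at den s \<and> s \<noteq> t \<and> psi_at num den s = psi_at num den t)}" using t0 by auto
  thus ?thesis using assms unfolding proper_param_def by (meson finite_insert finite_subset)
next
  case False
  hence "{t. defined_at den t \<and> psi_at num den t = x} = {}" by blast
  thus ?thesis by (metis finite.emptyI)
qed

text \<open>Injectivity of the parametrization outside finitely many parameters passes to
  \<open>P / Q\<close>. The relation is concluded as an identity of forms, so that it also holds at
  the exceptional parameters and at the pole of the Moebius map.\<close>

lemma moebius_of_rational_reparametrization:
  fixes num den num' den' :: "'m::finite \<Rightarrow> 'f::{field_char_0,field_gcd} poly"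
  assumes alg: "\<And>p::'f poly. degree p \<ge> 1 \<Longrightarrow> \<exists>x. poly p x = 0"
    and hom: "homogenization e num den N" and hom': "homogenization e num' den' N'"
    and proper: "proper_param num den" and Q: "Q \<noteq> 0" and fin: "finite Bad"
    and rep: "\<And>t. t \<notin> Bad \<Longrightarrow> poly Q t \<noteq> 0 \<and> defined_at den t \<and> defined_at den' (poly P t / poly Q t) \<and>
       psi_at num' den' (poly P t / poly Q t) = psi_at num den t"
  shows "\<exists>a b c f \<kappa>. a * f - b * c \<noteq> 0 \<and> P * [:f, c:] = Q * [:b, a:] \<and> \<kappa> \<noteq> 0 \<and>
     (\<forall>k. form_subst e (N' k) [:b, a:] [:f, c:] = smult \<kappa> (N k))"
proof -
  have bpf: "basepoint_free e N" "basepoint_free e N'" and N0: "N None \<noteq> 0"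
    using hom hom' by (auto simp: homogenization_def)
  define D where "D = {t. defined_at den t \<and> (\<exists>s. defined_at den s \<and> s \<noteq> t \<and> psi_at num den s = psi_at num den t)}"
  have finD: "finite (Bad \<union> D)" using fin proper by (simp add: D_def proper_param_def)
  have inj: "x = y" if "x \<notin> Bad \<union> D" "y \<notin> Bad \<union> D" "poly P x / poly Q x = poly P y / poly Q y" for x y
  proof (rule ccontr)
    assume "x \<noteq> y"
    moreover have "psi_at num den x = psi_at num den y" "defined_at den x" "defined_at den y"
      using rep[of x] rep[of y] that by auto
    ultimately have "x \<in> D" unfolding D_def by auto
    thus False using that by blast
  qed
  obtain a b c f where m: "a * f - b * c \<noteq> 0" "P * [:f, c:] = Q * [:b, a:]"
    using injective_rational_is_moebius[OF alg Q finD inj] by blast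
  have Q0: "[:f, c:] \<noteq> 0" using m(1) by auto
  have "form_subst e (N' k) [:b, a:] [:f, c:] * N None = N k * form_subst e (N' None) [:b, a:] [:f, c:]" for k
  proof (rule poly_eq_if_eq_outside_finite)
    show "finite (Bad \<union> {t. poly [:f, c:] t = 0})" using fin Q0 poly_roots_finite by blast
    fix t assume t: "t \<notin> Bad \<union> {t. poly [:f, c:] t = 0}"
    hence Qt: "poly [:f, c:] t \<noteq> 0" by blast
    define u where "u = poly [:b, a:] t / poly [:f, c:] t"
    have "poly P t * poly [:f, c:] t = poly Q t * poly [:b, a:] t"
      using arg_cong[OF m(2), of "\<lambda>p. poly p t"] by (simp only: poly_mult)
    hence u: "poly P t / poly Q t = u" using rep[of t] t Qt unfolding u_def by (simp add: field_simps)
    have d: "defined_at den t" "defined_at den' u" "psi_at num' den' u = psi_at num den t"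
      using rep[of t] t unfolding u by auto
    have "poly (N' k) u * poly (N None) t = poly (N k) t * poly (N' None) u"
    proof (cases k)
      case (Some l)
      thus ?thesis using d(3) unfolding psi_at_eq_iff[OF hom hom' d(1,2)] by simp
    qed simp
    moreover have "degree (N' k) \<le> e" "degree (N' None) \<le> e" using bpf by (auto simp: basepoint_free_def)
    ultimately show "poly (form_subst e (N' k) [:b, a:] [:f, c:] * N None) t =
        poly (N k * form_subst e (N' None) [:b, a:] [:f, c:]) t"
      using Qt unfolding poly_mult by (simp add: poly_form_subst u_def[symmetric] del: poly_pCons)
  qed
  thus ?thesis using form_subst_proportional[OF alg bpf N0 m(1)] m by blast
qed

section \<open>Rationality of a unique solution\<close>

lemma subleading_coeff_of_unique_root:
  fixes p :: "'f::field poly"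
  assumes alg: "\<And>p::'f poly. degree p \<ge> 1 \<Longrightarrow> \<exists>x. poly p x = 0"
    and p: "degree p = Suc k" and root: "\<And>x. poly p x = 0 \<Longrightarrow> x = w"
  shows "coeff p k = - of_nat (Suc k) * w * lead_coeff p"
proof -
  have "p \<noteq> 0" using p by auto
  then obtain q where q: "p = [:- w, 1:] ^ order w p * q" "\<not> [:- w, 1:] dvd q"
    using order_decomp by blast
  have "poly q x \<noteq> 0" for x
  proof
    assume z: "poly q x = 0"
    hence "poly p x = 0" by (subst q(1)) simp
    hence "x = w" by (rule root)
    thus False using z q(2) by (simp add: poly_eq_0_iff_dvd)
  qed
  hence "degree q = 0" using alg[of q] by (cases "degree q") auto
  then obtain c where c: "q = [:c:]" by (rule degree_eq_zeroE)
  have "c \<noteq> 0" using q(1) c \<open>p \<noteq> 0\<close> by auto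
  have p': "p = smult c ([:- w, 1:] ^ order w p)" using q(1) c by simp
  have "degree p = order w p" by (subst p') (simp add: \<open>c \<noteq> 0\<close> degree_power_eq)
  hence p'': "p = smult c ([:- w, 1:] ^ Suc k)" using p' p by simp
  have "coeff p k = c * (of_nat (Suc k) * - w)"
    by (subst p'') (simp add: coeff_linear_poly_power del: power_Suc of_nat_Suc)
  moreover have "lead_coeff p = c"
    unfolding p by (subst p'') (simp add: coeff_linear_poly_power del: power_Suc)
  ultimately show ?thesis by (simp add: algebra_simps)
qed

text \<open>If the fibre over almost every \<open>t\<close> of a system of equations \<open>q l\<close> in \<open>F[t][s]\<close> is a single
  point \<open>w t\<close>, then \<open>w\<close> is rational: an element \<open>R\<close> of least degree in \<open>s\<close> among those vanishing on
  the graph of \<open>w\<close> pseudo-divides all \<open>q l\<close>, so that \<open>R(t, s)\<close> is a multiple of \<open>(s - w t)^k\<close> and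
  \<open>w\<close> can be read off its subleading coefficient.\<close>

lemma unique_solution_rational:
  fixes q :: "'l \<Rightarrow> 'f::field_char_0 poly poly"
  assumes alg: "\<And>p::'f poly. degree p \<ge> 1 \<Longrightarrow> \<exists>x. poly p x = 0"
    and fin: "finite Bad"
    and uniq: "\<And>t s. t \<notin> Bad \<Longrightarrow> (\<forall>l. poly (poly (q l) [:s:]) t = 0) \<longleftrightarrow> s = w t"
  shows "\<exists>P Q Bad'. Q \<noteq> 0 \<and> finite Bad' \<and> (\<forall>t. t \<notin> Bad' \<longrightarrow> poly Q t \<noteq> 0 \<and> poly P t / poly Q t = w t)"
proof -
  define V where "V = (\<lambda>R. finite {t. poly (poly R [:w t:]) t \<noteq> 0})"
  have Vq: "V (q l)" for l
  proof -
    have "{t. poly (poly (q l) [:w t:]) t \<noteq> 0} \<subseteq> Bad" using uniq by blast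
    thus ?thesis unfolding V_def using fin finite_subset by blast
  qed
  obtain l0 where l0: "q l0 \<noteq> 0"
  proof -
    obtain t where t: "t \<notin> Bad" using ex_new_if_finite[OF infinite_UNIV_char_0 fin] by blast
    have "w t + 1 \<noteq> w t" by simp
    hence "\<not> (\<forall>l. poly (poly (q l) [:w t + 1:]) t = 0)" using uniq[OF t] by blast
    then obtain l where "poly (poly (q l) [:w t + 1:]) t \<noteq> 0" by blast
    hence "q l \<noteq> 0" by auto
    thus ?thesis by (rule that)
  qed
  have "q l0 \<noteq> 0 \<and> V (q l0)" using l0 Vq by blast
  then obtain R where R: "R \<noteq> 0 \<and> V R" and "\<forall>R'. R' \<noteq> 0 \<and> V R' \<longrightarrow> degree R \<le> degree R'"
    using ex_has_least_nat[of "\<lambda>R. R \<noteq> 0 \<and> V R" "q l0" degree] by blast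
  hence least: "degree R \<le> degree R'" if "R' \<noteq> 0" "V R'" for R' using that by blast
  define lc where "lc = lead_coeff R"
  have lc0: "lc \<noteq> 0" using R by (simp add: lc_def)
  have div: "\<exists>m h. smult (lc ^ m) (q l) = R * h" for l
  proof -
    obtain h r where hr: "pseudo_divmod (q l) R = (h, r)" by fastforce
    define m where "m = Suc (degree (q l)) - degree R"
    have eq: "smult (lc ^ m) (q l) = R * h + r" "r = 0 \<or> degree r < degree R"
      using pseudo_divmod[OF _ hr] R by (auto simp: lc_def m_def)
    have "{t. poly (poly r [:w t:]) t \<noteq> 0} \<subseteq>
        {t. poly (poly (q l) [:w t:]) t \<noteq> 0} \<union> {t. poly (poly R [:w t:]) t \<noteq> 0}"
    proof (rule subsetI, rule ccontr)
      fix t assume "t \<in> {t. poly (poly r [:w t:]) t \<noteq> 0}"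
        "t \<notin> {t. poly (poly (q l) [:w t:]) t \<noteq> 0} \<union> {t. poly (poly R [:w t:]) t \<noteq> 0}"
      moreover have "r = smult (lc ^ m) (q l) - R * h" using eq(1) by simp
      ultimately show False by simp
    qed
    hence "V r" using Vq[of l] R unfolding V_def using finite_subset by blast
    hence "r = 0" using eq(2) least[of r] by force
    thus ?thesis using eq(1) by auto
  qed
  define Rt where "Rt = (\<lambda>t. map_poly (\<lambda>c. poly c t) R)"
  have Rt: "poly (Rt t) s = poly (poly R [:s:]) t" for s t
  proof -
    have "poly (map_poly (\<lambda>c. poly c t) p) s = poly (poly p [:s:]) t" for p :: "'f poly poly"
      by (induction p) (auto simp: map_poly_pCons)
    thus ?thesis by (simp add: Rt_def)
  qed
  have cRt: "coeff (Rt t) j = poly (coeff R j) t" for t j by (simp add: Rt_def coeff_map_poly)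
  define Bad' where "Bad' = Bad \<union> {t. poly lc t = 0} \<union> {t. poly (poly R [:w t:]) t \<noteq> 0}"
  have fin': "finite Bad'" using fin lc0 R poly_roots_finite by (auto simp: Bad'_def V_def)
  have dRt: "degree (Rt t) = degree R" if "t \<notin> Bad'" for t
  proof (rule antisym)
    show "degree (Rt t) \<le> degree R" by (rule degree_le) (simp add: cRt coeff_eq_0)
    show "degree R \<le> degree (Rt t)"
      using that by (intro le_degree) (auto simp: cRt Bad'_def lc_def)
  qed
  obtain t1 where t1: "t1 \<notin> Bad'" using ex_new_if_finite[OF infinite_UNIV_char_0 fin'] by blast
  have "degree R \<noteq> 0"
  proof
    assume "degree R = 0"
    then obtain c where "R = [:c:]" by (rule degree_eq_zeroE)
    thus False using t1 by (auto simp: Bad'_def lc_def)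
  qed
  then obtain k where k: "degree R = Suc k" by (cases "degree R") auto
  have root: "x = w t" if t: "t \<notin> Bad'" and x: "poly (Rt t) x = 0" for t x
  proof -
    have "poly (poly (q l) [:x:]) t = 0" for l
    proof -
      obtain m h where "smult (lc ^ m) (q l) = R * h" using div by blast
      hence "poly (poly (smult (lc ^ m) (q l)) [:x:]) t = poly (poly (R * h) [:x:]) t" by simp
      hence "poly lc t ^ m * poly (poly (q l) [:x:]) t = 0" using x Rt by simp
      thus ?thesis using t by (auto simp: Bad'_def)
    qed
    thus ?thesis using uniq t by (auto simp: Bad'_def)
  qed
  \<comment> \<open>The coefficient of degree \<open>k\<close> in a multiple \<open>c\<close> of the
    power \<open>k + 1\<close> of \<open>x - w\<close> is \<open>- (k + 1) * c * w\<close>, and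
    \<open>k + 1\<close> is invertible in characteristic zero.\<close>
  define P where "P = - coeff R k"
  define Q where "Q = smult (of_nat (Suc k)) lc"
  have "poly Q t \<noteq> 0 \<and> poly P t / poly Q t = w t" if t: "t \<notin> Bad'" for t
  proof -
    have lt: "poly lc t \<noteq> 0" using t by (simp add: Bad'_def)
    have "coeff (Rt t) k = - of_nat (Suc k) * w t * lead_coeff (Rt t)"
      using subleading_coeff_of_unique_root[OF alg _ root[OF t]] dRt[OF t] k by simp
    hence "poly (coeff R k) t = - of_nat (Suc k) * w t * poly lc t"
      unfolding dRt[OF t] cRt lc_def .
    thus ?thesis using lt by (simp add: P_def Q_def field_simps del: of_nat_Suc)
  qed
  moreover have "Q \<noteq> 0" using lc0 by (simp add: Q_def del: of_nat_Suc)
  ultimately show ?thesis using fin' by blast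
qed

lemma coeff_mult_at_degree_bounds:
  fixes p q :: "'f::comm_ring_1 poly"
  assumes "degree p \<le> m" "degree q \<le> n"
  shows "coeff (p * q) (m + n) = coeff p m * coeff q n"
proof -
  have "coeff (p * q) (m + n) = (\<Sum>i\<le>m + n. if i = m then coeff p m * coeff q n else 0)"
    unfolding coeff_mult
  proof (rule sum.cong)
    fix i assume "i \<in> {..m + n}"
    show "coeff p i * coeff q (m + n - i) = (if i = m then coeff p m * coeff q n else 0)"
    proof (cases i m rule: linorder_cases)
      case less
      hence "coeff q (m + n - i) = 0" using assms(2) by (intro coeff_eq_0) simp
      thus ?thesis using less by simp
    next
      case greater
      hence "coeff p i = 0" using assms(1) by (intro coeff_eq_0) simp
      thus ?thesis using greater by simp
    qed simp
  qed simp
  thus ?thesis by simp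
qed

text \<open>Comparing the coefficients of degree \<open>e + degree (den l)\<close> in
  \<open>N (Some l) * den l = N None * num l\<close> turns the image of infinity, read off
  \<open>N\<close>, into ratios of leading coefficients.\<close>

lemma point_at_infinity_iff:
  fixes num den :: "'m::finite \<Rightarrow> 'f::field poly"
  assumes hom: "homogenization e num den N" and den: "\<And>l. den l \<noteq> 0"
  shows "point_at_infinity e N x \<longleftrightarrow> inf_affine num den \<and> x = inf_value num den"
proof -
  have bpf: "basepoint_free e N" and N0: "N None \<noteq> 0"
    and rel: "\<And>l. N (Some l) * den l = N None * num l"
    using hom by (auto simp: homogenization_def)
  have deg: "degree (N k) \<le> e" for k using bpf by (auto simp: basepoint_free_def)
  have val: "coeff (N (Some l)) e = inf_value num den l * coeff (N None) e"
    if "degree (num l) \<le> degree (den l)" for l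
  proof -
    have "coeff (N (Some l)) e * lead_coeff (den l) = coeff (N None) e * coeff (num l) (degree (den l))"
      using coeff_mult_at_degree_bounds[OF deg order_refl, of "Some l" "den l"]
        coeff_mult_at_degree_bounds[OF deg that, of None] rel[of l] by simp
    moreover have "coeff (num l) (degree (den l)) = inf_value num den l * lead_coeff (den l)"
      using that den[of l] by (auto simp: inf_value_def coeff_eq_0)
    ultimately show ?thesis using den[of l] by simp
  qed
  show ?thesis
  proof
    assume p: "point_at_infinity e N x"
    hence c0: "coeff (N None) e \<noteq> 0" by (simp add: point_at_infinity_def)
    hence d0: "degree (N None) = e" using deg[of None] le_degree by (metis antisym)
    have aff: "degree (num l) \<le> degree (den l)" for l
    proof (cases "num l = 0")
      case False
      hence "N (Some l) \<noteq> 0" using rel[of l] N0 by (metis mult_eq_0_iff)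
      hence "degree (N (Some l)) + degree (den l) = e + degree (num l)"
        using rel[of l] degree_mult_eq[OF _ den[of l], of "N (Some l)"] degree_mult_eq[OF N0 False] d0 by simp
      thus ?thesis using deg[of "Some l"] by simp
    qed simp
    hence "x = inf_value num den"
      using val p c0 by (auto simp: point_at_infinity_def fun_eq_iff)
    thus "inf_affine num den \<and> x = inf_value num den" using aff by (simp add: inf_affine_def)
  next
    assume a: "inf_affine num den \<and> x = inf_value num den"
    hence v: "coeff (N (Some l)) e = x l * coeff (N None) e" for l
      using val[of l] by (simp add: inf_affine_def)
    have "coeff (N None) e \<noteq> 0"
    proof
      assume "coeff (N None) e = 0"
      hence "coeff (N k) e = 0" for k using v by (cases k) auto
      thus False using bpf by (auto simp: basepoint_free_def)
    qed
    thus "point_at_infinity e N x" using v by (simp add: point_at_infinity_def)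
  qed
qed

section \<open>Good and failing parameters\<close>

lemma coprime_no_common_root:
  fixes p q :: "'f::{field_char_0,field_gcd} poly"
  assumes "coprime p q" "poly p r = 0"
  shows "poly q r \<noteq> 0"
proof
  assume "poly q r = 0"
  hence "[:- r, 1:] dvd p" "[:- r, 1:] dvd q" using assms(2) by (simp_all add: poly_eq_0_iff_dvd)
  hence "[:- r, 1:] dvd 1" using assms(1) by (intro coprime_common_divisor[of p q])
  thus False using poly_eq_0_iff_dvd[of 1 r] by simp
qed

text \<open>Zeros of the gcd are common zeros of the cross-multiplied equations. There no
  denominator can vanish, because the numerator would vanish with it, and coprimality survives
  conjugation.\<close>

lemma poly_g_poly_eq_0_iff:
  fixes num den :: "'m::finite \<Rightarrow> 'f::{field_char_0,field_gcd} poly"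
  assumes aut: "field_automorphism s" and cop: "\<And>l. coprime (num l) (den l)"
  shows "poly (g_poly s num den t) r = 0 \<longleftrightarrow>
    defined_at (conj_poly s den) r \<and> psi_at (conj_poly s num) (conj_poly s den) r = psi_at num den t"
proof -
  interpret field_automorphism s by fact
  have "poly (g_poly s num den t) r = 0 \<longleftrightarrow>
      (\<forall>l. psi_at num den t l * poly (map_poly s (den l)) r = poly (map_poly s (num l)) r)"
    unfolding g_poly_def poly_eq_0_iff_dvd dvd_Gcd_iff
    by (simp add: poly_eq_0_iff_dvd[symmetric])
  also have "\<dots> \<longleftrightarrow> defined_at (conj_poly s den) r \<and>
      psi_at (conj_poly s num) (conj_poly s den) r = psi_at num den t"
  proof
    assume a: "\<forall>l. psi_at num den t l * poly (map_poly s (den l)) r = poly (map_poly s (num l)) r"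
    have nz: "poly (map_poly s (den l)) r \<noteq> 0" for l
    proof
      assume z: "poly (map_poly s (den l)) r = 0"
      hence "poly (map_poly s (num l)) r = 0" using a by (metis mult_zero_right)
      thus False using z coprime_no_common_root[OF cop, of l] unfolding poly_map_eq_0 by blast
    qed
    moreover have "psi_at (conj_poly s num) (conj_poly s den) r = psi_at num den t"
    proof
      fix l
      show "psi_at (conj_poly s num) (conj_poly s den) r l = psi_at num den t l"
        using nz[of l] a[rule_format, of l, symmetric] unfolding psi_at_def[of "conj_poly s num"]
        by (simp add: conj_poly_def)
    qed
    ultimately show "defined_at (conj_poly s den) r \<and>
      psi_at (conj_poly s num) (conj_poly s den) r = psi_at num den t"
      by (simp add: defined_at_def conj_poly_def)
  next
    assume "defined_at (conj_poly s den) r \<and> psi_at (conj_poly s num) (conj_poly s den) r = psi_at num den t"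
    hence d: "defined_at (conj_poly s den) r"
      and eq: "psi_at num den t = psi_at (conj_poly s num) (conj_poly s den) r" by auto
    show "\<forall>l. psi_at num den t l * poly (map_poly s (den l)) r = poly (map_poly s (num l)) r"
      using d unfolding eq by (simp add: psi_at_def defined_at_def conj_poly_def)
  qed
  finally show ?thesis .
qed

lemma moebius_relation_at:
  fixes N N' :: "'m option \<Rightarrow> 'f::field poly"
  assumes bpf: "basepoint_free e N'" and \<kappa>: "\<kappa> \<noteq> 0"
    and T: "\<And>k. form_subst e (N' k) [:b, a:] [:f, c:] = smult \<kappa> (N k)"
    and hom: "homogenization e num den N" and hom': "homogenization e num' den' N'"
    and t: "defined_at den t" and fin: "c * t + f \<noteq> 0"
  shows "defined_at den' ((a * t + b) / (c * t + f))"
    "psi_at num' den' ((a * t + b) / (c * t + f)) = psi_at num den t"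
proof -
  let ?s = "(a * t + b) / (c * t + f)"
  define \<mu> where "\<mu> = \<kappa> / (c * t + f) ^ e"
  have N': "poly (N' k) ?s = \<mu> * poly (N k) t" for k
  proof -
    have "poly (form_subst e (N' k) [:b, a:] [:f, c:]) t = poly [:f, c:] t ^ e * poly (N' k) (poly [:b, a:] t / poly [:f, c:] t)"
      using bpf fin by (intro poly_form_subst) (auto simp: basepoint_free_def ac_simps)
    hence "\<kappa> * poly (N k) t = (c * t + f) ^ e * poly (N' k) ?s"
      unfolding T by (simp add: ac_simps)
    thus ?thesis using fin by (simp add: \<mu>_def field_simps)
  qed
  have "\<mu> \<noteq> 0" using \<kappa> fin by (simp add: \<mu>_def)
  moreover have "poly (N None) t \<noteq> 0" using hom t by (simp add: homogenization_def)
  ultimately have "poly (N' None) ?s \<noteq> 0" by (simp add: N')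
  thus d: "defined_at den' ?s" using hom' by (simp add: homogenization_def)
  show "psi_at num' den' ?s = psi_at num den t"
    unfolding psi_at_eq_iff[OF hom hom' t d] N' by simp
qed

lemma moebius_relation_at_infinity:
  fixes N N' :: "'m option \<Rightarrow> 'f::field poly"
  assumes \<kappa>: "\<kappa> \<noteq> 0"
    and T: "\<And>k. form_subst e (N' k) [:b, a:] [:f, c:] = smult \<kappa> (N k)"
    and hom: "homogenization e num den N"
    and t: "defined_at den t" and inf: "c * t + f = 0"
  shows "point_at_infinity e N' (psi_at num den t)"
proof -
  have c: "coeff (N' k) e * (a * t + b) ^ e = \<kappa> * poly (N k) t" for k
  proof -
    have "poly (form_subst e (N' k) [:b, a:] [:f, c:]) t = coeff (N' k) e * poly [:b, a:] t ^ e"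
      by (rule poly_form_subst_inf) (use inf in \<open>simp add: ac_simps\<close>)
    thus ?thesis unfolding T by (simp add: ac_simps)
  qed
  have "poly (N None) t \<noteq> 0" using hom t by (simp add: homogenization_def)
  hence "coeff (N' None) e * (a * t + b) ^ e \<noteq> 0" unfolding c using \<kappa> by simp
  hence nz: "coeff (N' None) e \<noteq> 0" "(a * t + b) ^ e \<noteq> 0" by (metis mult_zero_left, metis mult_zero_right)
  have "coeff (N' (Some l)) e = psi_at num den t l * coeff (N' None) e" for l
  proof -
    have "coeff (N' (Some l)) e * (a * t + b) ^ e = psi_at num den t l * (coeff (N' None) e * (a * t + b) ^ e)"
      unfolding c homogenization_at[OF hom t] by (simp add: ac_simps)
    thus ?thesis using nz(2) by (auto simp: mult.assoc[symmetric])
  qed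
  thus ?thesis using nz(1) by (simp add: point_at_infinity_def)
qed

text \<open>Substituting the Moebius map carries the fibre of the conjugate parametrization over the
  point of \<open>t0\<close> to the fibre through \<open>t0\<close>. A second zero of the gcd, or
  infinity in the fibre, therefore gives a further common factor \<open>L\<close> and makes
  \<open>t0\<close> singular.\<close>

lemma good_param_if_not_singular:
  fixes num den :: "'m::finite \<Rightarrow> 'f::{field_char_0,field_gcd} poly"
  assumes alg: "\<And>p::'f poly. degree p \<ge> 1 \<Longrightarrow> \<exists>x. poly p x = 0"
    and aut: "field_automorphism s" and cop: "\<And>l. coprime (num l) (den l)" and den: "\<And>l. den l \<noteq> 0"
    and hom: "homogenization e num den N"
    and det: "a * f - b * c \<noteq> 0" and \<kappa>: "\<kappa> \<noteq> 0"
    and T: "\<And>k. form_subst e (conj_poly s N k) [:b, a:] [:f, c:] = smult \<kappa> (N k)"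
    and t0: "defined_at den t0" and nonsing: "\<not> singular_param e N t0" and fin: "c * t0 + f \<noteq> 0"
  shows "good_param s num den t0"
proof -
  interpret field_automorphism s by fact
  define N' where "N' = conj_poly s N"
  define num' where "num' = conj_poly s num"
  define den' where "den' = conj_poly s den"
  have hom': "homogenization e num' den' N'"
    unfolding N'_def num'_def den'_def by (rule homogenization_conj[OF hom])
  have bpf': "basepoint_free e N'" using hom' by (simp add: homogenization_def)
  have deg': "degree (N' k) \<le> e" for k using bpf' by (simp add: basepoint_free_def)
  define P where "P = [:b, a:]"
  define Q where "Q = [:f, c:]"
  have Q0: "Q \<noteq> 0" using det by (auto simp: Q_def)
  have dPQ: "degree P \<le> 1" "degree Q \<le> 1" by (auto simp: P_def Q_def)
  note T = T[folded N'_def P_def Q_def]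
  define s0 where "s0 = (a * t0 + b) / (c * t0 + f)"
  have s0: "defined_at den' s0" "psi_at num' den' s0 = psi_at num den t0"
    unfolding s0_def
    using moebius_relation_at[OF bpf' \<kappa> T[unfolded P_def Q_def] hom hom' t0 fin] by blast+
  define X where "X = (\<lambda>k. poly (N k) t0)"
  have X0: "X None \<noteq> 0" using hom t0 by (simp add: homogenization_def X_def)
  have Xl: "X (Some l) = psi_at num den t0 l * X None" for l
    using homogenization_at[OF hom t0] by (simp add: X_def)
  define p where "p = project_from X N'"
  have dp: "degree (p l) \<le> e" for l unfolding p_def by (rule degree_project_from_le[OF deg'])
  have sub: "form_subst e (p l) P Q = smult \<kappa> (project_from X N l)" for l
    unfolding p_def project_from_def form_subst_lincomb T by (simp add: smult_diff_right mult.commute)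
  have p_eq: "poly (p l) r = 0" if "defined_at den' r" "psi_at num' den' r = psi_at num den t0" for l r
    using that(2) unfolding psi_at_eq_iff[OF hom hom' t0 that(1)]
    by (simp add: p_def project_from_def X_def mult.commute)
  define m where "m = a - s0 * c"
  have "(c * t0 + f) * m = a * f - b * c"
    using fin by (simp add: m_def s0_def right_diff_distrib) (simp add: algebra_simps)
  hence m: "m \<noteq> 0" using det by auto
  have lin: "P - smult s0 Q = smult m [:- t0, 1:]"
  proof -
    have "s0 * (c * t0 + f) = a * t0 + b" using fin by (simp add: s0_def)
    hence "b - s0 * f = - (t0 * m)" by (simp add: m_def algebra_simps)
    thus ?thesis by (simp add: P_def Q_def m_def mult.commute)
  qed
  \<comment> \<open>Each failure is refuted by naming \<open>L\<close>:
    \<open>P - smult s1 Q\<close> for a second zero \<open>s1\<close>, \<open>Q\<close> for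
    infinity, and 1 if all equations vanish. As \<open>e - 2\<close> is truncated,
    \<open>r = 0\<close> has to be demanded separately for \<open>e < 2\<close>.\<close>
  have sing: False if L: "L \<noteq> 0" "degree L \<le> 1"
    and r: "\<And>l. \<exists>r. (r = 0 \<or> 2 \<le> e) \<and> degree r \<le> e - 2 \<and> form_subst e (p l) P Q = (P - smult s0 Q) * (L * r)" for L
  proof -
    have "\<exists>q. (\<forall>j. Suc j \<ge> e \<longrightarrow> coeff q j = 0) \<and> project_from X N l = [:- t0, 1:] * (L * q)" for l
    proof -
      obtain r where r: "r = 0 \<or> 2 \<le> e" "degree r \<le> e - 2"
        "form_subst e (p l) P Q = (P - smult s0 Q) * (L * r)" using r by blast
      have "project_from X N l = smult (1 / \<kappa>) (smult \<kappa> (project_from X N l))" using \<kappa> by simp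
      also have "\<dots> = [:- t0, 1:] * (L * smult (m / \<kappa>) r)"
        unfolding sub[symmetric] r(3) lin mult_smult_left mult_smult_right smult_smult by simp
      finally have "project_from X N l = [:- t0, 1:] * (L * smult (m / \<kappa>) r)" .
      moreover have "\<forall>j. Suc j \<ge> e \<longrightarrow> coeff (smult (m / \<kappa>) r) j = 0"
      proof (cases "r = 0")
        case False
        thus ?thesis using r(1,2) by (auto intro!: coeff_eq_0)
      qed simp
      ultimately show ?thesis by blast
    qed
    hence "singular_param e N t0"
      unfolding singular_param_def using L X0 unfolding X_def by blast
    thus False using nonsing by blast
  qed
  define g where "g = g_poly s num den t0"
  have groot: "poly g r = 0 \<longleftrightarrow> defined_at den' r \<and> psi_at num' den' r = psi_at num den t0" for r
    unfolding g_def num'_def den'_def by (rule poly_g_poly_eq_0_iff[OF aut cop])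
  have g0: "g \<noteq> 0"
  proof
    assume "g = 0"
    hence "poly (p l) r = 0" for l r using groot p_eq by simp
    hence "p l = 0" for l using poly_all_0_iff_0 by blast
    hence "\<exists>r. (r = 0 \<or> 2 \<le> e) \<and> degree r \<le> e - 2 \<and> form_subst e (p l) P Q = (P - smult s0 Q) * (1 * r)" for l
      by (intro exI[of _ 0]) (simp add: form_subst_def)
    thus False using sing[of 1] by simp
  qed
  have "poly g s0 = 0" using groot s0 by blast
  then obtain h where h: "g = [:- s0, 1:] * h" by (metis dvdE poly_eq_0_iff_dvd)
  have "degree h = 0"
  proof (rule ccontr)
    assume "degree h \<noteq> 0"
    then obtain s1 where "poly h s1 = 0" using alg[of h] by auto
    then obtain h' where h': "h = [:- s1, 1:] * h'" by (metis dvdE poly_eq_0_iff_dvd)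
    have s1: "defined_at den' s1" "psi_at num' den' s1 = psi_at num den t0"
      using groot[of s1] by (auto simp: h h')
    \<comment> \<open>\<open>s1 = s0\<close> is allowed here, so a double zero of the gcd is covered
      as well.\<close>
    define W where "W = [:- s0, 1:] * [:- s1, 1:]"
    have "W \<noteq> 0" unfolding W_def by (subst mult_eq_0_iff) auto
    have Wg: "W dvd g" unfolding W_def h h' by (rule mult_dvd_mono[OF dvd_refl dvd_triv_left])
    have Wp: "W dvd p l" for l
    proof -
      \<comment> \<open>\<open>p l\<close> is obtained from an entry of the gcd by changing
        denominators; coprimality to \<open>den' l\<close> lets divisibility by \<open>W\<close>
        survive this.\<close>
      have cW: "coprime W (den' l)"
      proof (rule coprime_if_no_common_root[OF alg \<open>W \<noteq> 0\<close>])
        fix x assume "poly W x = 0"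
        hence "x = s0 \<or> x = s1" by (auto simp: W_def simp del: mult_pCons_left mult_pCons_right)
        thus "poly (den' l) x \<noteq> 0" using s0(1) s1(1) by (auto simp: defined_at_def)
      qed
      let ?q = "[:psi_at num den t0 l:] * map_poly s (den l) - map_poly s (num l)"
      have "W dvd ?q" using Wg unfolding g_def g_poly_def by (auto intro: dvd_trans[OF _ Gcd_dvd])
      hence "W dvd smult (X None) (?q * N' None)" by (intro dvd_smult dvd_mult2)
      also have "smult (X None) (?q * N' None) = den' l * p l"
      proof -
        have "N' (Some l) * den' l = N' None * num' l" using hom' by (simp add: homogenization_def)
        hence "num' l * N' None = den' l * N' (Some l)" by (simp add: mult.commute)
        moreover have "?q = smult (psi_at num den t0 l) (den' l) - num' l"
          by (simp add: num'_def den'_def conj_poly_def)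
        ultimately show ?thesis
          by (simp add: p_def project_from_def Xl smult_diff_right left_diff_distrib right_diff_distrib mult.commute)
      qed
      finally show ?thesis using cW coprime_dvd_mult_right_iff by blast
    qed
    have "P - smult s1 Q \<noteq> 0"
    proof
      assume z: "P - smult s1 Q = 0"
      hence "b = s1 * f" "a = s1 * c" by (simp_all add: P_def Q_def)
      thus False using det by simp
    qed
    moreover have "degree (P - smult s1 Q) \<le> 1"
      using dPQ by (intro degree_diff_le) (auto intro: order_trans[OF degree_smult_le])
    moreover have "\<exists>r. (r = 0 \<or> 2 \<le> e) \<and> degree r \<le> e - 2 \<and>
        form_subst e (p l) P Q = (P - smult s0 Q) * ((P - smult s1 Q) * r)" for l
    proof -
      obtain r where "p l = W * r" using Wp[of l] by (elim dvdE)
      hence r: "p l = [:- s0, 1:] * ([:- s1, 1:] * r)" unfolding W_def by (simp only: mult.assoc)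
      show ?thesis
      proof (cases "r = 0")
        case True
        thus ?thesis using r by (intro exI[of _ 0]) (simp add: form_subst_def)
      next
        case False
        hence "Suc (Suc (degree r)) \<le> e" using degree_le_of_linear_factors[of "- s0" "- s1" r e] dp[of l] r by simp
        moreover define e' where "e' = e - 2"
        ultimately have e': "e = Suc (Suc e')" "degree r \<le> e'" by auto
        have d1: "degree ([:- s1, 1:] * r) \<le> Suc e'"
          using degree_mult_le[of "[:- s1, 1:]" r] e'(2) by simp
        have "form_subst e (p l) P Q = (P - smult s0 Q) * ((P - smult s1 Q) * form_subst e' r P Q)"
          unfolding r e'(1) form_subst_linear_factor[OF d1 Q0] form_subst_linear_factor[OF e'(2) Q0] ..
        thus ?thesis using degree_form_subst_le[OF dPQ, of e' r]
          by (intro exI[of _ "form_subst e' r P Q"]) (simp add: e'(1))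
      qed
    qed
    ultimately show False by (rule sing)
  qed
  moreover have "h \<noteq> 0" using g0 h by auto
  ultimately have "degree g = 1"
    unfolding h using degree_mult_eq[of "[:- s0, 1:]" h] by auto
  moreover have "differs_from_inf s num den t0"
  proof (rule ccontr)
    assume "\<not> ?thesis"
    hence "point_at_infinity e N' (psi_at num den t0)"
      unfolding differs_from_inf_def using point_at_infinity_iff[OF hom', of "psi_at num den t0"] den
      by (simp add: num'_def den'_def conj_poly_def)
    hence cp: "coeff (p l) e = 0" for l
      by (simp add: point_at_infinity_def p_def project_from_def Xl)
    have "\<exists>r. (r = 0 \<or> 2 \<le> e) \<and> degree r \<le> e - 2 \<and> form_subst e (p l) P Q = (P - smult s0 Q) * (Q * r)" for l
    proof -
      have "poly (p l) s0 = 0" by (rule p_eq[OF s0])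
      then obtain r where r: "p l = [:- s0, 1:] * r" by (metis dvdE poly_eq_0_iff_dvd)
      show ?thesis
      proof (cases "r = 0")
        case True
        thus ?thesis using r by (intro exI[of _ 0]) (simp add: form_subst_def)
      next
        case False
        have dpr: "degree (p l) = Suc (degree r)"
          unfolding r using degree_mult_eq[of "[:- s0, 1:]" r] False by auto
        \<comment> \<open>The zero at infinity shows as a drop of degree, which substitution turns
          into the factor \<open>Q\<close>.\<close>
        have "degree (p l) \<noteq> e" using cp[of l] dpr by (metis leading_coeff_0_iff degree_0 nat.distinct(1))
        hence "Suc (Suc (degree r)) \<le> e" using dp[of l] dpr by simp
        moreover define e' where "e' = e - 2"
        ultimately have e': "e = Suc (Suc e')" "degree r \<le> e'" by auto
        have "degree ([:- s0, 1:] * r) \<le> Suc e'" using dpr e'(2) r by simp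
        hence "form_subst e (p l) P Q = Q * ((P - smult s0 Q) * form_subst e' r P Q)"
          unfolding r e'(1) by (simp only: form_subst_raise[OF _ Q0] form_subst_linear_factor[OF e'(2) Q0])
        hence "form_subst e (p l) P Q = (P - smult s0 Q) * (Q * form_subst e' r P Q)"
          by (simp only: mult.left_commute)
        thus ?thesis using degree_form_subst_le[OF dPQ, of e' r]
          by (intro exI[of _ "form_subst e' r P Q"]) (simp add: e'(1))
      qed
    qed
    thus False using sing[OF Q0 dPQ(2)] by blast
  qed
  ultimately show ?thesis using t0 by (simp add: good_param_def g_def)
qed

section \<open>The conjugate curve\<close>

lemma (in field_automorphism) conj_set_param_curve_subset:
  fixes num den :: "'m::finite \<Rightarrow> 'f poly"
  shows "conj_set s (param_curve num den) \<subseteq> param_curve (conj_poly s num) (conj_poly s den)"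
proof
  fix x assume "x \<in> conj_set s (param_curve num den)"
  then obtain y where y: "y \<in> param_curve num den" "x = s \<circ> y" by (auto simp: conj_set_def)
  define s' where "s' = inv_into UNIV s"
  have bij': "bij s'" unfolding s'_def by (rule bij_imp_bij_inv[OF bij])
  have ss': "s (s' z) = z" for z by (simp add: s'_def inv_s)
  have s's: "s' (s z) = z" for z using ss'[of "s z"] by simp
  \<comment> \<open>A polynomial function on the conjugate curve is pulled back along
    \<open>s\<close> by conjugating its coefficients with the inverse.\<close>
  interpret i: field_automorphism s'
    by unfold_locales (simp_all add: bij' eq_iff[symmetric] ss' add mult one del: eq_iff)
  have inv': "inv_into UNIV s' = s"
  proof
    fix z
    show "inv_into UNIV s' z = s z" using i.inv_s[of z] s's[of z] i.eq_iff by metis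
  qed
  show "x \<in> param_curve (conj_poly s num) (conj_poly s den)"
    unfolding param_curve_def zar_closure_def
  proof (intro CollectI conjI allI impI UNIV_I)
    fix g :: "('m \<Rightarrow> 'f) \<Rightarrow> 'f"
    assume g: "poly_fun UNIV UNIV g"
      and zero: "\<forall>y\<in>{psi_at (conj_poly s num) (conj_poly s den) t |t. defined_at (conj_poly s den) t}. g y = 0"
    define g' where "g' = (\<lambda>z. s' (g (s \<circ> z)))"
    have "poly_fun UNIV UNIV g'" using i.poly_fun_conj[OF g] unfolding inv' g'_def .
    moreover have "g' (psi_at num den t) = 0" if "defined_at den t" for t
    proof -
      have "g (psi_at (conj_poly s num) (conj_poly s den) (s t)) = 0"
        using zero that defined_at_conj[of den t] by blast
      thus ?thesis by (simp add: g'_def psi_at_conj)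
    qed
    ultimately have "g' y = 0" using y(1) unfolding param_curve_def zar_closure_def by blast
    thus "g x = 0" by (simp add: g'_def y(2))
  qed
qed

lemma (in field_automorphism) conj_set_param_curve:
  fixes num den :: "'m::finite \<Rightarrow> 'f poly"
  shows "conj_set s (param_curve num den) = param_curve (conj_poly s num) (conj_poly s den)"
proof
  show "param_curve (conj_poly s num) (conj_poly s den) \<subseteq> conj_set s (param_curve num den)"
  proof
    fix x assume x: "x \<in> param_curve (conj_poly s num) (conj_poly s den)"
    have "inv_into UNIV s \<circ> x \<in> param_curve num den"
      unfolding param_curve_def zar_closure_def
    proof (intro CollectI conjI allI impI UNIV_I)
      fix g :: "('m \<Rightarrow> 'f) \<Rightarrow> 'f"
      assume g: "poly_fun UNIV UNIV g" and zero: "\<forall>y\<in>{psi_at num den t |t. defined_at den t}. g y = 0"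
      define g' where "g' = (\<lambda>z. s (g (inv_into UNIV s \<circ> z)))"
      have "poly_fun UNIV UNIV g'" unfolding g'_def by (rule poly_fun_conj[OF g])
      moreover have "g' (psi_at (conj_poly s num) (conj_poly s den) t) = 0"
        if "defined_at (conj_poly s den) t" for t
      proof -
        obtain u where u: "t = s u" by (rule surjE)
        have "inv_into UNIV s \<circ> (s \<circ> y) = y" for y :: "'m \<Rightarrow> 'f"
          using bij by (auto simp: bij_is_inj)
        moreover have "g (psi_at num den u) = 0" using zero that unfolding u defined_at_conj by blast
        ultimately show ?thesis by (simp add: g'_def u psi_at_conj)
      qed
      ultimately have "g' x = 0" using x unfolding param_curve_def zar_closure_def by blast
      thus "g (inv_into UNIV s \<circ> x) = 0" by (simp add: g'_def)
    qed
    moreover have "x = s \<circ> (inv_into UNIV s \<circ> x)" by (auto simp: inv_s)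
    ultimately show "x \<in> conj_set s (param_curve num den)" unfolding conj_set_def by blast
  qed
qed (rule conj_set_param_curve_subset)

section \<open>Counting failing and fake parameters\<close>

lemma finite_params_at_infinity:
  assumes "proper_param num den"
  shows "finite {t. defined_at den t \<and> point_at_infinity e N' (psi_at num den t)}"
proof (cases "\<exists>x. point_at_infinity e N' x")
  case True
  then obtain x where "point_at_infinity e N' x" by blast
  hence "{t. defined_at den t \<and> point_at_infinity e N' (psi_at num den t)} \<subseteq> {t. defined_at den t \<and> psi_at num den t = x}"
    using point_at_infinity_unique by blast
  thus ?thesis using finite_fibre[OF assms] finite_subset by blast
qed simp

lemma finite_undefined:
  assumes "homogenization e num den N"
  shows "finite {t. \<not> defined_at den t}" "card {t. \<not> defined_at den t} \<le> e"
proof -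
  have N: "N None \<noteq> 0" "degree (N None) \<le> e" and eq: "{t. \<not> defined_at den t} = {t. poly (N None) t = 0}"
    using assms unfolding homogenization_def basepoint_free_def by blast+
  show "finite {t. \<not> defined_at den t}" unfolding eq using N(1) by (rule poly_roots_finite)
  show "card {t. \<not> defined_at den t} \<le> e"
    unfolding eq using card_poly_roots_bound[OF N(1)] N(2) by linarith
qed

lemma ex_moebius_relation:
  fixes num den :: "'m::finite \<Rightarrow> 'f::{field_char_0,field_gcd} poly"
  assumes alg: "\<And>p::'f poly. degree p \<ge> 1 \<Longrightarrow> \<exists>x. poly p x = 0"
    and aut: "field_automorphism s" and hom: "homogenization e num den N" and e: "e \<ge> 1"
    and proper: "proper_param num den"
    and inv: "conj_set s (param_curve num den) = param_curve num den"
  shows "\<exists>a b c f \<kappa>. a * f - b * c \<noteq> 0 \<and> \<kappa> \<noteq> 0 \<and>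
     (\<forall>k. form_subst e (conj_poly s N k) [:b, a:] [:f, c:] = smult \<kappa> (N k))"
proof -
  interpret field_automorphism s by fact
  define N' where "N' = conj_poly s N"
  define num' where "num' = conj_poly s num"
  define den' where "den' = conj_poly s den"
  have hom': "homogenization e num' den' N'"
    unfolding N'_def num'_def den'_def by (rule homogenization_conj[OF hom])
  have proper': "proper_param num' den'" unfolding num'_def den'_def by (rule proper_param_conj[OF proper])
  define D where "D = {u. defined_at den' u \<and> (\<exists>v. defined_at den' v \<and> v \<noteq> u \<and> psi_at num' den' v = psi_at num' den' u)}"
  \<comment> \<open>Excluded are poles, parameters over the point at infinity of the conjugate
    curve, where a solution may be missing, and those over its double points, where it is not
    unique.\<close>
  define Bad where "Bad = {t. \<not> defined_at den t} \<union> {t. defined_at den t \<and> point_at_infinity e N' (psi_at num den t)}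
     \<union> (\<Union>u\<in>D. {t. defined_at den t \<and> psi_at num den t = psi_at num' den' u})"
  have finD: "finite D" using proper' by (simp add: D_def proper_param_def)
  have fin: "finite Bad" unfolding Bad_def
    using finite_undefined(1)[OF hom] finite_params_at_infinity[OF proper] finite_fibre[OF proper] finD by simp
  have ex: "\<exists>u. defined_at den' u \<and> psi_at num' den' u = psi_at num den t" if t: "t \<notin> Bad" for t
  proof -
    have d: "defined_at den t" using t by (auto simp: Bad_def)
    have "psi_at num den t \<in> param_curve num' den'"
      using psi_at_in_param_curve[OF d, of num] conj_set_param_curve[of num den] inv
      unfolding num'_def den'_def by simp
    hence "(\<exists>u. defined_at den' u \<and> psi_at num den t = psi_at num' den' u) \<or> point_at_infinity e N' (psi_at num den t)"
      using param_curve_subset[OF alg hom' e] by blast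
    thus ?thesis using t d by (auto simp: Bad_def)
  qed
  then obtain w where w: "\<And>t. t \<notin> Bad \<Longrightarrow> defined_at den' (w t) \<and> psi_at num' den' (w t) = psi_at num den t"
    by metis
  have w_unique: "u = w t" if "t \<notin> Bad" "defined_at den' u" "psi_at num' den' u = psi_at num den t" for t u
  proof (rule ccontr)
    assume "u \<noteq> w t"
    hence "u \<in> D" using that w[OF that(1)] unfolding D_def by auto
    moreover have "defined_at den t" using that(1) by (auto simp: Bad_def)
    ultimately show False using that unfolding Bad_def by auto
  qed
  \<comment> \<open>The cross-multiplied equations, as polynomials in the unknown whose coefficients
    are polynomials in the parameter.\<close>
  define q where "q = (\<lambda>l. smult (N (Some l)) (map_poly (\<lambda>c. [:c:]) (N' None)) - smult (N None) (map_poly (\<lambda>c. [:c:]) (N' (Some l))))"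
  have lift: "poly (poly (map_poly (\<lambda>c. [:c:]) p) [:u:]) t = poly p u" for p :: "'f poly" and u t
    by (induction p) (auto simp: map_poly_pCons)
  have q: "poly (poly (q l) [:u:]) t = poly (N (Some l)) t * poly (N' None) u - poly (N None) t * poly (N' (Some l)) u" for l u t
    by (simp add: q_def lift)
  have uniq: "(\<forall>l. poly (poly (q l) [:u:]) t = 0) \<longleftrightarrow> u = w t" if t: "t \<notin> Bad" for t u
  proof -
    have d: "defined_at den t" using t by (auto simp: Bad_def)
    have X0: "poly (N None) t \<noteq> 0" using hom d by (simp add: homogenization_def)
    show ?thesis
    proof
      assume "\<forall>l. poly (poly (q l) [:u:]) t = 0"
      hence z: "poly (N (Some l)) t * poly (N' None) u = poly (N None) t * poly (N' (Some l)) u" for l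
        by (simp add: q)
      have "poly (N' None) u \<noteq> 0"
      proof
        assume "poly (N' None) u = 0"
        hence "poly (N' k) u = 0" for k using z X0 by (cases k) auto
        moreover have "\<exists>k. poly (N' k) u \<noteq> 0"
          using hom' unfolding homogenization_def basepoint_free_def by blast
        ultimately show False by blast
      qed
      hence d': "defined_at den' u" using hom' by (simp add: homogenization_def)
      have "psi_at num' den' u = psi_at num den t"
        unfolding psi_at_eq_iff[OF hom hom' d d'] z by (simp add: mult.commute)
      thus "u = w t" using w_unique[OF t d'] by blast
    next
      assume u: "u = w t"
      hence d': "defined_at den' u" "psi_at num' den' u = psi_at num den t" using w[OF t] by auto
      show "\<forall>l. poly (poly (q l) [:u:]) t = 0"
        using d'(2) unfolding psi_at_eq_iff[OF hom hom' d d'(1)] q by (simp add: mult.commute)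
    qed
  qed
  obtain P Q Bad' where PQ: "Q \<noteq> 0" "finite Bad'" "\<And>t. t \<notin> Bad' \<Longrightarrow> poly Q t \<noteq> 0 \<and> poly P t / poly Q t = w t"
    using unique_solution_rational[OF alg fin uniq] by blast
  have finB: "finite (Bad \<union> Bad')" using fin PQ(2) by simp
  have rep: "poly Q t \<noteq> 0 \<and> defined_at den t \<and> defined_at den' (poly P t / poly Q t) \<and>
       psi_at num' den' (poly P t / poly Q t) = psi_at num den t" if "t \<notin> Bad \<union> Bad'" for t
  proof -
    have "defined_at den t" using that by (auto simp: Bad_def)
    thus ?thesis using that w[of t] PQ(3)[of t] by simp
  qed
  show ?thesis
    using moebius_of_rational_reparametrization[OF alg hom hom' proper PQ(1) finB rep] unfolding N'_def by blast
qed

lemma card_failing_params_le: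
  fixes num den :: "'m::finite \<Rightarrow> 'f::{field_char_0,field_gcd} poly"
  assumes alg: "\<And>p::'f poly. degree p \<ge> 1 \<Longrightarrow> \<exists>x. poly p x = 0"
    and den: "\<And>l. den l \<noteq> 0" and cop: "\<And>l. coprime (num l) (den l)"
    and hom: "homogenization e num den N" and e: "e \<ge> 1" and proper: "proper_param num den"
    and I: "finite I" and aut: "\<And>i. i \<in> I \<Longrightarrow> field_automorphism (s i)"
    and inv: "\<And>i. i \<in> I \<Longrightarrow> conj_set (s i) (param_curve num den) = param_curve num den"
  shows "finite {t. \<exists>i\<in>I. \<not> good_param (s i) num den t} \<and>
     card {t. \<exists>i\<in>I. \<not> good_param (s i) num den t} \<le> e + (e - 2) * (e - 1) + card I"
proof -
  have bpf: "basepoint_free e N" and N0: "N None \<noteq> 0" using hom by (auto simp: homogenization_def)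
  have "\<forall>i\<in>I. \<exists>c f. (c \<noteq> 0 \<or> f \<noteq> 0) \<and> (\<forall>t. defined_at den t \<longrightarrow> \<not> singular_param e N t \<longrightarrow> c * t + f \<noteq> 0 \<longrightarrow> good_param (s i) num den t)"
  proof
    fix i assume i: "i \<in> I"
    obtain a b c f \<kappa> where m: "a * f - b * c \<noteq> 0" "\<kappa> \<noteq> 0"
      "\<And>k. form_subst e (conj_poly (s i) N k) [:b, a:] [:f, c:] = smult \<kappa> (N k)"
      using ex_moebius_relation[OF alg aut[OF i] hom e proper inv[OF i]] by blast
    have "c \<noteq> 0 \<or> f \<noteq> 0" using m(1) by auto
    moreover have "good_param (s i) num den t" if "defined_at den t" "\<not> singular_param e N t" "c * t + f \<noteq> 0" for t
      by (rule good_param_if_not_singular[OF alg aut[OF i] cop den hom m that])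
    ultimately show "\<exists>c f. (c \<noteq> 0 \<or> f \<noteq> 0) \<and> (\<forall>t. defined_at den t \<longrightarrow> \<not> singular_param e N t \<longrightarrow> c * t + f \<noteq> 0 \<longrightarrow> good_param (s i) num den t)"
      by blast
  qed
  then obtain c f where cf: "\<And>i. i \<in> I \<Longrightarrow> c i \<noteq> 0 \<or> f i \<noteq> 0"
    "\<And>i t. i \<in> I \<Longrightarrow> defined_at den t \<Longrightarrow> \<not> singular_param e N t \<Longrightarrow> c i * t + f i \<noteq> 0 \<Longrightarrow> good_param (s i) num den t"
    by metis
  have dbl: "finite (double_params N)"
    using proper unfolding double_params_eq[OF hom] proper_param_def .
  note S = card_singular_params_le[OF alg bpf e N0 dbl]
  define U where "U = {t. \<not> defined_at den t}"
  define S where "S = {t. singular_param e N t}"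
  \<comment> \<open>The poles of the Moebius maps. If \<open>c i = 0\<close>, there is no pole and
    the quotient is 0, a harmless extra element.\<close>
  define V where "V = (\<Union>i\<in>I. {- f i / c i})"
  have finS: "finite S" "card S \<le> (e - 2) * (e - 1)" using S by (auto simp: S_def)
  have U: "finite U" "card U \<le> e" unfolding U_def using finite_undefined[OF hom] by auto
  have V: "finite V" "card V \<le> card I"
    using I card_image_le[OF I, of "\<lambda>i. - f i / c i"] by (auto simp: V_def UNION_singleton_eq_range)
  have "{t. \<exists>i\<in>I. \<not> good_param (s i) num den t} \<subseteq> U \<union> S \<union> V"
  proof
    fix t assume "t \<in> {t. \<exists>i\<in>I. \<not> good_param (s i) num den t}"
    then obtain i where i: "i \<in> I" "\<not> good_param (s i) num den t" by blast
    show "t \<in> U \<union> S \<union> V"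
    proof (rule ccontr)
      assume a: "t \<notin> U \<union> S \<union> V"
      hence z: "c i * t + f i = 0" using cf(2)[OF i(1)] i(2) by (auto simp: U_def S_def)
      hence "c i \<noteq> 0" using cf(1)[OF i(1)] by auto
      moreover have "t * c i = - f i" using z by (simp add: eq_neg_iff_add_eq_0 mult.commute)
      ultimately have "t = - f i / c i" by (metis nonzero_mult_div_cancel_right)
      thus False using a i(1) by (auto simp: V_def)
    qed
  qed
  moreover have "finite (U \<union> S \<union> V)" using U finS V by simp
  moreover have "card (U \<union> S \<union> V) \<le> e + (e - 2) * (e - 1) + card I"
    using card_Un_le[of "U \<union> S" V] card_Un_le[of U S] U finS V by linarith
  ultimately show ?thesis by (meson card_mono finite_subset le_trans)
qed

text \<open>A polynomial function with infinitely many zeros along a parametrized curve vanishes on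
  all of it. Zeros on one curve give infinitely many on the other: fibres of the proper
  parametrization are finite, so infinitely many \<open>u\<close> are hit.\<close>

lemma param_curves_eq:
  fixes num den num' den' :: "'m::finite \<Rightarrow> 'f::field_char_0 poly"
  assumes proper: "proper_param num den" and fin: "finite Bad"
    and rep: "\<And>t. t \<notin> Bad \<Longrightarrow> defined_at den t \<and> (\<exists>u. defined_at den' u \<and> psi_at num' den' u = psi_at num den t)"
  shows "param_curve num den = param_curve num' den'"
proof -
  have inf: "infinite (- Bad)" using fin infinite_UNIV_char_0 by (metis finite_compl)
  have vanish_iff: "(\<forall>t. defined_at den t \<longrightarrow> g (psi_at num den t) = 0) \<longleftrightarrow>
      (\<forall>u. defined_at den' u \<longrightarrow> g (psi_at num' den' u) = 0)" if g: "poly_fun UNIV UNIV g" for g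
  proof
    assume a: "\<forall>u. defined_at den' u \<longrightarrow> g (psi_at num' den' u) = 0"
    have sub: "- Bad \<subseteq> {t. defined_at den t \<and> g (psi_at num den t) = 0}" using a rep by fastforce
    have "infinite {t. defined_at den t \<and> g (psi_at num den t) = 0}"
      using inf finite_subset[OF sub] by blast
    thus "\<forall>t. defined_at den t \<longrightarrow> g (psi_at num den t) = 0"
      using poly_fun_vanish_on_curve[OF g] by blast
  next
    assume a: "\<forall>t. defined_at den t \<longrightarrow> g (psi_at num den t) = 0"
    define Z where "Z = {u. defined_at den' u \<and> g (psi_at num' den' u) = 0}"
    have "infinite Z"
    proof
      assume "finite Z"
      hence "finite (Bad \<union> (\<Union>u\<in>Z. {t. defined_at den t \<and> psi_at num den t = psi_at num' den' u}))"
        using fin finite_fibre[OF proper] by simp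
      moreover have "UNIV = Bad \<union> (\<Union>u\<in>Z. {t. defined_at den t \<and> psi_at num den t = psi_at num' den' u})"
      proof -
        have "t \<in> (\<Union>u\<in>Z. {t. defined_at den t \<and> psi_at num den t = psi_at num' den' u})" if t: "t \<notin> Bad" for t
        proof -
          obtain u where u: "defined_at den' u" "psi_at num' den' u = psi_at num den t" and d: "defined_at den t"
            using rep[OF t] by blast
          hence "u \<in> Z" using a by (simp add: Z_def)
          moreover have "t \<in> {t. defined_at den t \<and> psi_at num den t = psi_at num' den' u}" using u d by simp
          ultimately show ?thesis by blast
        qed
        thus ?thesis by blast
      qed
      ultimately show False using infinite_UNIV_char_0[where 'a = 'f] by simp
    qed
    thus "\<forall>u. defined_at den' u \<longrightarrow> g (psi_at num' den' u) = 0"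
      using poly_fun_vanish_on_curve[OF g] unfolding Z_def by blast
  qed
  have "(\<forall>y\<in>{psi_at num den t |t. defined_at den t}. g y = 0) \<longleftrightarrow>
      (\<forall>y\<in>{psi_at num' den' t |t. defined_at den' t}. g y = 0)" if "poly_fun UNIV UNIV g" for g
    using vanish_iff[OF that] by blast
  thus ?thesis unfolding param_curve_def zar_closure_def by auto
qed

lemma card_fake_params_le:
  fixes num den :: "'m::finite \<Rightarrow> 'f::{field_char_0,field_gcd} poly"
  assumes alg: "\<And>p::'f poly. degree p \<ge> 1 \<Longrightarrow> \<exists>x. poly p x = 0"
    and cop: "\<And>l. coprime (num l) (den l)"
    and hom: "homogenization e num den N" and e: "e \<ge> 1" and proper: "proper_param num den"
    and aut: "field_automorphism s"
    and ne: "conj_set s (param_curve num den) \<noteq> param_curve num den"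
  shows "finite {t. defined_at den t \<and> degree (g_poly s num den t) = 1} \<and>
     card {t. defined_at den t \<and> degree (g_poly s num den t) = 1} \<le> e * e"
proof -
  interpret field_automorphism s by fact
  define N' where "N' = conj_poly s N"
  define num' where "num' = conj_poly s num"
  define den' where "den' = conj_poly s den"
  have hom': "homogenization e num' den' N'"
    unfolding N'_def num'_def den'_def by (rule homogenization_conj[OF hom])
  have deg: "degree (N k) \<le> e" "degree (N' k) \<le> e" for k
    using hom hom' by (auto simp: homogenization_def basepoint_free_def)
  define Bad where "Bad = {t. \<not> defined_at den t} \<union> {t. defined_at den t \<and> point_at_infinity e N' (psi_at num den t)}"
  have fin: "finite Bad" unfolding Bad_def
    using finite_undefined(1)[OF hom] finite_params_at_infinity[OF proper] by simp
  \<comment> \<open>Otherwise almost all points of the curve lie on the conjugate image and the two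
    curves agree. The point of \<open>t1\<close> is the centre of projection and certifies that the
    determinant is not identically zero.\<close>
  have "\<exists>t. t \<notin> Bad \<and> (\<forall>u. defined_at den' u \<longrightarrow> psi_at num' den' u \<noteq> psi_at num den t)"
  proof (rule ccontr)
    assume "\<not> ?thesis"
    hence "defined_at den t \<and> (\<exists>u. defined_at den' u \<and> psi_at num' den' u = psi_at num den t)" if "t \<notin> Bad" for t
      using that by (auto simp: Bad_def)
    hence "param_curve num den = param_curve num' den'" by (rule param_curves_eq[OF proper fin])
    thus False using ne conj_set_param_curve[of num den] by (simp add: num'_def den'_def)
  qed
  then obtain t1 where t1: "t1 \<notin> Bad" "\<And>u. defined_at den' u \<Longrightarrow> psi_at num den t1 \<noteq> psi_at num' den' u" by metis
  have d1: "defined_at den t1" and inf1: "\<not> point_at_infinity e N' (psi_at num den t1)" using t1(1) by (auto simp: Bad_def)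
  define X where "X = case_option 1 (psi_at num den t1)"
  have X0: "X None \<noteq> 0" by (simp add: X_def)
  have bpfX: "basepoint_free e (project_from X N')"
    unfolding X_def by (rule basepoint_free_project_from[OF hom' t1(2) inf1])
  obtain c where c: "\<And>u \<kappa>. det (mat e e (\<lambda>(i, j). \<Sum>k\<in>UNIV. c i j k * (\<kappa> * poly (N' k) u))) = 0"
    "det (mat e e (\<lambda>(i, j). \<Sum>k\<in>UNIV. c i j k * X k)) \<noteq> 0"
    using implicit_determinant[of X e N', OF alg X0 e deg(2) bpfX] by blast
  \<comment> \<open>The implicit matrix of the conjugate curve along the given curve: its size and
    the degree of its entries are each at most \<open>e\<close>, hence \<open>e * e\<close>.\<close>
  define M where "M = (\<lambda>i j. lin_comb (c i j) N)"
  show ?thesis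
  proof (rule card_det_roots_le[of e M e t1])
    show "degree (M i j) \<le> e" for i j unfolding M_def by (rule degree_lin_comb_le[OF deg(1)])
    have nz: "poly (N None) t1 \<noteq> 0" using hom d1 by (simp add: homogenization_def)
    have NX: "poly (N k) t1 = poly (N None) t1 * X k" for k
      using homogenization_at[OF hom d1] by (cases k) (simp_all add: X_def mult.commute)
    have "poly (M i j) t1 = poly (N None) t1 * (\<Sum>k\<in>UNIV. c i j k * X k)" for i j
      unfolding M_def poly_lin_comb sum_distrib_left
      by (intro sum.cong refl) (subst NX, rule mult.left_commute)
    hence "mat e e (\<lambda>(i, j). poly (M i j) t1) = poly (N None) t1 \<cdot>\<^sub>m mat e e (\<lambda>(i, j). \<Sum>k\<in>UNIV. c i j k * X k)"
      by (intro eq_matI) auto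
    thus "det (mat e e (\<lambda>(i, j). poly (M i j) t1)) \<noteq> 0" using c(2) nz by simp
  next
    fix t assume "t \<in> {t. defined_at den t \<and> degree (g_poly s num den t) = 1}"
    hence d: "defined_at den t" and "degree (g_poly s num den t) = 1" by auto
    then obtain u where "poly (g_poly s num den t) u = 0" using alg[of "g_poly s num den t"] by auto
    hence u: "defined_at den' u" "psi_at num' den' u = psi_at num den t"
      unfolding poly_g_poly_eq_0_iff[OF aut cop] num'_def den'_def by auto
    have nz: "poly (N' None) u \<noteq> 0" using hom' u(1) by (simp add: homogenization_def)
    define \<kappa> where "\<kappa> = poly (N None) t / poly (N' None) u"
    have "poly (N k) t = \<kappa> * poly (N' k) u" for k
      using nz u(2) unfolding psi_at_eq_iff[OF hom hom' d u(1)]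
      by (cases k) (simp_all add: \<kappa>_def field_simps)
    hence "poly (M i j) t = (\<Sum>k\<in>UNIV. c i j k * (\<kappa> * poly (N' k) u))" for i j by (simp add: M_def)
    thus "det (mat e e (\<lambda>(i, j). poly (M i j) t)) = 0" using c(1)[of \<kappa> u] by simp
  qed
qed

section \<open>The hypercircle\<close>

text \<open>On the hypercircle only \<open>F 0 l\<close> survives, and it is fixed by \<open>s\<close>; hence applying \<open>s\<close> to the
  defining identity replaces \<open>a\<close> by \<open>s a\<close> without changing the value.\<close>

lemma hyper_preset_conj_identity:
  fixes num den :: "'m \<Rightarrow> 'f::field poly"
  assumes aut: "K_automorphism K s" and n: "n > 0" and hd: "hyper_data K a n num den F D"
    and T: "T \<in> hyper_preset n F D"
  shows "poly (conj_poly s num l) (\<Sum>k<n. s a ^ k * T k) * poly (den l) (\<Sum>k<n. a ^ k * T k)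
       = poly (conj_poly s den l) (\<Sum>k<n. s a ^ k * T k) * poly (num l) (\<Sum>k<n. a ^ k * T k)"
proof -
  interpret field_automorphism s using aut by (rule K_automorphism_imp_field_automorphism)
  have TA: "T \<in> aff_space n" and D: "D T \<noteq> 0" and F0: "\<And>k. 1 \<le> k \<Longrightarrow> k < n \<Longrightarrow> F k l T = 0"
    using T by (auto simp: hyper_preset_def)
  have id: "D T * poly (num l) (\<Sum>k<n. a ^ k * T k) = poly (den l) (\<Sum>k<n. a ^ k * T k) * (\<Sum>k<n. a ^ k * F k l T)"
    if "T \<in> aff_space n" for T using hd that by (auto simp: hyper_data_def)
  have pD: "poly_fun {..<n} K D" and pF: "\<And>k. k < n \<Longrightarrow> poly_fun {..<n} K (F k l)"
    using hd by (auto simp: hyper_data_def)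
  have only0: "(\<Sum>k<n. x ^ k * F k l T) = F 0 l T" for x
  proof -
    have "(\<Sum>k<n. x ^ k * F k l T) = (\<Sum>k<n. if k = 0 then F 0 l T else 0)"
      by (rule sum.cong) (use F0 in auto)
    thus ?thesis using n by simp
  qed
  \<comment> \<open>The defining identity is used at the preimage \<open>T'\<close>: applying
    \<open>s\<close> then returns to \<open>T\<close>, conjugates the parametrization and replaces
    \<open>a\<close> by \<open>s a\<close>, while \<open>D\<close> and \<open>F\<close> have
    coefficients in \<open>K\<close>.\<close>
  define T' where "T' = inv_into UNIV s \<circ> T"
  have sT': "s (T' k) = T k" for k by (simp add: T'_def inv_s)
  have comp: "s \<circ> T' = T" by (auto simp: sT')
  have "T' k = 0" if "k \<ge> n" for k
    using sT'[of k] TA that by (simp add: aff_space_def)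
  hence T'A: "T' \<in> aff_space n" by (simp add: aff_space_def)
  have ssum: "s (\<Sum>k<n. a ^ k * T' k) = (\<Sum>k<n. s a ^ k * T k)" by (simp add: sum mult power sT')
  have "s (D T') = D T"
    using poly_fun_fixed[OF pD K_automorphism_fixes[OF aut], of T'] comp by simp
  moreover have "s (\<Sum>k<n. a ^ k * F k l T') = F 0 l T"
  proof -
    have "s (F k l T') = F k l T" if "k < n" for k
      using poly_fun_fixed[OF pF[OF that] K_automorphism_fixes[OF aut], of T'] comp by simp
    hence "s (\<Sum>k<n. a ^ k * F k l T') = (\<Sum>k<n. s a ^ k * F k l T)" by (simp add: sum mult power)
    thus ?thesis unfolding only0 .
  qed
  ultimately have 1: "D T * poly (conj_poly s num l) (\<Sum>k<n. s a ^ k * T k)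
      = poly (conj_poly s den l) (\<Sum>k<n. s a ^ k * T k) * F 0 l T" (is "_ * ?x = ?y * _")
    using arg_cong[OF id[OF T'A], of s] unfolding mult poly_map[symmetric] ssum conj_poly_def by simp
  have 2: "D T * poly (num l) (\<Sum>k<n. a ^ k * T k) = poly (den l) (\<Sum>k<n. a ^ k * T k) * F 0 l T"
      (is "_ * ?u = ?v * _")
    using id[OF TA] unfolding only0 .
  have "D T * (?x * ?v) = ?y * F 0 l T * ?v" unfolding 1[symmetric] by (simp only: mult.assoc)
  also have "\<dots> = ?y * (D T * ?u)" unfolding 2 by (simp only: ac_simps)
  finally have "D T * (?x * ?v) = D T * (?y * ?u)" by (simp only: ac_simps)
  thus ?thesis using D by simp
qed

text \<open>The identity is polynomial in \<open>T\<close>, so it extends to the closure and thus to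
  the hypercircle. Along the standard parametrization the sum with powers of \<open>a\<close> is
  \<open>t\<close>, and the sum with powers of \<open>s a\<close> is the value of
  \<open>u_map\<close>.\<close>

lemma u_map_conj_identity:
  fixes num den :: "'m \<Rightarrow> 'f::field poly"
  assumes aut: "K_automorphism K s" and n: "n > 0" and hd: "hyper_data K a n num den F D"
    and U: "U \<subseteq> zar_closure {..<n} (aff_space n) (hyper_preset n F D)"
    and sp: "std_param a n U pn pd" and t: "rat_vec_defined n pd t"
  shows "poly (conj_poly s num l) (u_map (s a) n pn pd t) * poly (den l) t
       = poly (conj_poly s den l) (u_map (s a) n pn pd t) * poly (num l) t"
proof -
  define h where "h = (\<lambda>T. poly (conj_poly s num l) (\<Sum>k<n. s a ^ k * T k) * poly (den l) (\<Sum>k<n. a ^ k * T k)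
       - poly (conj_poly s den l) (\<Sum>k<n. s a ^ k * T k) * poly (num l) (\<Sum>k<n. a ^ k * T k))"
  have "poly_fun {..<n} UNIV (\<lambda>T. \<Sum>k<n. x ^ k * T k)" for x :: 'f
    by (intro poly_fun_sum poly_fun_mult poly_fun_const poly_fun_coord) auto
  hence ph: "poly_fun {..<n} UNIV h" unfolding h_def
    by (intro poly_fun_diff poly_fun_mult poly_fun_poly)
  have "h T = 0" if "T \<in> hyper_preset n F D" for T
    using hyper_preset_conj_identity[OF aut n hd that] by (simp add: h_def)
  hence hU: "h T = 0" if "T \<in> U" for T
    using U that ph unfolding zar_closure_def by blast
  let ?T = "rat_vec_at n pn pd t"
  have "?T \<in> aff_space n" by (simp add: aff_space_def rat_vec_at_def)
  hence "?T \<in> U" using sp t unfolding std_param_def zar_closure_def by blast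
  hence "h ?T = 0" by (rule hU)
  moreover have "(\<Sum>k<n. a ^ k * ?T k) = t" using sp t by (simp add: std_param_def)
  ultimately show ?thesis by (simp add: h_def u_map_def)
qed

lemma u_map_eq_rational:
  assumes pd: "\<And>k. k < n \<Longrightarrow> pd k \<noteq> 0"
  shows "\<exists>P Q. Q \<noteq> 0 \<and> (\<forall>t. rat_vec_defined n pd t \<longleftrightarrow> poly Q t \<noteq> 0) \<and>
     (\<forall>t. rat_vec_defined n pd t \<longrightarrow> u_map x n pn pd t = poly P t / poly Q t)"
proof -
  define Q where "Q = (\<Prod>k<n. pd k)"
  define P where "P = (\<Sum>k<n. smult (x ^ k) (pn k * (\<Prod>j\<in>{..<n}-{k}. pd j)))"
  have def_iff: "rat_vec_defined n pd t \<longleftrightarrow> poly Q t \<noteq> 0" for t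
    by (auto simp: rat_vec_defined_def Q_def poly_prod)
  have "u_map x n pn pd t = poly P t / poly Q t" if t: "rat_vec_defined n pd t" for t
  proof -
    have "x ^ k * rat_vec_at n pn pd t k = x ^ k * (poly (pn k) t * poly (\<Prod>j\<in>{..<n}-{k}. pd j) t) / poly Q t"
      if "k < n" for k
    proof -
      have "Q = pd k * (\<Prod>j\<in>{..<n}-{k}. pd j)" unfolding Q_def using that by (intro prod.remove) auto
      hence "poly Q t = poly (pd k) t * poly (\<Prod>j\<in>{..<n}-{k}. pd j) t" by (simp only: poly_mult)
      moreover have "poly Q t \<noteq> 0" using t def_iff by blast
      ultimately show ?thesis using that by (auto simp: rat_vec_at_def)
    qed
    thus ?thesis by (simp add: u_map_def P_def poly_sum sum_divide_distrib)
  qed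
  moreover have "Q \<noteq> 0" using pd by (simp add: Q_def)
  ultimately show ?thesis using def_iff by blast
qed

lemma moebius_interpolation:
  fixes num den :: "'m::finite \<Rightarrow> 'f::{field_char_0,field_gcd} poly"
  assumes alg: "\<And>p::'f poly. degree p \<ge> 1 \<Longrightarrow> \<exists>x. poly p x = 0"
    and aut: "K_automorphism K s" and n: "n > 0"
    and den: "\<And>l. den l \<noteq> 0" and cop: "\<And>l. coprime (num l) (den l)" and proper: "proper_param num den"
    and hd: "hyper_data K \<alpha> n num den F D"
    and U: "U \<subseteq> zar_closure {..<n} (aff_space n) (hyper_preset n F D)"
    and sp: "std_param \<alpha> n U pn pd"
    and tinj: "inj_on t {1, 2, 3::nat}"
    and tj: "\<And>j. j \<in> {1, 2, 3} \<Longrightarrow> defined_at den (t j) \<and>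
             {u. defined_at (conj_poly s den) u \<and>
                  psi_at (conj_poly s num) (conj_poly s den) u = psi_at num den (t j)} = {v j} \<and>
             differs_from_inf s num den (t j)"
  shows "(\<exists>a b c e. mobius_interp a b c e t v) \<and>
         (\<forall>a b c e. mobius_interp a b c e t v \<longrightarrow>
            (\<forall>x. rat_vec_defined n pd x \<longrightarrow> c * x + e \<noteq> 0 \<longrightarrow>
                 u_map (s \<alpha>) n pn pd x = (a * x + b) / (c * x + e)))"
proof -
  have aut': "field_automorphism s" using aut by (rule K_automorphism_imp_field_automorphism)
  interpret field_automorphism s by fact
  obtain d N where hom: "homogenization d num den N" using ex_homogenization[where num = num and den = den, OF den cop] by blast
  define N' where "N' = conj_poly s N"
  define num' where "num' = conj_poly s num"
  define den' where "den' = conj_poly s den"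
  have hom': "homogenization d num' den' N'"
    unfolding N'_def num'_def den'_def by (rule homogenization_conj[OF hom])
  have bpf': "basepoint_free d N'" using hom' by (simp add: homogenization_def)
  have pd: "pd k \<noteq> 0" if "k < n" for k using sp that by (simp add: std_param_def)
  obtain P Q where Q0: "Q \<noteq> 0" and Q: "\<And>t. rat_vec_defined n pd t \<longleftrightarrow> poly Q t \<noteq> 0"
    and PQ: "\<And>t. rat_vec_defined n pd t \<Longrightarrow> u_map (s \<alpha>) n pn pd t = poly P t / poly Q t"
    using u_map_eq_rational[of n pd "s \<alpha>" pn, OF pd] by blast
  define Bad where "Bad = {t. poly Q t = 0} \<union> {t. \<not> defined_at den t}"
  have fin: "finite Bad" unfolding Bad_def using Q0 poly_roots_finite finite_undefined(1)[OF hom] by blast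
  have rep: "poly Q t \<noteq> 0 \<and> defined_at den t \<and> defined_at den' (poly P t / poly Q t) \<and>
       psi_at num' den' (poly P t / poly Q t) = psi_at num den t" if t: "t \<notin> Bad" for t
  proof -
    have Qt: "poly Q t \<noteq> 0" and d: "defined_at den t" using t by (auto simp: Bad_def)
    define u where "u = poly P t / poly Q t"
    have id: "poly (num' l) u * poly (den l) t = poly (den' l) u * poly (num l) t" for l
      using u_map_conj_identity[OF aut n hd U sp, of t] Q Qt PQ by (simp add: u_def num'_def den'_def)
    have dn: "poly (den l) t \<noteq> 0" for l using d by (simp add: defined_at_def)
    have dn': "poly (den' l) u \<noteq> 0" for l
    proof
      assume z: "poly (den' l) u = 0"
      hence "poly (num' l) u = 0" using id[of l] dn[of l] by simp
      thus False using z coprime_no_common_root[OF cop, of l]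
        unfolding num'_def den'_def conj_poly_def poly_map_eq_0 by blast
    qed
    hence "psi_at num' den' u = psi_at num den t"
      using id dn by (auto simp: psi_at_def fun_eq_iff field_simps)
    thus ?thesis using Qt d dn' unfolding u_def by (simp add: defined_at_def)
  qed
  obtain a b c f \<kappa> where m: "a * f - b * c \<noteq> 0" and PQm: "P * [:f, c:] = Q * [:b, a:]" and \<kappa>: "\<kappa> \<noteq> 0"
    and T: "\<And>k. form_subst d (N' k) [:b, a:] [:f, c:] = smult \<kappa> (N k)"
    using moebius_of_rational_reparametrization[OF alg hom hom' proper Q0 fin rep] by blast
  have interp: "c * t j + f \<noteq> 0 \<and> (a * t j + b) / (c * t j + f) = v j" if j: "j \<in> {1, 2, 3}" for j
  proof -
    have d: "defined_at den (t j)"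
      and v: "{u. defined_at den' u \<and> psi_at num' den' u = psi_at num den (t j)} = {v j}"
      and diff: "differs_from_inf s num den (t j)" using tj[OF j] by (auto simp: num'_def den'_def)
    \<comment> \<open>At the pole of the Moebius map the point of \<open>t j\<close> would be the
      image of infinity, which \<open>differs_from_inf\<close> excludes.\<close>
    have nz: "c * t j + f \<noteq> 0"
    proof
      assume "c * t j + f = 0"
      hence "point_at_infinity d N' (psi_at num den (t j))"
        by (rule moebius_relation_at_infinity[OF \<kappa> T hom d])
      hence "\<not> differs_from_inf s num den (t j)"
        unfolding differs_from_inf_def using point_at_infinity_iff[OF hom'] den
        by (simp add: num'_def den'_def conj_poly_def)
      thus False using diff by blast
    qed
    have "(a * t j + b) / (c * t j + f) \<in> {u. defined_at den' u \<and> psi_at num' den' u = psi_at num den (t j)}"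
      using moebius_relation_at[OF bpf' \<kappa> T hom hom' d nz] by blast
    thus ?thesis using nz v by simp
  qed
  have "mobius_interp a b c f t v" unfolding mobius_interp_def using m interp by blast
  moreover have "u_map (s \<alpha>) n pn pd x = (a' * x + b') / (c' * x + e')"
    if mi: "mobius_interp a' b' c' e' t v" and x: "rat_vec_defined n pd x" "c' * x + e' \<noteq> 0" for a' b' c' e' x
  proof -
    \<comment> \<open>Equality of the two Moebius maps is cross-multiplied into one of polynomials
      of degree at most 2, which three distinct nodes decide.\<close>
    define A where "A = [:b, a:] * [:e', c':]"
    define B where "B = [:b', a':] * [:f, c:]"
    have "A = B"
    proof (rule poly_eqI_degree[of "t ` {1, 2, 3}"])
      fix y assume "y \<in> t ` {1, 2, 3}"
      then obtain j where j: "j \<in> {1, 2, 3}" "y = t j" by blast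
      have 1: "c * y + f \<noteq> 0" "(a * y + b) / (c * y + f) = v j" using interp[OF j(1)] j(2) by auto
      have 2: "c' * y + e' \<noteq> 0" "(a' * y + b') / (c' * y + e') = v j" using mi j unfolding mobius_interp_def by auto
      have "(a * y + b) * (c' * y + e') = (a' * y + b') * (c * y + f)"
        using 1 2 by (metis frac_eq_eq)
      moreover have "poly A y = (a * y + b) * (c' * y + e')" "poly B y = (a' * y + b') * (c * y + f)"
        unfolding A_def B_def poly_mult by (simp_all add: algebra_simps)
      ultimately show "poly A y = poly B y" by simp
    next
      have card3: "card (t ` {1, 2, 3}) = 3" using card_image[OF tinj] by simp
      have "degree A \<le> 1 + 1" unfolding A_def
        by (rule order_trans[OF degree_mult_le]) (intro add_mono, auto)
      thus "degree A < card (t ` {1, 2, 3})" using card3 by simp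
      have "degree B \<le> 1 + 1" unfolding B_def
        by (rule order_trans[OF degree_mult_le]) (intro add_mono, auto)
      thus "degree B < card (t ` {1, 2, 3})" using card3 by simp
    qed
    hence eq: "(a * x + b) * (c' * x + e') = (a' * x + b') * (c * x + f)"
      using arg_cong[of A B "\<lambda>p. poly p x"] unfolding A_def B_def poly_mult by (simp add: ac_simps)
    have Px: "poly P x * (c * x + f) = poly Q x * (a * x + b)"
      using arg_cong[OF PQm, of "\<lambda>p. poly p x"] unfolding poly_mult by (simp add: ac_simps)
    have Qx: "poly Q x \<noteq> 0" using Q x by blast
    have nz: "c * x + f \<noteq> 0"
    proof
      assume z: "c * x + f = 0"
      hence "a * x + b = 0" using Px Qx by simp
      hence "b = - (a * x)" "f = - (c * x)" using z by (simp_all add: eq_neg_iff_add_eq_0 add.commute)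
      thus False using m by simp
    qed
    have "u_map (s \<alpha>) n pn pd x = poly P x / poly Q x" by (rule PQ[OF x(1)])
    also have "\<dots> = (a * x + b) / (c * x + f)" using Px Qx nz by (simp add: frac_eq_eq mult.commute)
    also have "\<dots> = (a' * x + b') / (c' * x + e')" using eq x(2) nz by (simp add: frac_eq_eq)
    finally show ?thesis .
  qed
  ultimately show ?thesis by blast
qed

theorem theorem3:
  fixes K :: "'f::{field_char_0,field_gcd} set"
    and alpha :: 'f and n :: nat
    and sigma :: "nat \<Rightarrow> 'f \<Rightarrow> 'f"
    and num den :: "'m::finite \<Rightarrow> 'f poly"
    and d :: nat
  assumes closure: "is_alg_closure_of K"
    and alpha_deg: "alg_degree K alpha n"
    and sigma_aut: "\<forall>i<n. K_automorphism K (sigma i)"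
    and sigma0: "sigma 0 alpha = alpha"
    and conjugates: "inj_on (\<lambda>i. sigma i alpha) {..<n}"
    and coeffs: "\<forall>l. poly_over (simple_ext K alpha) (num l) \<and> poly_over (simple_ext K alpha) (den l)"
    and den_nz: "\<forall>l. den l \<noteq> 0"
    and reduced: "\<forall>l. coprime (num l) (den l)"
    and proper: "proper_param num den"
    and degC: "curve_degree (param_curve num den) d"
  shows
   "(defined_over K (param_curve num den) \<longrightarrow>
      (\<forall>i<n. \<forall>F D U pn pd t s.
         hyper_data K alpha n num den F D \<longrightarrow>
         zar_component {..<n} (aff_space n)
            (zar_closure {..<n} (aff_space n) (hyper_preset n F D)) U \<longrightarrow>
         zar_dim_one {..<n} (aff_space n) U \<longrightarrow>
         std_param alpha n U pn pd \<longrightarrow>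
         inj_on t {1,2,3} \<longrightarrow>
         (\<forall>j\<in>{1,2,3}. defined_at den (t j) \<and>
             {s'. defined_at (conj_poly (sigma i) den) s' \<and>
                  psi_at (conj_poly (sigma i) num) (conj_poly (sigma i) den) s' = psi_at num den (t j)}
               = {s j} \<and>
             differs_from_inf (sigma i) num den (t j)) \<longrightarrow>
         (\<exists>a b c e. mobius_interp a b c e t s) \<and>
         (\<forall>a b c e. mobius_interp a b c e t s \<longrightarrow>
            (\<forall>x. rat_vec_defined n pd x \<longrightarrow> c * x + e \<noteq> 0 \<longrightarrow>
                 u_map (sigma i alpha) n pn pd x = (a * x + b) / (c * x + e)))))
    \<and>
    (defined_over K (param_curve num den) \<longrightarrow>
      finite {t0. \<exists>i\<in>{1..<n}. \<not> good_param (sigma i) num den t0} \<and>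
      card {t0. \<exists>i\<in>{1..<n}. \<not> good_param (sigma i) num den t0} \<le> d^2 + n + 1 - 2 * d)
    \<and>
    (\<forall>i<n. \<not> defined_over K (param_curve num den) \<longrightarrow>
        param_curve num den \<noteq> conj_set (sigma i) (param_curve num den) \<longrightarrow>
        finite {t0. defined_at den t0 \<and> degree (g_poly (sigma i) num den t0) = 1} \<and>
        card {t0. defined_at den t0 \<and> degree (g_poly (sigma i) num den t0) = 1} \<le> d^2)"
proof -
  have alg: "\<exists>x. poly p x = 0" if "degree p \<ge> 1" for p :: "'f poly"
    using closure that unfolding is_alg_closure_of_def by blast
  have den: "den l \<noteq> 0" and cop: "coprime (num l) (den l)" for l using den_nz reduced by auto
  have autK: "K_automorphism K (sigma i)" if "i < n" for i using sigma_aut that by blast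
  have aut: "field_automorphism (sigma i)" if "i < n" for i
    by (rule K_automorphism_imp_field_automorphism[OF autK[OF that]])
  obtain e N where hom: "homogenization e num den N"
    using ex_homogenization[where num = num and den = den, OF den cop] by blast
  have e: "e \<ge> 1" by (rule homogenization_degree_pos[OF hom proper])
  have ed: "e \<le> d" using homogenization_degree_le[OF alg hom proper degC] .
  show ?thesis
  proof (intro conjI impI)
    assume "defined_over K (param_curve num den)"
    show "\<forall>i<n. \<forall>F D U pn pd t s.
         hyper_data K alpha n num den F D \<longrightarrow>
         zar_component {..<n} (aff_space n)
            (zar_closure {..<n} (aff_space n) (hyper_preset n F D)) U \<longrightarrow>
         zar_dim_one {..<n} (aff_space n) U \<longrightarrow>
         std_param alpha n U pn pd \<longrightarrow>
         inj_on t {1, 2, 3} \<longrightarrow>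
         (\<forall>j\<in>{1, 2, 3}. defined_at den (t j) \<and>
             {s'. defined_at (conj_poly (sigma i) den) s' \<and>
                  psi_at (conj_poly (sigma i) num) (conj_poly (sigma i) den) s' = psi_at num den (t j)}
               = {s j} \<and>
             differs_from_inf (sigma i) num den (t j)) \<longrightarrow>
         (\<exists>a b c e. mobius_interp a b c e t s) \<and>
         (\<forall>a b c e. mobius_interp a b c e t s \<longrightarrow>
            (\<forall>x. rat_vec_defined n pd x \<longrightarrow> c * x + e \<noteq> 0 \<longrightarrow>
                 u_map (sigma i alpha) n pn pd x = (a * x + b) / (c * x + e)))"
    proof (intro allI impI, goal_cases)
      case (1 i F D U pn pd t s)
      have "U \<subseteq> zar_closure {..<n} (aff_space n) (hyper_preset n F D)"
        using 1(3) unfolding zar_component_def by blast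
      moreover have "n > 0" using 1(1) by simp
      ultimately show ?case
        using moebius_interpolation[OF alg autK[OF 1(1)] _ den cop proper 1(2) _ 1(5,6), of s] 1(7) by blast
    qed
  next
    assume "defined_over K (param_curve num den)"
    hence inv: "conj_set (sigma i) (param_curve num den) = param_curve num den" if "i < n" for i
      using field_automorphism.conj_set_defined_over[OF aut[OF that]] K_automorphism_fixes[OF autK[OF that]] by blast
    have fail: "finite {t0. \<exists>i\<in>{1..<n}. \<not> good_param (sigma i) num den t0} \<and>
        card {t0. \<exists>i\<in>{1..<n}. \<not> good_param (sigma i) num den t0} \<le> e + (e - 2) * (e - 1) + card {1..<n}"
      by (rule card_failing_params_le[OF alg den cop hom e proper]) (auto simp: aut inv)
    show "finite {t0. \<exists>i\<in>{1..<n}. \<not> good_param (sigma i) num den t0}" using fail by blast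
    show "card {t0. \<exists>i\<in>{1..<n}. \<not> good_param (sigma i) num den t0} \<le> d^2 + n + 1 - 2 * d"
    \<comment> \<open>For \<open>n = 0\<close> truncation makes \<open>card {1..<n}\<close> equal to
      0 instead of -1 and would spoil the estimate; for \<open>n \<le> 1\<close> there is no index
      and the set is empty.\<close>
    proof (cases "n \<le> 1")
      case True
      hence "{t0. \<exists>i\<in>{1..<n}. \<not> good_param (sigma i) num den t0} = {}" by auto
      thus ?thesis by (metis card.empty le0)
    next
      case False
      obtain k where k: "e = Suc k" using e by (cases e) auto
      obtain m where m: "d = Suc m" using e ed by (cases d) auto
      \<comment> \<open>With \<open>k = e - 1\<close> and \<open>m = d - 1\<close> the bound
        obtained is \<open>k * k + n\<close> and the bound claimed is
        \<open>m * m + n\<close>.\<close>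
      have "(e - 2) * (e - 1) + e = k * k + 1" unfolding k by (cases k) auto
      moreover have "k * k \<le> m * m" using ed unfolding k m by (intro mult_mono) auto
      moreover have "d^2 + n + 1 - 2 * d = m * m + n" unfolding m by (simp add: power2_eq_square)
      moreover have "card {1..<n} = n - 1" by simp
      ultimately show ?thesis using conjunct2[OF fail] False by linarith
    qed
  next
    show "\<forall>i<n. \<not> defined_over K (param_curve num den) \<longrightarrow>
        param_curve num den \<noteq> conj_set (sigma i) (param_curve num den) \<longrightarrow>
        finite {t0. defined_at den t0 \<and> degree (g_poly (sigma i) num den t0) = 1} \<and>
        card {t0. defined_at den t0 \<and> degree (g_poly (sigma i) num den t0) = 1} \<le> d^2"
    proof (intro allI impI)
      fix i assume i: "i < n" and ne: "param_curve num den \<noteq> conj_set (sigma i) (param_curve num den)"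
      have "e * e \<le> d^2" using ed by (simp add: power2_eq_square mult_mono)
      thus "finite {t0. defined_at den t0 \<and> degree (g_poly (sigma i) num den t0) = 1} \<and>
        card {t0. defined_at den t0 \<and> degree (g_poly (sigma i) num den t0) = 1} \<le> d^2"
        using card_fake_params_le[OF alg cop hom e proper aut[OF i]] ne by (metis (no_types, lifting) le_trans)
    qed
  qed
qed

end
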